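(* Let $\phi$ be a Szeg\H{o}-type symbol, $a\in\mathbb C$, let $d_1,\dots,d_{m_1}$ and $c_1,\dots,c_{m_2}$ be complex numbers that do not lie on the unit circle, and let $A_j,B_k\in\mathbb C$. Put $$\psi(z)=\sum_{j=1}^{m_1}\frac{A_j}{z-d_j},\qquad\eta(z)=\sum_{k=1}^{m_2}\frac{B_k}{z-c_k}.$$ Then, as $n\to\infty$, $$\mathscr H_{n+1}[\phi;\psi,\eta;a]=G[\phi]^nE[\phi]\left(a+O(\rho^{-n})\right),\qquad\mathscr L_{n+1}[\phi;\psi,\eta;a]=G[\phi]^nE[\phi]\left(a+O(\rho^{-n})\right),$$ $$\mathscr E_{n+1}[\phi;\psi,\eta;a]=G[\phi]^nE[\phi]\Bigg(a+\sum_{\substack{1\le j\le m_1\\|d_j|>1}}\ \sum_{\substack{1\le k\le m_2\\|c_k|>1}}A_jB_k\frac{\alpha(c_k)}{\alpha(d_j^{-1})}\cdot\frac1{1-c_kd_j}+O(\rho^{-n})\Bigg),$$ $$\mathscr G_{n+1}[\phi;\psi,\eta;a]=G[\phi]^nE[\phi]\Bigg(a+\sum_{\substack{1\le j\le m_1\\|d_j|>1}}\ \sum_{\substack{1\le k\le m_2\\|c_k|>1}}A_jB_k\frac{\alpha(d_j)}{\alpha(c_k^{-1})}\cdot\frac1{1-c_kd_j}+O(\rho^{-n})\Bigg).$$ Here $\rho>1$ is a number such that every $\lambda\in\{d_1,\dots,d_{m_1},c_1,\dots,c_{m_2}\}$ satisfies $\rho<|\lambda|$ if $|\lambda|>1$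 and $|\lambda|<\rho^{-1}$ if $|\lambda|<1$, and $\phi$ is analytic in the annulus $\{z:\rho^{-1}<|z|<\rho\}$.
   Context: $\mathbb T$ is the unit circle oriented counterclockwise; $f_j=[f]_j=\int_{\mathbb T}f(\zeta)\zeta^{-j}\frac{d\zeta}{2\pi i\zeta}$. A symbol $\phi$ is of Szeg\H{o}-type if it is $C^\infty$ and nonzero on $\mathbb T$, has zero winding number, and admits an analytic continuation to some neighborhood of $\mathbb T$. $G[\phi]=\exp([\log\phi]_0)$, $E[\phi]=\exp\big(\sum_{k\ge1}k[\log\phi]_k[\log\phi]_{-k}\big)$, $\alpha(z)=\exp\left[\frac1{2\pi i}\int_{\mathbb T}\frac{\ln\phi(\tau)}{\tau-z}d\tau\right]$ for $z\notin\mathbb T$. Semi-framed determinants: for $N\ge2$ each of $\mathscr E_N,\mathscr G_N,\mathscr H_N,\mathscr L_N[\phi;\psi,\eta;a]$ is the determinant of an $N\times N$ matrix whose upper-left $(N-1)\times(N-1)$ block is $(\phi_{j-k})_{0\le j,k\le N-2}$, whose lower-right entry is $a$, and whose remaining last-column entries (row $j$, $0\le j\le N-2$) and last-row entries (column $k$, $0\le k\le N-2$) are: for $\mathscr E_N$: $\psi_{N-2-j}$ and $\eta_{N-2-k}$; for $\mathscr G_N$: $\psi_j$ and $\eta_k$; for $\mathscr H_N$: $\psi_j$ and $\eta_{N-2-k}$; for $\mathscr L_N$: $\psi_{N-2-j}$ and $\eta_k$.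
   Formalization: The number ρ is required to be such that φ is analytic and nonzero on the closed annulus ρ^{-1} ≤ |z| ≤ ρ (not only analytic in the open one), since otherwise the error O(ρ^{-n}) can fail; existence of such a ρ is also proved. *)

theory Defs
  imports
    "HOL-Complex_Analysis.Complex_Analysis"
    "HOL-Library.Landau_Symbols"
    "Jordan_Normal_Form.Determinant"
begin

text \<open>
  A symbol is a function on the unit circle. It is represented by a total function
  \<^typ>\<open>complex \<Rightarrow> complex\<close>, of which only the values on \<^term>\<open>sphere (0::complex) 1\<close> are used;
  analytic continuations are separate functions agreeing with it on the circle.
\<close>

definition fourier_coeff :: "(complex \<Rightarrow> complex) \<Rightarrow> int \<Rightarrow> complex" where
  "fourier_coeff f j =
     contour_integral (circlepath 0 1) (\<lambda>\<zeta>. f \<zeta> * \<zeta> powi (- j) / (2 * of_real pi * \<i> * \<zeta>))"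

definition smooth_on_circle :: "(complex \<Rightarrow> complex) \<Rightarrow> bool" where
  "smooth_on_circle f \<longleftrightarrow>
     (\<exists>D :: nat \<Rightarrow> real \<Rightarrow> complex.
        D 0 = (\<lambda>t. f (cis t)) \<and>
        (\<forall>k t. (D k has_vector_derivative D (Suc k) t) (at t)))"

definition szego_type :: "(complex \<Rightarrow> complex) \<Rightarrow> bool" where
  "szego_type \<phi> \<longleftrightarrow>
     smooth_on_circle \<phi> \<and>
     (\<forall>z \<in> sphere 0 1. \<phi> z \<noteq> 0) \<and>
     winding_number (\<phi> \<circ> circlepath 0 1) 0 = 0 \<and>
     (\<exists>U F. open U \<and> sphere 0 1 \<subseteq> U \<and> F holomorphic_on U \<and> (\<forall>z \<in> sphere 0 1. F z = \<phi> z))"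

text \<open>
  A continuous logarithm of \<open>\<phi>\<close> on the circle. It exists if \<open>\<phi>\<close> is continuous and nonzero with
  winding number zero, and is then unique up to an additive constant in \<open>2\<pi>i\<int>\<close>. The quantities
  \<open>G[\<phi>]\<close>, \<open>E[\<phi>]\<close> and \<open>\<alpha>\<close> below do not depend on that constant.
\<close>

definition log_symbol :: "(complex \<Rightarrow> complex) \<Rightarrow> complex \<Rightarrow> complex" where
  "log_symbol \<phi> =
     (SOME L. continuous_on (sphere 0 1) L \<and> (\<forall>z \<in> sphere 0 1. exp (L z) = \<phi> z))"

definition szego_G :: "(complex \<Rightarrow> complex) \<Rightarrow> complex" where
  "szego_G \<phi> = exp (fourier_coeff (log_symbol \<phi>) 0)"

definition szego_E :: "(complex \<Rightarrow> complex) \<Rightarrow> complex" where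
  "szego_E \<phi> =
     exp (\<Sum>k. of_nat (Suc k) * fourier_coeff (log_symbol \<phi>) (int (Suc k))
                            * fourier_coeff (log_symbol \<phi>) (- int (Suc k)))"

definition szego_alpha :: "(complex \<Rightarrow> complex) \<Rightarrow> complex \<Rightarrow> complex" where
  "szego_alpha \<phi> z =
     exp (1 / (2 * of_real pi * \<i>) *
          contour_integral (circlepath 0 1) (\<lambda>\<tau>. log_symbol \<phi> \<tau> / (\<tau> - z)))"

text \<open>
  The \<open>N \<times> N\<close> matrix (\<open>N \<ge> 2\<close>) with Toeplitz upper-left block \<open>(\<phi>\<^bsub>j-k\<^esub>)\<close>, last column \<open>u\<close>, last row
  \<open>v\<close> and lower-right entry \<open>a\<close>. Rows and columns are numbered from \<open>0\<close>. The determinant is the one of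
  \<^theory>\<open>Jordan_Normal_Form.Determinant\<close>, whose dimension is a natural number.
\<close>

definition semi_framed_mat ::
  "(complex \<Rightarrow> complex) \<Rightarrow> (nat \<Rightarrow> complex) \<Rightarrow> (nat \<Rightarrow> complex) \<Rightarrow> complex \<Rightarrow> nat \<Rightarrow> complex mat" where
  "semi_framed_mat \<phi> u v a N = Matrix.mat N N (\<lambda>(j, k).
     if j < N - 1 \<and> k < N - 1 then fourier_coeff \<phi> (int j - int k)
     else if j < N - 1 then u j
     else if k < N - 1 then v k
     else a)"

definition det_E ::
  "nat \<Rightarrow> (complex \<Rightarrow> complex) \<Rightarrow> (complex \<Rightarrow> complex) \<Rightarrow> (complex \<Rightarrow> complex) \<Rightarrow> complex \<Rightarrow> complex" where
  "det_E N \<phi> \<psi> \<eta> a = Determinant.det (semi_framed_mat \<phi>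
     (\<lambda>j. fourier_coeff \<psi> (int N - 2 - int j)) (\<lambda>k. fourier_coeff \<eta> (int N - 2 - int k)) a N)"

definition det_G ::
  "nat \<Rightarrow> (complex \<Rightarrow> complex) \<Rightarrow> (complex \<Rightarrow> complex) \<Rightarrow> (complex \<Rightarrow> complex) \<Rightarrow> complex \<Rightarrow> complex" where
  "det_G N \<phi> \<psi> \<eta> a = Determinant.det (semi_framed_mat \<phi>
     (\<lambda>j. fourier_coeff \<psi> (int j)) (\<lambda>k. fourier_coeff \<eta> (int k)) a N)"

definition det_H ::
  "nat \<Rightarrow> (complex \<Rightarrow> complex) \<Rightarrow> (complex \<Rightarrow> complex) \<Rightarrow> (complex \<Rightarrow> complex) \<Rightarrow> complex \<Rightarrow> complex" where
  "det_H N \<phi> \<psi> \<eta> a = Determinant.det (semi_framed_mat \<phi>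
     (\<lambda>j. fourier_coeff \<psi> (int j)) (\<lambda>k. fourier_coeff \<eta> (int N - 2 - int k)) a N)"

definition det_L ::
  "nat \<Rightarrow> (complex \<Rightarrow> complex) \<Rightarrow> (complex \<Rightarrow> complex) \<Rightarrow> (complex \<Rightarrow> complex) \<Rightarrow> complex \<Rightarrow> complex" where
  "det_L N \<phi> \<psi> \<eta> a = Determinant.det (semi_framed_mat \<phi>
     (\<lambda>j. fourier_coeff \<psi> (int N - 2 - int j)) (\<lambda>k. fourier_coeff \<eta> (int k)) a N)"

text \<open>
  The continuation of \<open>\<phi>\<close> is required to be analytic and nonzero on the closed annulus
  \<open>1/\<rho> \<le> |z| \<le> \<rho>\<close> (\<open>analytic_on\<close> means holomorphic on a neighbourhood). Analyticity in the open
  annulus does not suffice for an error \<open>O(\<rho>\<^sup>-\<^sup>n)\<close>. If \<open>\<phi>(z) = (1 - z/r)(1 - 1/(rz))\<close>, \<open>r > 1\<close>, the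
  relative error of the Toeplitz determinant is \<open>-r\<^sup>-\<^sup>2\<^sup>n\<^sup>-\<^sup>2\<close>, although \<open>\<phi>\<close> is analytic in every annulus.
  If \<open>\<phi>(z) = (1 - z/\<rho>)\<^sup>2\<close>, which is also nonzero in the open annulus, the determinant \<open>det_H (n + 1)\<close> has an
  error of exact order \<open>n \<rho>\<^sup>-\<^sup>n\<close> in general.
\<close>

definition admissible_radius :: "(complex \<Rightarrow> complex) \<Rightarrow> complex set \<Rightarrow> real \<Rightarrow> bool" where
  "admissible_radius \<phi> \<Lambda> \<rho> \<longleftrightarrow>
     \<rho> > 1 \<and>
     (\<forall>w \<in> \<Lambda>. (cmod w > 1 \<longrightarrow> \<rho> < cmod w) \<and> (cmod w < 1 \<longrightarrow> cmod w < inverse \<rho>)) \<and>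
     (\<exists>F. F analytic_on {z. inverse \<rho> \<le> cmod z \<and> cmod z \<le> \<rho>} \<and>
          (\<forall>z. inverse \<rho> \<le> cmod z \<and> cmod z \<le> \<rho> \<longrightarrow> F z \<noteq> 0) \<and>
          (\<forall>z \<in> sphere 0 1. F z = \<phi> z))"

text \<open>\<open>X\<^sub>n = g\<^sup>n e (s + O(\<rho>\<^sup>-\<^sup>n))\<close> as \<open>n \<rightarrow> \<infinity>\<close>, for a sequence \<open>X\<close> defined for \<open>n \<ge> 1\<close>.\<close>

definition szego_asymp ::
  "(nat \<Rightarrow> complex) \<Rightarrow> complex \<Rightarrow> complex \<Rightarrow> complex \<Rightarrow> real \<Rightarrow> bool" where
  "szego_asymp X g e s \<rho> \<longleftrightarrow>
     (\<exists>\<epsilon> \<in> O(\<lambda>n. inverse (of_real \<rho>) ^ n). \<forall>n\<ge>1. X n = g ^ n * e * (s + \<epsilon> n))"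

end

theory Submission
  imports Defs
begin

text \<open>
  Write \<open>log \<phi> = P(z) + Q(1/z)\<close> on the circle and \<open>\<phi> = G b(z) f(1/z)\<close> with \<open>b = exp (P - P(0))\<close>,
  \<open>f = exp Q\<close>, \<open>e = 1/b\<close>, \<open>g = 1/f\<close>. The finite Toeplitz matrix factors as \<open>G T\<^sub>n(b) (1 + K\<^sub>n) T\<^sub>n(f)\<close> with
  unipotent triangular outer factors, where \<open>K\<^sub>n\<close> is the \<open>n \<times> n\<close> corner of a fixed matrix with entries
  \<open>O(\<rho>\<^sup>-\<^sup>j\<^sup>-\<^sup>k)\<close>. Hence \<open>det (1 + K\<^sub>n)\<close> converges with error \<open>O(\<rho>\<^sup>-\<^sup>n)\<close>. Its limit is multiplicative in \<open>f\<close>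
  because \<open>T(e) T(f) T(b)\<close> is, so along \<open>exp (x Q)\<close> it equals \<open>exp (x \<tau>)\<close>, with \<open>\<tau>\<close> the trace
  \<open>\<Sum> k P\<^sub>k Q\<^sub>k\<close> of the first-order term of \<open>K\<close>. This identifies the limit with \<open>E[\<phi>]\<close>.

  A semi-framed determinant is \<open>a det T - v adj(T) u\<close>. Only poles outside the disc contribute to the border, which
  consists of geometric sequences concentrated at the top or at the bottom. Since
  \<open>adj (1 + K\<^sub>n)\<close> differs from \<open>det (1 + K\<^sub>n)\<close> by \<open>O(\<rho>\<^sup>-\<^sup>j\<^sup>-\<^sup>k)\<close>, only the pairing bottom--bottom survives in the
  limit. The pairing top--top is reduced to it by reversing the order of rows and columns and transposing.
\<close>

section \<open>Determinants and adjugates of finite matrices\<close>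

text \<open>Two rates run through the proof: Taylor coefficients decay like \<open>t ^ i\<close>,
  the arrays built from them are bounded with \<open>q\<close>, where \<open>t < q\<close> and
  \<open>q\<close> is \<open>1 / \<rho>\<close>. Convolving two sequences of equal rate would cost a
  factor \<open>n\<close>; the gap, which the closed annulus provides, absorbs it. The adjugate
  replaces the inverse because \<open>1 + K\<close> may have singular corners for small
  \<open>n\<close>; no lower bound on a determinant has to be found. No infinite determinant is
  defined. The analysis takes place on finite corners, with the crude bound of a determinant by the
  product of its absolute row sums: the rows of \<open>1 + K\<close> have sums
  \<open>1 + O(q ^ i)\<close>, so these products stay bounded in \<open>n\<close>. Multiplicativity
  of the limit is also read off on corners: the corner of a product of infinite arrays differs from
  the product of the corners by \<open>O(q ^ n)\<close> in each of \<open>n\<close> rows, which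
  still tends to zero in total. The value of the limit then needs only first-order information at
  \<open>x = 0\<close>, since a multiplicative function that is differentiable at \<open>0\<close>
  is an exponential.\<close>

text \<open>Matrices are total functions of two indices with the size as a separate argument, so
  that the corners of one infinite array can be compared for all \<open>n\<close>.\<close>

definition fdet :: "nat \<Rightarrow> (nat \<Rightarrow> nat \<Rightarrow> complex) \<Rightarrow> complex" where
  "fdet n A = Determinant.det (Matrix.mat n n (\<lambda>(i, j). A i j))"

definition fadj :: "nat \<Rightarrow> (nat \<Rightarrow> nat \<Rightarrow> complex) \<Rightarrow> nat \<Rightarrow> nat \<Rightarrow> complex" where
  "fadj n A i j = Determinant.cofactor (Matrix.mat n n (\<lambda>(i, j). A i j)) j i"

text \<open>The increasing enumeration of the indices other than \<open>j\<close>; deleting a row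
  and a column becomes reindexing.\<close>

definition skip :: "nat \<Rightarrow> nat \<Rightarrow> nat" where
  "skip j i = (if i < j then i else Suc i)"

lemma inj_skip: "inj_on (skip j) S"
  by (auto simp: inj_on_def skip_def split: if_splits)

lemma skip_less: "i < n - 1 \<Longrightarrow> skip j i < n"
  by (auto simp: skip_def)

lemma fdet_cong: "(\<And>i j. i < n \<Longrightarrow> j < n \<Longrightarrow> A i j = A' i j) \<Longrightarrow> fdet n A = fdet n A'"
  unfolding fdet_def by (rule arg_cong[where f = Determinant.det]) auto

lemma fdet_transpose: "fdet n (\<lambda>i j. A j i) = fdet n A"
proof -
  have "Matrix.transpose_mat (Matrix.mat n n (\<lambda>(i, j). A i j)) = Matrix.mat n n (\<lambda>(i, j). A j i)"
    by auto
  then show ?thesis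
    unfolding fdet_def using Determinant.det_transpose[of "Matrix.mat n n (\<lambda>(i, j). A i j)" n] by simp
qed

lemma fdet_mult: "fdet n A * fdet n B = fdet n (\<lambda>i j. \<Sum>k<n. A i k * B k j)"
proof -
  have "Matrix.mat n n (\<lambda>(i, j). A i j) * Matrix.mat n n (\<lambda>(i, j). B i j)
      = Matrix.mat n n (\<lambda>(i, j). \<Sum>k<n. A i k * B k j)"
    by (rule eq_matI) (auto simp: scalar_prod_def lessThan_atLeast0)
  then show ?thesis
    unfolding fdet_def
    using Determinant.det_mult[of "Matrix.mat n n (\<lambda>(i, j). A i j)" n "Matrix.mat n n (\<lambda>(i, j). B i j)"]
    by simp
qed

lemma fdet_upper_triangular:
  assumes "\<And>i j. i < n \<Longrightarrow> j < i \<Longrightarrow> A i j = 0" and "\<And>i. i < n \<Longrightarrow> A i i = 1"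
  shows "fdet n A = 1"
proof -
  have "Determinant.det (Matrix.mat n n (\<lambda>(i, j). A i j)) =
      prod_list (diag_mat (Matrix.mat n n (\<lambda>(i, j). A i j)))"
    by (rule Determinant.det_upper_triangular[where n = n]) (auto simp: upper_triangular_def assms)
  also have "diag_mat (Matrix.mat n n (\<lambda>(i, j). A i j)) = map (\<lambda>_. 1) [0..<n]"
    by (auto simp: diag_mat_def assms)
  also have "prod_list (map (\<lambda>_. 1::complex) [0..<n]) = 1"
    by (induction n) auto
  finally show ?thesis by (simp add: fdet_def)
qed

lemma fdet_lower_triangular:
  assumes "\<And>i j. j < n \<Longrightarrow> i < j \<Longrightarrow> A i j = 0" and "\<And>i. i < n \<Longrightarrow> A i i = 1"
  shows "fdet n A = 1"
  using fdet_upper_triangular[of n "\<lambda>i j. A j i"] assms fdet_transpose[of n A] by simp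

lemma fdet_smult: "fdet n (\<lambda>i j. c * A i j) = c ^ n * fdet n A"
proof -
  have "c \<cdot>\<^sub>m Matrix.mat n n (\<lambda>(i, j). A i j) = Matrix.mat n n (\<lambda>(i, j). c * A i j)"
    by auto
  then show ?thesis
    unfolding fdet_def using Determinant.det_smult[of c "Matrix.mat n n (\<lambda>(i, j). A i j)"] by simp
qed

lemma fdet_0 [simp]: "fdet 0 A = 1"
  by (simp add: fdet_def Determinant.det_def)

lemma mat_delete_mat:
  "Determinant.mat_delete (Matrix.mat n n (\<lambda>(i, j). A i j)) a b
     = Matrix.mat (n - 1) (n - 1) (\<lambda>(i, j). A (skip a i) (skip b j))"
  by (rule eq_matI) (auto simp: Determinant.mat_delete_def skip_def)

lemma fadj_eq: "fadj n A i j = (- 1) ^ (i + j) * fdet (n - 1) (\<lambda>k l. A (skip j k) (skip i l))"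
  by (simp add: fadj_def Determinant.cofactor_def mat_delete_mat fdet_def add.commute)

lemma fadj_right:
  assumes "i < n" "j < n"
  shows "(\<Sum>k<n. A i k * fadj n A k j) = (if i = j then fdet n A else 0)"
proof -
  define M where "M = Matrix.mat n n (\<lambda>(i, j). A i j)"
  have M: "M \<in> carrier_mat n n" by (simp add: M_def)
  have "(M * Determinant.adj_mat M) $$ (i, j) = (Determinant.det M \<cdot>\<^sub>m 1\<^sub>m n) $$ (i, j)"
    using Determinant.adj_mat(2)[OF M] by simp
  moreover have "(M * Determinant.adj_mat M) $$ (i, j) = (\<Sum>k<n. A i k * fadj n A k j)"
    using assms by (auto simp: M_def Determinant.adj_mat_def scalar_prod_def lessThan_atLeast0 fadj_def)
  ultimately show ?thesis using assms by (cases "i = j") (auto simp: fdet_def M_def)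
qed

lemma fadj_left:
  assumes "i < n" "j < n"
  shows "(\<Sum>k<n. fadj n A i k * A k j) = (if i = j then fdet n A else 0)"
proof -
  define M where "M = Matrix.mat n n (\<lambda>(i, j). A i j)"
  have M: "M \<in> carrier_mat n n" by (simp add: M_def)
  have "(Determinant.adj_mat M * M) $$ (i, j) = (Determinant.det M \<cdot>\<^sub>m 1\<^sub>m n) $$ (i, j)"
    using Determinant.adj_mat(3)[OF M] by simp
  moreover have "(Determinant.adj_mat M * M) $$ (i, j) = (\<Sum>k<n. fadj n A i k * A k j)"
    using assms by (auto simp: M_def Determinant.adj_mat_def scalar_prod_def lessThan_atLeast0 fadj_def)
  ultimately show ?thesis using assms by (cases "i = j") (auto simp: fdet_def M_def)
qed

text \<open>Expanding along the last row, and each minor along its last column, leaves minors of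
  \<open>A\<close> of size \<open>n - 1\<close>, which are adjugate entries up to sign. This is the
  Schur complement formula multiplied by the determinant, so \<open>A\<close> may be
  singular.\<close>

lemma fdet_bordered:
  "fdet (Suc n) (\<lambda>i j. if i < n \<and> j < n then A i j else if i < n then u i else if j < n then v j else a)
   = a * fdet n A - (\<Sum>i<n. \<Sum>j<n. v i * fadj n A i j * u j)"
proof -
  define B where "B = (\<lambda>i j. if i < n \<and> j < n then A i j else if i < n then u i else if j < n then v j else a)"
  define M where "M = Matrix.mat (Suc n) (Suc n) (\<lambda>(i, j). B i j)"
  have "fdet (Suc n) B = (\<Sum>j<Suc n. M $$ (n, j) * Determinant.cofactor M n j)"
    unfolding fdet_def M_def by (rule Determinant.laplace_expansion_row) auto
  also have "\<dots> = a * Determinant.cofactor M n n + (\<Sum>k<n. v k * Determinant.cofactor M n k)"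
    by (simp add: M_def B_def)
  also have "Determinant.cofactor M n n = fdet n (\<lambda>i j. B (skip n i) (skip n j))"
    by (simp add: Determinant.cofactor_def M_def mat_delete_mat fdet_def)
  also have "\<dots> = fdet n A"
    by (rule fdet_cong) (auto simp: B_def skip_def)
  also have "(\<Sum>k<n. v k * Determinant.cofactor M n k) = - (\<Sum>i<n. \<Sum>j<n. v i * fadj n A i j * u j)"
    unfolding sum_negf[symmetric]
  proof (rule sum.cong[OF refl])
    fix k assume "k \<in> {..<n}"
    then have k: "k < n" by simp
    define m where "m = n - 1"
    have n: "n = Suc m" using k by (simp add: m_def)
    define N where "N = Matrix.mat n n (\<lambda>(i, j). B (skip n i) (skip k j))"
    have "Determinant.cofactor M n k = (- 1) ^ (n + k) * Determinant.det N"
      by (simp add: Determinant.cofactor_def M_def mat_delete_mat N_def)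
    also have "Determinant.det N = (\<Sum>i<n. N $$ (i, m) * Determinant.cofactor N i m)"
      by (rule Determinant.laplace_expansion_column) (auto simp: N_def n)
    also have "\<dots> = (\<Sum>i<n. u i * ((- 1) ^ (i + m) * fdet m (\<lambda>k' l. A (skip i k') (skip k l))))"
    proof (rule sum.cong[OF refl])
      fix i assume "i \<in> {..<n}"
      then have i: "i < n" by simp
      have "N $$ (i, m) = u i" using i k by (auto simp: N_def n B_def skip_def)
      moreover have "Determinant.cofactor N i m = (- 1) ^ (i + m) *
          fdet m (\<lambda>k' l. B (skip n (skip i k')) (skip k (skip m l)))"
        by (simp add: Determinant.cofactor_def N_def mat_delete_mat fdet_def n)
      moreover have "fdet m (\<lambda>k' l. B (skip n (skip i k')) (skip k (skip m l)))
          = fdet m (\<lambda>k' l. A (skip i k') (skip k l))"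
        by (rule fdet_cong) (auto simp: B_def skip_def n)
      ultimately show "N $$ (i, m) * Determinant.cofactor N i m =
          u i * ((- 1) ^ (i + m) * fdet m (\<lambda>k' l. A (skip i k') (skip k l)))" by simp
    qed
    finally have "Determinant.cofactor M n k = (- 1) ^ (n + k) *
        (\<Sum>i<n. u i * ((- 1) ^ (i + m) * fdet m (\<lambda>k' l. A (skip i k') (skip k l))))" .
    \<comment> \<open>Since \<open>n = Suc m\<close>, the two signs combine to minus the sign of the
      adjugate entry.\<close>
    also have "\<dots> = (\<Sum>j<n. - (fadj n A k j * u j))"
      unfolding sum_distrib_left
      by (rule sum.cong[OF refl]) (auto simp: fadj_eq n minus_one_power_iff)
    finally show "v k * Determinant.cofactor M n k = (\<Sum>j<n. - (v k * fadj n A k j * u j))"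
      by (simp add: sum_distrib_left mult.assoc)
  qed
  finally show ?thesis by (simp add: B_def)
qed

section \<open>Row-sum bounds for determinants and adjugates\<close>

text \<open>Permutations inject into all maps of the index set to itself, and the sum over all maps
  is the expanded product of the row sums.\<close>

lemma sum_permutes_le_prod:
  fixes a :: "nat \<Rightarrow> nat \<Rightarrow> real"
  assumes "\<And>i j. i < n \<Longrightarrow> j < n \<Longrightarrow> 0 \<le> a i j"
  shows "(\<Sum>p | p permutes {0..<n}. \<Prod>i=0..<n. a i (p i)) \<le> (\<Prod>i<n. \<Sum>j<n. a i j)"
proof -
  let ?P = "{p. p permutes {0..<n}}" and ?F = "PiE {0..<n} (\<lambda>_. {0..<n})"
  \<comment> \<open>Elements of \<open>PiE\<close> are \<open>undefined\<close> outside the index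
    set while permutations are the identity there; restriction reconciles the two.\<close>
  let ?r = "\<lambda>p. restrict p {0..<n}"
  have inj: "inj_on ?r ?P"
  proof (rule inj_onI)
    fix p p' assume *: "p \<in> ?P" "p' \<in> ?P" "?r p = ?r p'"
    show "p = p'"
    proof
      fix x show "p x = p' x"
        using *(1,2) fun_cong[OF *(3), of x, unfolded restrict_def]
        by (cases "x \<in> {0..<n}") (simp_all add: permutes_not_in)
    qed
  qed
  have "(\<Sum>p\<in>?P. \<Prod>i=0..<n. a i (p i)) = (\<Sum>p\<in>?r ` ?P. \<Prod>i=0..<n. a i (p i))"
    by (subst sum.reindex[OF inj]) (auto intro!: sum.cong prod.cong)
  also have "\<dots> \<le> (\<Sum>p\<in>?F. \<Prod>i=0..<n. a i (p i))"
  proof (rule sum_mono2)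
    show "?r ` ?P \<subseteq> ?F"
      using permutes_in_image by fastforce
    show "0 \<le> (\<Prod>i=0..<n. a i (p i))" if "p \<in> ?F - ?r ` ?P" for p
      using that by (intro prod_nonneg) (auto intro!: assms simp: PiE_def Pi_def)
  qed (auto intro: finite_PiE)
  also have "\<dots> = (\<Prod>i=0..<n. \<Sum>j=0..<n. a i j)"
    by (rule prod_sum_PiE[symmetric]) auto
  finally show ?thesis by (simp add: lessThan_atLeast0)
qed

lemma norm_fdet_le: "cmod (fdet n A) \<le> (\<Prod>i<n. \<Sum>j<n. cmod (A i j))"
proof -
  have "fdet n A = (\<Sum>p | p permutes {0..<n}. signof p * (\<Prod>i=0..<n. A i (p i)))"
    unfolding fdet_def Determinant.det_def
    by (auto intro!: sum.cong prod.cong arg_cong2[where f = "(*)"] simp: permutes_def)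
  also have "cmod \<dots> \<le> (\<Sum>p | p permutes {0..<n}. \<Prod>i=0..<n. cmod (A i (p i)))"
    by (rule sum_norm_le) (simp add: norm_mult prod_norm sign_def)
  also have "\<dots> \<le> (\<Prod>i<n. \<Sum>j<n. cmod (A i j))"
    by (rule sum_permutes_le_prod) auto
  finally show ?thesis .
qed


text \<open>A minor omits row \<open>j\<close>; the condition \<open>1 \<le> w i\<close> allows the
  factor of that row to be put back, so the bound is the same for all entries.\<close>

lemma norm_fadj_le:
  assumes row: "\<And>i. i < n \<Longrightarrow> (\<Sum>j<n. cmod (A i j)) \<le> w i" and w: "\<And>i. 1 \<le> w i"
    and "i < n" "j < n"
  shows "cmod (fadj n A i j) \<le> (\<Prod>i<n. w i)"
proof -
  have "cmod (fadj n A i j) = cmod (fdet (n - 1) (\<lambda>k l. A (skip j k) (skip i l)))"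
    by (simp add: fadj_eq norm_mult norm_power)
  also have "\<dots> \<le> (\<Prod>k<n - 1. \<Sum>l<n - 1. cmod (A (skip j k) (skip i l)))"
    by (rule norm_fdet_le)
  also have "\<dots> \<le> (\<Prod>k<n - 1. w (skip j k))"
  proof (rule prod_mono, safe)
    fix k assume "k < n - 1"
    then have k: "skip j k < n" by (rule skip_less)
    have "(\<Sum>l<n - 1. cmod (A (skip j k) (skip i l))) = (\<Sum>l\<in>skip i ` {..<n - 1}. cmod (A (skip j k) l))"
      by (simp add: sum.reindex[OF inj_skip])
    also have "\<dots> \<le> (\<Sum>l<n. cmod (A (skip j k) l))"
      by (rule sum_mono2) (auto intro: skip_less)
    also have "\<dots> \<le> w (skip j k)" by (rule row[OF k])
    finally show "(\<Sum>l<n - 1. cmod (A (skip j k) (skip i l))) \<le> w (skip j k)" .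
  qed (auto intro: sum_nonneg)
  also have "\<dots> = (\<Prod>x\<in>skip j ` {..<n - 1}. w x)"
    by (simp add: prod.reindex[OF inj_skip])
  also have "\<dots> \<le> (\<Prod>x<n. w x)"
    by (rule prod_mono2) (auto intro: skip_less w order_trans[OF zero_le_one w])
  finally show ?thesis .
qed

lemma fdet_laplace_row:
  assumes "m < n"
  shows "fdet n A = (\<Sum>j<n. A m j * ((- 1) ^ (m + j) * fdet (n - 1) (\<lambda>k l. A (skip m k) (skip j l))))"
proof -
  have "fdet n A = (\<Sum>j<n. Matrix.mat n n (\<lambda>(i, j). A i j) $$ (m, j) *
      Determinant.cofactor (Matrix.mat n n (\<lambda>(i, j). A i j)) m j)"
    unfolding fdet_def using assms by (intro Determinant.laplace_expansion_row) auto
  also have "\<dots> = (\<Sum>j<n. A m j * ((- 1) ^ (m + j) * fdet (n - 1) (\<lambda>k l. A (skip m k) (skip j l))))"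
    using assms by (intro sum.cong refl) (simp add: Determinant.cofactor_def mat_delete_mat fdet_def)
  finally show ?thesis .
qed

lemma fdet_row_diff:
  assumes "m < n"
  shows "fdet n (\<lambda>i j. if i = m then x j else A i j) - fdet n (\<lambda>i j. if i = m then y j else A i j)
       = fdet n (\<lambda>i j. if i = m then x j - y j else A i j)"
proof -
  have ne: "skip m i \<noteq> m" for i by (simp add: skip_def)
  have "fdet n (\<lambda>i j. if i = m then z j else A i j)
      = (\<Sum>j<n. z j * ((- 1) ^ (m + j) * fdet (n - 1) (\<lambda>k l. A (skip m k) (skip j l))))" for z
    using fdet_laplace_row[OF assms, of "\<lambda>i j. if i = m then z j else A i j"] by (simp add: ne)
  then show ?thesis
    by (simp add: sum_subtractf[symmetric] left_diff_distrib)
qed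

lemma norm_fdet_diff_le:
  assumes row: "\<And>i. i < n \<Longrightarrow> (\<Sum>j<n. cmod (A i j)) \<le> w i"
    and row': "\<And>i. i < n \<Longrightarrow> (\<Sum>j<n. cmod (A' i j)) \<le> w i"
    and diff: "\<And>i. i < n \<Longrightarrow> (\<Sum>j<n. cmod (A' i j - A i j)) \<le> \<epsilon> i"
    and w: "\<And>i. 1 \<le> w i"
  shows "cmod (fdet n A' - fdet n A) \<le> (\<Prod>i<n. w i) * (\<Sum>i<n. \<epsilon> i)"
proof -
  \<comment> \<open>Hybrids whose first \<open>m\<close> rows are taken from \<open>A'\<close>.
    Neighbouring hybrids differ in one row, in which the determinant is linear, and the differences
    telescope.\<close>
  define H where "H m = (\<lambda>i j. if i < m then A' i j else A i j)" for m :: nat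
  have w0: "0 \<le> w i" for i using w[of i] by simp
  have step: "cmod (fdet n (H (Suc m)) - fdet n (H m)) \<le> (\<Prod>i<n. w i) * \<epsilon> m" if "m < n" for m
  proof -
    have "fdet n (H (Suc m)) = fdet n (\<lambda>i j. if i = m then A' m j else H m i j)"
      by (rule fdet_cong) (auto simp: H_def)
    moreover have "fdet n (H m) = fdet n (\<lambda>i j. if i = m then A m j else H m i j)"
      by (rule fdet_cong) (auto simp: H_def)
    ultimately have "fdet n (H (Suc m)) - fdet n (H m)
        = fdet n (\<lambda>i j. if i = m then A' m j - A m j else H m i j)"
      by (simp add: fdet_row_diff[OF that])
    also have "cmod \<dots> \<le> (\<Prod>i<n. \<Sum>j<n. cmod (if i = m then A' m j - A m j else H m i j))"
      by (rule norm_fdet_le)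
    also have "\<dots> = (\<Sum>j<n. cmod (A' m j - A m j)) * (\<Prod>i\<in>{..<n} - {m}. \<Sum>j<n. cmod (H m i j))"
      using that by (subst prod.remove[of _ m]) (auto intro!: prod.cong arg_cong2[where f = "(*)"])
    also have "\<dots> \<le> \<epsilon> m * (\<Prod>i\<in>{..<n} - {m}. w i)"
    proof (rule mult_mono)
      show "0 \<le> \<epsilon> m" using diff[OF that] by (rule order_trans[rotated]) (auto intro: sum_nonneg)
      show "(\<Prod>i\<in>{..<n} - {m}. \<Sum>j<n. cmod (H m i j)) \<le> (\<Prod>i\<in>{..<n} - {m}. w i)"
      proof (intro prod_mono conjI sum_nonneg)
        show "(\<Sum>j<n. cmod (H m i j)) \<le> w i" if "i \<in> {..<n} - {m}" for i
          using that row[of i] row'[of i] by (cases "i < m") (simp_all add: H_def)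
      qed auto
    qed (auto intro!: diff that prod_nonneg sum_nonneg)
    also have "\<dots> \<le> \<epsilon> m * (\<Prod>i<n. w i)"
    proof (rule mult_left_mono)
      show "(\<Prod>i\<in>{..<n} - {m}. w i) \<le> (\<Prod>i<n. w i)"
        by (rule prod_mono2) (auto intro: w w0)
      show "0 \<le> \<epsilon> m" using diff[OF that] by (rule order_trans[rotated]) (auto intro: sum_nonneg)
    qed
    finally show ?thesis by (simp add: mult.commute)
  qed
  have "fdet n A' - fdet n A = fdet n (H n) - fdet n (H 0)"
    by (intro arg_cong2[where f = "(-)"] fdet_cong) (auto simp: H_def)
  also have "\<dots> = (\<Sum>m<n. fdet n (H (Suc m)) - fdet n (H m))"
    by (rule sum_lessThan_telescope[symmetric])
  also have "cmod \<dots> \<le> (\<Sum>m<n. (\<Prod>i<n. w i) * \<epsilon> m)"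
    by (rule sum_norm_le) (simp add: step)
  finally show ?thesis by (simp add: sum_distrib_left)
qed

section \<open>Identity plus a geometrically small matrix\<close>

lemma geometric_sum_le:
  fixes q :: real
  assumes "0 \<le> q" "q < 1"
  shows "(\<Sum>i<n. q ^ i) \<le> 1 / (1 - q)"
  using assms sum_gp_strict[of q n] by (simp add: divide_right_mono)

lemma sum_geometric_le:
  fixes q C :: real
  assumes "0 \<le> q" "q < 1" "0 \<le> C" "\<And>i. i < n \<Longrightarrow> x i \<le> C * q ^ i"
  shows "(\<Sum>i<n. x i) \<le> C / (1 - q)"
proof -
  have "(\<Sum>i<n. x i) \<le> (\<Sum>i<n. C * q ^ i)"
    by (rule sum_mono) (simp add: assms)
  also have "\<dots> \<le> C * (1 / (1 - q))"
    unfolding sum_distrib_left[symmetric] by (intro mult_left_mono geometric_sum_le assms)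
  finally show ?thesis by simp
qed

lemma geometric_tail:
  fixes x :: "nat \<Rightarrow> complex"
  assumes q: "0 \<le> q" "q < 1" and step: "\<And>n. cmod (x (Suc n) - x n) \<le> C * q ^ n"
  obtains l where "\<And>n. cmod (x n - l) \<le> C / (1 - q) * q ^ n" "x \<longlonglongrightarrow> l"
proof -
  have bd: "cmod (x (n + m) - x n) \<le> C / (1 - q) * q ^ n" for n m
  proof -
    have C: "0 \<le> C * q ^ n" for n using step[of n] by (rule order_trans[rotated]) simp
    have "x (n + m) - x n = (\<Sum>i<m. x (Suc (n + i)) - x (n + i))"
      using sum_lessThan_telescope[of "\<lambda>i. x (n + i)" m] by simp
    also have "cmod \<dots> \<le> (\<Sum>i<m. C * q ^ n * q ^ i)"
      by (rule sum_norm_le) (use step[of "n + _"] in \<open>simp add: power_add mult.assoc\<close>)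
    also have "\<dots> \<le> C * q ^ n / (1 - q)"
      by (rule sum_geometric_le[OF q C]) simp
    finally show ?thesis by simp
  qed
  have lim0: "(\<lambda>n. C / (1 - q) * q ^ n) \<longlonglongrightarrow> 0"
    using tendsto_mult_left[OF LIMSEQ_power_zero[of q], of "C / (1 - q)"] q by simp
  have "Cauchy x"
  proof (rule metric_CauchyI)
    fix e :: real assume "0 < e"
    then obtain N where N: "\<And>n. n \<ge> N \<Longrightarrow> C / (1 - q) * q ^ n < e / 2"
      using order_tendstoD(2)[OF lim0, of "e / 2"] by (auto simp: eventually_sequentially)
    show "\<exists>M. \<forall>m\<ge>M. \<forall>n\<ge>M. dist (x m) (x n) < e"
    proof (intro exI allI impI)
      fix m n assume "N \<le> m" "N \<le> n"
      then have "dist (x m) (x N) < e / 2" "dist (x n) (x N) < e / 2"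
        using le_less_trans[OF bd[of N "m - N"] N[OF order_refl]]
          le_less_trans[OF bd[of N "n - N"] N[OF order_refl]] by (simp_all add: dist_norm)
      then show "dist (x m) (x n) < e" using dist_triangle_half_l by blast
    qed
  qed
  then obtain l where l: "x \<longlonglongrightarrow> l" using Cauchy_convergent convergent_def by blast
  have "cmod (x n - l) \<le> C / (1 - q) * q ^ n" for n
  proof -
    have "(\<lambda>m. cmod (x (m + n) - x n)) \<longlonglongrightarrow> cmod (l - x n)"
      by (intro tendsto_norm tendsto_diff tendsto_const LIMSEQ_ignore_initial_segment l)
    then have "cmod (l - x n) \<le> C / (1 - q) * q ^ n"
      by (rule LIMSEQ_le_const2) (use bd[of n] in \<open>auto simp: add.commute\<close>)
    then show ?thesis by (simp add: norm_minus_commute)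
  qed
  then show ?thesis using l that by blast
qed

definition idp :: "(nat \<Rightarrow> nat \<Rightarrow> complex) \<Rightarrow> nat \<Rightarrow> nat \<Rightarrow> complex" where
  "idp U i j = (if i = j then 1 else 0) + U i j"

lemma prod_one_plus_geometric_le:
  fixes q c :: real
  assumes q: "0 < q" "q < 1" and c: "0 \<le> c"
  shows "(\<Prod>i<n. 1 + c / (1 - q) * q ^ i) \<le> exp (c / (1 - q)\<^sup>2)"
proof -
  have "(\<Prod>i<n. 1 + c / (1 - q) * q ^ i) \<le> (\<Prod>i<n. exp (c / (1 - q) * q ^ i))"
    using q c by (intro prod_mono) (auto intro!: add_nonneg_nonneg exp_ge_add_one_self)
  also have "\<dots> = exp (\<Sum>i<n. c / (1 - q) * q ^ i)" by (simp add: exp_sum)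
  also have "\<dots> \<le> exp (c / (1 - q) / (1 - q))"
    using q c by (subst exp_le_cancel_iff, intro sum_geometric_le) auto
  finally show ?thesis by (simp add: power2_eq_square)
qed

lemma idp_row_le:
  assumes q: "0 < q" "q < 1" and c: "0 \<le> c" and i: "i < n"
    and U: "\<And>i j. i < n \<Longrightarrow> j < n \<Longrightarrow> cmod (U i j) \<le> c * q ^ (i + j)"
  shows "(\<Sum>j<n. cmod (idp U i j)) \<le> 1 + c / (1 - q) * q ^ i"
proof -
  have "(\<Sum>j<n. cmod (idp U i j)) \<le> (\<Sum>j<n. (if i = j then 1 else 0) + cmod (U i j))"
    by (rule sum_mono) (auto simp: idp_def intro: order_trans[OF norm_triangle_ineq])
  also have "\<dots> = 1 + (\<Sum>j<n. cmod (U i j))" using i by (simp add: sum.distrib)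
  also have "(\<Sum>j<n. cmod (U i j)) \<le> c * q ^ i / (1 - q)"
    using q c U[OF i] by (intro sum_geometric_le) (auto simp: power_add mult.assoc)
  finally show ?thesis by simp
qed

lemma norm_fdet_idp_le:
  assumes q: "0 < q" "q < 1" and c: "0 \<le> c"
    and U: "\<And>i j. i < n \<Longrightarrow> j < n \<Longrightarrow> cmod (U i j) \<le> c * q ^ (i + j)"
  shows "cmod (fdet n (idp U)) \<le> exp (c / (1 - q)\<^sup>2)"
proof -
  have "cmod (fdet n (idp U)) \<le> (\<Prod>i<n. \<Sum>j<n. cmod (idp U i j))" by (rule norm_fdet_le)
  also have "\<dots> \<le> (\<Prod>i<n. 1 + c / (1 - q) * q ^ i)"
    by (intro prod_mono conjI sum_nonneg idp_row_le[OF q c] U) auto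
  also have "\<dots> \<le> exp (c / (1 - q)\<^sup>2)" by (rule prod_one_plus_geometric_le[OF q c])
  finally show ?thesis .
qed

lemma norm_fadj_idp_le:
  assumes q: "0 < q" "q < 1" and c: "0 \<le> c"
    and U: "\<And>i j. i < n \<Longrightarrow> j < n \<Longrightarrow> cmod (U i j) \<le> c * q ^ (i + j)"
    and "i < n" "j < n"
  shows "cmod (fadj n (idp U) i j) \<le> exp (c / (1 - q)\<^sup>2)"
proof -
  have "cmod (fadj n (idp U) i j) \<le> (\<Prod>i<n. 1 + c / (1 - q) * q ^ i)"
    using q c by (intro norm_fadj_le idp_row_le[OF q c] U assms) auto
  also have "\<dots> \<le> exp (c / (1 - q)\<^sup>2)" by (rule prod_one_plus_geometric_le[OF q c])
  finally show ?thesis .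
qed

lemma norm_double_sum_le:
  fixes q c e E :: real
  assumes q: "0 < q" "q < 1" and cc: "0 \<le> c" "0 \<le> e" "0 \<le> E"
    and "\<And>i. i < n \<Longrightarrow> cmod (v i) \<le> c * q ^ i" "\<And>j. j < n \<Longrightarrow> cmod (u j) \<le> e * q ^ j"
    and "\<And>i j. i < n \<Longrightarrow> j < n \<Longrightarrow> cmod (F i j) \<le> E"
  shows "cmod (\<Sum>i<n. \<Sum>j<n. v i * F i j * u j) \<le> c * e * E / (1 - q)\<^sup>2"
proof -
  have "cmod (\<Sum>i<n. \<Sum>j<n. v i * F i j * u j) \<le> (\<Sum>i<n. c * E * e / (1 - q) * q ^ i)"
  proof (rule sum_norm_le)
    fix i assume i: "i \<in> {..<n}"
    have "cmod (\<Sum>j<n. v i * F i j * u j) \<le> (\<Sum>j<n. (c * q ^ i) * E * (e * q ^ j))"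
      using i q cc by (intro sum_norm_le) (auto simp: norm_mult intro!: mult_mono assms)
    also have "\<dots> \<le> (c * q ^ i) * E * e / (1 - q)"
      using q cc by (intro sum_geometric_le) (auto simp: mult_ac)
    finally show "cmod (\<Sum>j<n. v i * F i j * u j) \<le> c * E * e / (1 - q) * q ^ i"
      by (simp add: mult_ac)
  qed
  also have "\<dots> \<le> c * E * e / (1 - q) / (1 - q)"
    using q cc by (intro sum_geometric_le) auto
  finally show ?thesis by (simp add: power2_eq_square mult_ac)
qed

lemma fdet_idp_Suc:
  "fdet (Suc n) (idp U) = (1 + U n n) * fdet n (idp U)
     - (\<Sum>i<n. \<Sum>j<n. U n i * fadj n (idp U) i j * U j n)"
proof -
  have "fdet (Suc n) (idp U) = fdet (Suc n) (\<lambda>i j. if i < n \<and> j < n then idp U i j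
      else if i < n then U i n else if j < n then U n j else 1 + U n n)"
    by (rule fdet_cong) (auto simp: idp_def less_Suc_eq)
  then show ?thesis by (simp add: fdet_bordered)
qed

text \<open>The double sum of the bordered formula contains both the new row and the new column,
  each of size \<open>c * q ^ n\<close>, so it is of second order in \<open>c\<close>. The first
  estimate keeps this order for the trace expansion, the second gives convergence.\<close>

lemma norm_fdet_idp_step:
  fixes q c :: real
  defines "E \<equiv> exp (c / (1 - q)\<^sup>2)"
  assumes q: "0 < q" "q < 1" and c: "0 \<le> c" and U: "\<And>i j. cmod (U i j) \<le> c * q ^ (i + j)"
  shows "cmod (fdet (Suc n) (idp U) - (1 + U n n) * fdet n (idp U)) \<le> c\<^sup>2 * E / (1 - q)\<^sup>2 * q ^ n" (is ?A)
    and "cmod (fdet (Suc n) (idp U) - fdet n (idp U)) \<le> c * E * (1 + c / (1 - q)\<^sup>2) * q ^ n" (is ?B)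
proof -
  let ?S = "\<Sum>i<n. \<Sum>j<n. U n i * fadj n (idp U) i j * U j n"
  \<comment> \<open>The double sum is even \<open>O(q ^ n * q ^ n)\<close>; the single power is
    enough for what follows.\<close>
  have qn: "q ^ n * q ^ n \<le> q ^ n" using q mult_left_le[of "q ^ n" "q ^ n"] by (simp add: power_le_one)
  have U': "cmod (U n i) \<le> c * q ^ n * q ^ i" "cmod (U i n) \<le> c * q ^ n * q ^ i" for i
    using U[of n i] U[of i n] by (simp_all add: power_add mult_ac)
  have "cmod ?S \<le> (c * q ^ n) * (c * q ^ n) * E / (1 - q)\<^sup>2"
    using q c unfolding E_def
    by (intro norm_double_sum_le norm_fadj_idp_le[OF q c] U U') auto
  also have "\<dots> = (c\<^sup>2 * E / (1 - q)\<^sup>2) * (q ^ n * q ^ n)" by (simp add: power2_eq_square)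
  also have "\<dots> \<le> (c\<^sup>2 * E / (1 - q)\<^sup>2) * q ^ n"
    by (intro mult_left_mono qn) (auto simp: E_def)
  finally have S: "cmod ?S \<le> c\<^sup>2 * E / (1 - q)\<^sup>2 * q ^ n" .
  show ?A using S by (simp add: fdet_idp_Suc)
  have "cmod (U n n * fdet n (idp U)) \<le> (c * q ^ (n + n)) * E"
    using c q unfolding norm_mult E_def
    by (intro mult_mono U norm_fdet_idp_le[OF q c]) auto
  also have "\<dots> \<le> c * q ^ n * E"
    using qn c by (intro mult_right_mono mult_left_mono) (auto simp: E_def power_add)
  finally have "cmod (U n n * fdet n (idp U)) \<le> c * E * q ^ n" by (simp add: mult_ac)
  then have "cmod (U n n * fdet n (idp U) - ?S) \<le> c * E * q ^ n + c\<^sup>2 * E / (1 - q)\<^sup>2 * q ^ n"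
    using S by (rule order_trans[OF norm_triangle_ineq4 add_mono])
  moreover have "fdet (Suc n) (idp U) - fdet n (idp U) = U n n * fdet n (idp U) - ?S"
    by (simp add: fdet_idp_Suc algebra_simps)
  moreover have "c * E * q ^ n + c\<^sup>2 * E / (1 - q)\<^sup>2 * q ^ n = c * E * (1 + c / (1 - q)\<^sup>2) * q ^ n"
    by (simp add: algebra_simps power2_eq_square)
  ultimately show ?B by simp
qed

lemma fdet_idp_limit:
  assumes q: "0 < q" "q < 1" and c: "0 \<le> c" and U: "\<And>i j. cmod (U i j) \<le> c * q ^ (i + j)"
  obtains l D where "\<And>n. cmod (fdet n (idp U) - l) \<le> D * q ^ n" "(\<lambda>n. fdet n (idp U)) \<longlonglongrightarrow> l"
  by (rule geometric_tail[OF less_imp_le[OF q(1)] q(2) norm_fdet_idp_step(2)[OF q c U]]) blast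

text \<open>\<open>D\<close> depends on \<open>M\<close> and \<open>q\<close> only and not on
  \<open>n\<close>, so the first-order expansion survives the passage to the limit. The increments
  of the corner determinants are the diagonal entries up to second order in
  \<open>c\<close>.\<close>

lemma fdet_idp_trace:
  assumes q: "0 < q" "q < 1"
  obtains D where "\<And>n U c. 0 \<le> c \<Longrightarrow> c \<le> M \<Longrightarrow> (\<And>i j. cmod (U i j) \<le> c * q ^ (i + j)) \<Longrightarrow>
    cmod (fdet n (idp U) - 1 - (\<Sum>j<n. U j j)) \<le> D * c\<^sup>2"
proof -
  define E where "E = exp (M / (1 - q)\<^sup>2)"
  define F where "F = E * (1 + M / (1 - q)\<^sup>2) / (1 - q)"
  define D where "D = (F + E / (1 - q)\<^sup>2) / (1 - q)"
  have "cmod (fdet n (idp U) - 1 - (\<Sum>j<n. U j j)) \<le> D * c\<^sup>2"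
    if c: "0 \<le> c" "c \<le> M" and U: "\<And>i j. cmod (U i j) \<le> c * q ^ (i + j)" for n U c
  proof -
    let ?E = "exp (c / (1 - q)\<^sup>2)"
    have EE: "?E \<le> E" unfolding E_def using c by (simp add: divide_right_mono)
    have M: "0 \<le> M" using c by simp
    have d: "cmod (fdet n (idp U) - 1) \<le> F * c" for n
    proof -
      have "fdet n (idp U) - 1 = (\<Sum>m<n. fdet (Suc m) (idp U) - fdet m (idp U))"
        by (subst sum_lessThan_telescope) simp
      also have "cmod \<dots> \<le> (\<Sum>m<n. c * ?E * (1 + c / (1 - q)\<^sup>2) * q ^ m)"
        by (rule sum_norm_le) (rule norm_fdet_idp_step(2)[OF q c(1) U])
      also have "\<dots> \<le> c * ?E * (1 + c / (1 - q)\<^sup>2) / (1 - q)"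
        using q c by (intro sum_geometric_le) auto
      also have "\<dots> \<le> c * E * (1 + M / (1 - q)\<^sup>2) / (1 - q)"
        using q c EE by (intro divide_right_mono mult_mono add_left_mono mult_left_mono)
          (auto intro!: divide_right_mono simp: E_def)
      finally show ?thesis by (simp add: F_def mult_ac)
    qed
    have F0: "0 \<le> F" using M q by (simp add: F_def E_def)
    \<comment> \<open>The increment minus \<open>U m m\<close>, split into the bordered remainder
      and the effect of replacing the previous determinant by \<open>1\<close>; both are of order
      \<open>c\<close> squared.\<close>
    define r where "r m = (fdet (Suc m) (idp U) - (1 + U m m) * fdet m (idp U))
        + U m m * (fdet m (idp U) - 1)" for m
    have "fdet n (idp U) - 1 - (\<Sum>j<n. U j j)
        = (\<Sum>m<n. fdet (Suc m) (idp U) - fdet m (idp U)) - (\<Sum>j<n. U j j)"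
      by (subst sum_lessThan_telescope) simp
    also have "\<dots> = (\<Sum>m<n. r m)"
      unfolding sum_subtractf[symmetric] by (rule sum.cong) (auto simp: r_def algebra_simps)
    finally have eq: "fdet n (idp U) - 1 - (\<Sum>j<n. U j j) = (\<Sum>m<n. r m)" .
    have "cmod (\<Sum>m<n. r m) \<le> (\<Sum>m<n. (F + E / (1 - q)\<^sup>2) * c\<^sup>2 * q ^ m)"
    proof (rule sum_norm_le)
      fix m
      have "cmod (fdet (Suc m) (idp U) - (1 + U m m) * fdet m (idp U)) \<le> c\<^sup>2 * ?E / (1 - q)\<^sup>2 * q ^ m"
        by (rule norm_fdet_idp_step(1)[OF q c(1) U])
      also have "\<dots> \<le> c\<^sup>2 * E / (1 - q)\<^sup>2 * q ^ m"
        using q c EE by (intro divide_right_mono mult_right_mono mult_left_mono) auto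
      finally have 1: "cmod (fdet (Suc m) (idp U) - (1 + U m m) * fdet m (idp U)) \<le> c\<^sup>2 * E / (1 - q)\<^sup>2 * q ^ m" .
      have "cmod (U m m * (fdet m (idp U) - 1)) \<le> (c * q ^ (m + m)) * (F * c)"
        unfolding norm_mult using q c by (intro mult_mono U d) auto
      also have "\<dots> \<le> (c * q ^ m) * (F * c)"
        using q c F0 by (intro mult_right_mono mult_left_mono power_decreasing) auto
      finally have 2: "cmod (U m m * (fdet m (idp U) - 1)) \<le> F * c\<^sup>2 * q ^ m"
        by (simp add: power2_eq_square mult_ac)
      show "cmod (r m) \<le> (F + E / (1 - q)\<^sup>2) * c\<^sup>2 * q ^ m"
        unfolding r_def
        by (rule order_trans[OF norm_triangle_ineq], rule order_trans[OF add_mono[OF 1 2]])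
           (simp add: field_simps)
    qed
    also have "\<dots> \<le> (F + E / (1 - q)\<^sup>2) * c\<^sup>2 / (1 - q)"
    proof (rule sum_geometric_le)
      show "0 \<le> (F + E / (1 - q)\<^sup>2) * c\<^sup>2"
        using F0 by (intro mult_nonneg_nonneg add_nonneg_nonneg divide_nonneg_nonneg) (auto simp: E_def)
    qed (use q in auto)
    finally show ?thesis by (simp add: D_def eq)
  qed
  then show ?thesis using that by blast
qed

text \<open>\<open>adj (1 + U) = det (1 + U) (1 - U) + U adj (1 + U) U\<close>.\<close>

lemma fadj_idp_approx:
  assumes q: "0 < q" "q < 1" and c: "0 \<le> c"
    and U: "\<And>i j. i < n \<Longrightarrow> j < n \<Longrightarrow> cmod (U i j) \<le> c * q ^ (i + j)"
    and ij: "i < n" "j < n"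
  shows "cmod (fadj n (idp U) i j - (if i = j then fdet n (idp U) else 0))
    \<le> exp (c / (1 - q)\<^sup>2) * (c + c\<^sup>2 / (1 - q)\<^sup>2) * q ^ (i + j)"
proof -
  let ?E = "exp (c / (1 - q)\<^sup>2)" and ?d = "fdet n (idp U)" and ?F = "fadj n (idp U)"
  have r: "?F k l = (if k = l then ?d else 0) - (\<Sum>m<n. U k m * ?F m l)" if "k < n" "l < n" for k l
    using fadj_right[of k n l "idp U"] that
    by (simp add: idp_def distrib_right sum.distrib if_distrib[of "\<lambda>x. x * _"] sum.delta cong: if_cong)
       (cases "k = l", simp_all add: eq_diff_eq eq_neg_iff_add_eq_0)
  have l: "?F k l = (if k = l then ?d else 0) - (\<Sum>m<n. ?F k m * U m l)" if "k < n" "l < n" for k l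
    using fadj_left[of k n l "idp U"] that
    by (simp add: idp_def distrib_left sum.distrib if_distrib[of "\<lambda>x. _ * x"] sum.delta cong: if_cong)
       (cases "k = l", simp_all add: eq_diff_eq eq_neg_iff_add_eq_0)
  \<comment> \<open>Inserting the left identity into the right one places \<open>U\<close> on both
    sides of the adjugate, whence the decay in both indices.\<close>
  have "(\<Sum>m<n. U i m * ?F m j) = (\<Sum>m<n. U i m * (if m = j then ?d else 0)
      - (\<Sum>k<n. U i m * ?F m k * U k j))"
    by (rule sum.cong[OF refl], subst l) (auto simp: ij right_diff_distrib sum_distrib_left mult.assoc)
  also have "\<dots> = U i j * ?d - (\<Sum>m<n. \<Sum>k<n. U i m * ?F m k * U k j)"
    using ij by (simp add: sum_subtractf if_distrib[of "\<lambda>x. _ * x"] cong: if_cong)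
  finally have "?F i j - (if i = j then ?d else 0)
      = (\<Sum>m<n. \<Sum>k<n. U i m * ?F m k * U k j) - U i j * ?d"
    using r[OF ij] by simp
  also have "cmod \<dots> \<le> (c * q ^ i) * (c * q ^ j) * ?E / (1 - q)\<^sup>2 + c * q ^ (i + j) * ?E"
  proof (rule order_trans[OF norm_triangle_ineq4], rule add_mono)
    show "cmod (\<Sum>m<n. \<Sum>k<n. U i m * ?F m k * U k j) \<le> (c * q ^ i) * (c * q ^ j) * ?E / (1 - q)\<^sup>2"
    proof (intro norm_double_sum_le norm_fadj_idp_le[OF q c] U)
      show "cmod (U i m) \<le> c * q ^ i * q ^ m" if "m < n" for m
        using U[OF ij(1) that] by (simp add: power_add mult.assoc)
      show "cmod (U m j) \<le> c * q ^ j * q ^ m" if "m < n" for m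
        using U[OF that ij(2)] by (simp add: power_add mult_ac)
    qed (use q c in auto)
    show "cmod (U i j * ?d) \<le> c * q ^ (i + j) * ?E"
      unfolding norm_mult using q c
      by (intro mult_mono U ij norm_fdet_idp_le[OF q c]) auto
  qed
  also have "\<dots> = ?E * (c + c\<^sup>2 / (1 - q)\<^sup>2) * q ^ (i + j)"
    by (simp add: field_simps power_add power2_eq_square)
  finally show ?thesis .
qed

section \<open>Wiener--Hopf factorization of Toeplitz matrices\<close>

text \<open>Cutting off \<open>i\<close> at \<open>n\<close> makes the interchange finite, and the
  part cut off is \<open>O(u ^ n)\<close>, summably in \<open>j\<close>.\<close>

lemma suminf_exchange_geometric:
  fixes a :: "nat \<Rightarrow> nat \<Rightarrow> complex" and u v C :: real
  assumes u: "0 \<le> u" "u < 1" and v: "0 \<le> v" "v < 1"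
    and a: "\<And>i j. cmod (a i j) \<le> C * u ^ i * v ^ j"
  shows "summable (\<lambda>j. a i j)" "summable (\<lambda>i. a i j)"
    and "summable (\<lambda>j. \<Sum>i. a i j)"
    and "(\<lambda>i. \<Sum>j. a i j) sums (\<Sum>j. \<Sum>i. a i j)"
proof -
  have C0: "0 \<le> C" using a[of 0 0] by (simp add: order_trans[OF norm_ge_zero])
  have sgu: "summable (\<lambda>i. c * u ^ i)" and sgv: "summable (\<lambda>i. c * v ^ i)" for c
    using u v by (auto intro!: summable_mult summable_geometric)
  have ai: "summable (\<lambda>i. a i j)" for j
    by (rule summable_comparison_test'[OF sgu[of "C * v ^ j"], of 0]) (use a in \<open>simp add: mult_ac\<close>)
  have aj: "summable (\<lambda>j. a i j)" for i
    by (rule summable_comparison_test'[OF sgv[of "C * u ^ i"], of 0]) (use a in simp)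
  have tail: "cmod ((\<Sum>i. a i j) - (\<Sum>i<n. a i j)) \<le> C * u ^ n / (1 - u) * v ^ j" for n j
  proof -
    have "(\<Sum>i. a i j) - (\<Sum>i<n. a i j) = (\<Sum>i. a (i + n) j)"
      using suminf_minus_initial_segment[OF ai] by simp
    also have "cmod \<dots> \<le> (\<Sum>i. C * u ^ n * v ^ j * u ^ i)"
    proof (rule norm_suminf_le[OF _ sgu])
      show "cmod (a (i + n) j) \<le> C * u ^ n * v ^ j * u ^ i" for i
        using a[of "i + n" j] by (simp add: power_add mult_ac)
    qed
    also have "\<dots> = C * u ^ n / (1 - u) * v ^ j"
      using u by (subst suminf_mult) (auto simp: suminf_geometric summable_geometric)
    finally show ?thesis .
  qed
  have sA: "summable (\<lambda>j. \<Sum>i. a i j)"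
    by (rule summable_comparison_test'[OF sgv[of "C / (1 - u)"], of 0]) (use tail[of _ 0] in simp)
  have "(\<lambda>n. (\<Sum>i<n. \<Sum>j. a i j)) \<longlonglongrightarrow> (\<Sum>j. \<Sum>i. a i j)"
  proof (rule LIM_zero_cancel, rule Lim_null_comparison)
    show "\<forall>\<^sub>F n in sequentially. cmod ((\<Sum>i<n. \<Sum>j. a i j) - (\<Sum>j. \<Sum>i. a i j)) \<le> C / (1 - u) / (1 - v) * u ^ n"
    proof (rule always_eventually, rule allI)
      fix n
      have fin: "(\<Sum>i<n. \<Sum>j. a i j) = (\<Sum>j. \<Sum>i<n. a i j)"
        by (rule suminf_sum[symmetric]) (rule aj)
      have "(\<Sum>j. \<Sum>i. a i j) - (\<Sum>i<n. \<Sum>j. a i j) = (\<Sum>j. (\<Sum>i. a i j) - (\<Sum>i<n. a i j))"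
        unfolding fin by (rule suminf_diff[OF sA summable_sum]) (rule aj)
      also have "cmod \<dots> \<le> (\<Sum>j. C * u ^ n / (1 - u) * v ^ j)"
        by (rule norm_suminf_le[OF tail sgv])
      also have "\<dots> = C / (1 - u) / (1 - v) * u ^ n"
        using v by (subst suminf_mult) (auto simp: suminf_geometric summable_geometric)
      finally show "cmod ((\<Sum>i<n. \<Sum>j. a i j) - (\<Sum>j. \<Sum>i. a i j)) \<le> C / (1 - u) / (1 - v) * u ^ n"
        by (simp add: norm_minus_commute)
    qed
    show "(\<lambda>n. C / (1 - u) / (1 - v) * u ^ n) \<longlonglongrightarrow> 0"
      using tendsto_mult_left[OF LIMSEQ_power_zero[of u], of "C / (1 - u) / (1 - v)"] u by simp
  qed
  then show "(\<lambda>i. \<Sum>j. a i j) sums (\<Sum>j. \<Sum>i. a i j)" by (simp add: sums_def)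
  show "summable (\<lambda>j. a i j)" "summable (\<lambda>i. a i j)" by (rule aj, rule ai)
  show "summable (\<lambda>j. \<Sum>i. a i j)" by (rule sA)
qed

lemma summable_geometric_bound:
  fixes x :: "nat \<Rightarrow> complex" and t C :: real
  assumes "0 \<le> t" "t < 1" "\<And>i. cmod (x i) \<le> C * t ^ i"
  shows "summable x" "cmod (suminf x) \<le> C / (1 - t)"
proof -
  have s: "summable (\<lambda>i. C * t ^ i)" using assms by (auto intro!: summable_mult summable_geometric)
  show "summable x" by (rule summable_comparison_test'[OF s, of 0]) (use assms in simp)
  have "cmod (suminf x) \<le> (\<Sum>i. C * t ^ i)" by (rule norm_suminf_le[OF assms(3) s])
  also have "\<dots> = C / (1 - t)" using assms by (subst suminf_mult) (auto simp: suminf_geometric summable_geometric)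
  finally show "cmod (suminf x) \<le> C / (1 - t)" .
qed

text \<open>The strict gap makes powers of \<open>t / q\<close> summable; with equal rates a factor
  \<open>j\<close> would appear. The constant \<open>q / (q - t)\<close> is the sum of that
  geometric series.\<close>

lemma convolution_bound:
  fixes t q :: real
  assumes t: "0 < t" "t < q" and C: "0 \<le> C" "0 \<le> D"
    and x: "\<And>i. cmod (x i) \<le> C * t ^ i" and y: "\<And>i. cmod (y i) \<le> D * q ^ i"
  shows "cmod (\<Sum>i\<le>j. x (j - i) * y i) \<le> C * D * (q / (q - t)) * q ^ j"
proof -
  have "cmod (\<Sum>i\<le>j. x (j - i) * y i) \<le> (\<Sum>i\<le>j. C * D * q ^ j * (t / q) ^ (j - i))"
  proof (rule sum_norm_le)
    fix i assume "i \<in> {..j}"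
    then have i: "q ^ j = q ^ (j - i) * q ^ i" by (simp add: power_add[symmetric])
    have "cmod (x (j - i) * y i) \<le> (C * t ^ (j - i)) * (D * q ^ i)"
      unfolding norm_mult using t C by (intro mult_mono x y) auto
    also have "\<dots> = C * D * q ^ j * (t / q) ^ (j - i)"
      using t unfolding i by (simp add: power_divide)
    finally show "cmod (x (j - i) * y i) \<le> C * D * q ^ j * (t / q) ^ (j - i)" .
  qed
  also have "\<dots> = C * D * q ^ j * (\<Sum>i<Suc j. (t / q) ^ i)"
    unfolding sum_distrib_left[symmetric] lessThan_Suc_atMost
    by (subst sum.nat_diff_reindex[of _ "Suc j", unfolded lessThan_Suc_atMost, symmetric]) simp
  also have "\<dots> \<le> C * D * q ^ j * (1 / (1 - t / q))"
    using t C by (intro mult_left_mono geometric_sum_le) auto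
  also have "1 / (1 - t / q) = q / (q - t)" using t by (simp add: field_simps)
  finally show ?thesis by (simp add: mult_ac)
qed

lemma fps_mult_nth_reversed: "fps_nth (x * y) n = (\<Sum>i\<le>n. fps_nth x (n - i) * fps_nth y i)" for x y :: "complex fps"
  using fps_mult_nth[of y x n]
  by (simp add: atLeast0AtMost mult.commute[of y x] mult.commute[of "fps_nth y _"])

section \<open>The Hankel correction and the multiplicative array \<open>X\<close>\<close>

text \<open>\<open>b\<close> and \<open>e\<close> are the analytic Wiener-Hopf factor and its
  inverse. \<open>t\<close> is the rate of their coefficients, \<open>q\<close> the slower rate that
  is kept after convolutions.\<close>

locale wiener_hopf =
  fixes t q :: real and b e :: "complex fps" and Cb Ce :: real
  assumes t0: "0 < t" and tq: "t < q" and q1: "q < 1"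
    and be: "b * e = 1" and b0: "fps_nth b 0 = 1"
    and b_le: "\<And>i. cmod (fps_nth b i) \<le> Cb * t ^ i"
    and e_le: "\<And>i. cmod (fps_nth e i) \<le> Ce * t ^ i"
begin

lemma q0: "0 < q" and t1: "t < 1" using t0 tq q1 by auto

lemma Cb0: "0 \<le> Cb" and Ce0: "0 \<le> Ce"
  using b_le[of 0] e_le[of 0] by (auto intro: order_trans[OF norm_ge_zero])

lemma e0: "fps_nth e 0 = 1"
  using arg_cong[OF be, of "\<lambda>x. fps_nth x 0"] b0 by simp

abbreviation "\<kappa> \<equiv> q / (q - t)"

lemma kappa0: "0 \<le> \<kappa>" using t0 tq by simp

lemma t_le_q: "t ^ i \<le> q ^ i" using t0 tq by (intro power_mono) auto

text \<open>The array \<open>T(e) H(b)\<close>: lower triangular Toeplitz times Hankel, the Hankel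
  part starting at the coefficient of index \<open>1\<close>.\<close>

definition B :: "nat \<Rightarrow> nat \<Rightarrow> complex" where
  "B j m = (\<Sum>i\<le>j. fps_nth e (j - i) * fps_nth b (i + m + 1))"

definition CB where "CB = Ce * Cb * \<kappa>"

lemma CB0: "0 \<le> CB" unfolding CB_def by (intro mult_nonneg_nonneg Cb0 Ce0 kappa0)

lemma B_le: "cmod (B j m) \<le> CB * q ^ j * t ^ m"
proof -
  have "cmod (B j m) \<le> Ce * (Cb * t ^ m) * \<kappa> * q ^ j"
    unfolding B_def
  proof (rule convolution_bound[OF t0 tq Ce0 _ e_le])
    show "0 \<le> Cb * t ^ m" using Cb0 t0 by simp
    show "cmod (fps_nth b (i + m + 1)) \<le> Cb * t ^ m * q ^ i" for i
    proof -
      have "cmod (fps_nth b (i + m + 1)) \<le> Cb * (t ^ (i + m) * t)" using b_le[of "i + m + 1"] by (simp add: mult_ac)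
      also have "\<dots> \<le> Cb * (t ^ (i + m) * 1)" using Cb0 t0 t1 by (intro mult_left_mono) auto
      also have "\<dots> = Cb * (t ^ i * t ^ m)" by (simp add: power_add)
      also have "\<dots> \<le> Cb * (q ^ i * t ^ m)" using Cb0 t0 by (intro mult_left_mono mult_right_mono t_le_q) auto
      finally show ?thesis by (simp add: mult_ac)
    qed
  qed
  then show ?thesis by (simp add: CB_def mult_ac)
qed

lemma B_0: "B 0 p = fps_nth b (Suc p)"
  by (simp add: B_def e0)

lemma B_0_right: "B j 0 = - fps_nth e (Suc j)"
proof -
  have "0 = fps_nth (e * b) (Suc j)" using be by (simp add: mult.commute)
  also have "\<dots> = (\<Sum>i\<le>Suc j. fps_nth e (Suc j - i) * fps_nth b i)" by (rule fps_mult_nth_reversed)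
  also have "\<dots> = fps_nth e (Suc j) * fps_nth b 0 + B j 0"
    by (subst sum.atMost_Suc_shift) (simp add: B_def)
  finally show ?thesis using b0 by (simp add: eq_neg_iff_add_eq_0 add.commute)
qed

text \<open>A Hankel entry depends only on the sum of its indices, so moving one step from column to
  row changes the convolution by a single boundary term. By \<open>B_0\<close> and
  \<open>B_0_right\<close> that term is minus a product of boundary entries of
  \<open>B\<close>.\<close>

lemma B_rec: "B j (Suc p) = B (Suc j) p + B j 0 * B 0 p"
proof -
  have "B (Suc j) p = fps_nth e (Suc j) * fps_nth b (Suc p) + B j (Suc p)"
    unfolding B_def by (subst sum.atMost_Suc_shift) simp
  then show ?thesis by (simp add: B_0 B_0_right)
qed

text \<open>\<open>T(b) T(e) = 1\<close>, so \<open>T(b)\<close> applied to \<open>T(e) H(b)\<close>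
  restores the Hankel array.\<close>

lemma b_convolution_B: "(\<Sum>i\<le>j. fps_nth b (j - i) * B i m) = fps_nth b (j + m + 1)"
proof -
  define y where "y = Abs_fps (\<lambda>i. fps_nth b (i + m + 1))"
  have "B i m = fps_nth (e * y) i" for i by (simp add: fps_mult_nth_reversed y_def B_def)
  then have "(\<Sum>i\<le>j. fps_nth b (j - i) * B i m) = fps_nth (b * (e * y)) j"
    by (simp add: fps_mult_nth_reversed[of b])
  also have "b * (e * y) = y" using be by (simp add: mult.assoc[symmetric])
  finally show ?thesis by (simp add: y_def)
qed

text \<open>The Toeplitz matrix of \<open>b(z) f(1/z)\<close> is \<open>T(b) X(f)\<close>, and \<open>X(f)\<close> represents
  \<open>T(b)\<^sup>-\<^sup>1 T(f(1/z)) T(b)\<close>, which is multiplicative in \<open>f\<close>.\<close>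

definition X :: "complex fps \<Rightarrow> nat \<Rightarrow> nat \<Rightarrow> complex" where
  "X f j k = (if j \<le> k then fps_nth f (k - j) else 0) + (\<Sum>m. B j m * fps_nth f (k + m + 1))"

lemma B_mult_le:
  assumes "\<And>i. cmod (y i) \<le> D"
  shows "cmod (B j m * y m) \<le> CB * q ^ j * D * t ^ m"
proof -
  have "cmod (B j m * y m) \<le> (CB * q ^ j * t ^ m) * D"
    unfolding norm_mult using CB0 q0 t0 by (intro mult_mono B_le assms) auto
  then show ?thesis by (simp add: mult_ac)
qed

lemma summable_B:
  assumes "\<And>i. cmod (y i) \<le> D"
  shows "summable (\<lambda>m. B j m * y m)" "cmod (\<Sum>m. B j m * y m) \<le> CB / (1 - t) * D * q ^ j"
  using summable_geometric_bound[OF less_imp_le[OF t0] t1 B_mult_le[OF assms], of j] by (auto simp: mult_ac)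

lemma decay_le_const:
  assumes "\<And>i. cmod (fps_nth f i) \<le> C * t ^ i"
  shows "cmod (fps_nth f i) \<le> C"
proof -
  have "0 \<le> C" using assms[of 0] by (auto intro: order_trans[OF norm_ge_zero])
  then have "C * t ^ i \<le> C" using t0 t1 by (simp add: mult_left_le power_le_one)
  then show ?thesis using assms[of i] by simp
qed

lemma decay_shift:
  assumes "\<And>i. cmod (fps_nth f i) \<le> C * t ^ i"
  shows "cmod (fps_nth f (k + m + 1)) \<le> C * t ^ k"
proof -
  have C: "0 \<le> C" using assms[of 0] by (auto intro: order_trans[OF norm_ge_zero])
  have "cmod (fps_nth f (k + m + 1)) \<le> C * t ^ (k + m + 1)" by (rule assms)
  also have "\<dots> \<le> C * t ^ k" using C t0 t1 by (intro mult_left_mono power_decreasing) auto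
  finally show ?thesis .
qed

lemma X_tail_le:
  assumes f: "\<And>i. cmod (fps_nth f i) \<le> C * t ^ i"
  shows "cmod (\<Sum>m. B j m * fps_nth f (k + m + 1)) \<le> CB / (1 - t) * C * t ^ k * q ^ j"
  using summable_B(2)[OF decay_shift[OF f], where j = j] by (simp add: mult_ac)

text \<open>Multiplicativity of \<open>X\<close> for the factor \<open>fps_X\<close>: row
  \<open>j\<close> of \<open>X fps_X\<close> has the entry \<open>1\<close> in column
  \<open>Suc j\<close> and \<open>B j 0\<close> in column \<open>0\<close>. The recursion
  \<open>B_rec\<close> is exactly what this needs.\<close>

lemma X_shift:
  assumes f: "\<And>i. cmod (fps_nth f i) \<le> C * t ^ i"
  shows "X (fps_X * f) j k = X f (Suc j) k + B j 0 * X f 0 k"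
proof -
  note s = summable_B(1)[OF decay_shift[OF f, of k]]
  have "(\<Sum>m. B j m * fps_nth (fps_X * f) (k + m + 1)) = (\<Sum>m. B j m * fps_nth f (k + m))"
    by simp
  also have "\<dots> = B j 0 * fps_nth f k + (\<Sum>m. B j (Suc m) * fps_nth f (k + m + 1))"
    using suminf_split_head[OF summable_B(1)[OF decay_le_const[OF f], of j "\<lambda>m. k + m"]] by simp
  also have "(\<Sum>m. B j (Suc m) * fps_nth f (k + m + 1)) =
      (\<Sum>m. B (Suc j) m * fps_nth f (k + m + 1) + B j 0 * (B 0 m * fps_nth f (k + m + 1)))"
    by (simp add: B_rec algebra_simps)
  also have "\<dots> = (\<Sum>m. B (Suc j) m * fps_nth f (k + m + 1)) + B j 0 * (\<Sum>m. B 0 m * fps_nth f (k + m + 1))"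
    using s by (subst suminf_add[symmetric]) (auto intro: summable_mult simp: suminf_mult)
  finally show ?thesis
    by (auto simp: X_def algebra_simps Suc_diff_le dest: le_antisym)
qed

lemma fps_X_power_decay:
  "cmod (fps_nth (fps_X ^ n) i) \<le> (1 / t) ^ n * t ^ i"
  using t0 by (auto simp: fps_X_power_nth power_divide)

lemma fps_X_power_mult_decay:
  assumes f: "\<And>i. cmod (fps_nth f i) \<le> C * t ^ i"
  shows "cmod (fps_nth (fps_X ^ n * f) i) \<le> (C / t ^ n) * t ^ i"
proof -
  have C: "0 \<le> C" using f[of 0] by (auto intro: order_trans[OF norm_ge_zero])
  show ?thesis
  proof (cases "i < n")
    case False
    then have "t ^ i = t ^ n * t ^ (i - n)" by (simp add: power_add[symmetric])
    then show ?thesis using f[of "i - n"] t0 False by (simp add: fps_X_power_mult_nth)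
  qed (use C t0 in \<open>simp add: fps_X_power_mult_nth\<close>)
qed

lemma X_power: "X (fps_X ^ n) j i = (if i = j + n then 1 else 0) + (if i < n then B j (n - i - 1) else 0)"
proof -
  have "(\<Sum>m. B j m * fps_nth (fps_X ^ n) (i + m + 1)) = (if i < n then B j (n - i - 1) else 0)"
  proof (cases "i < n")
    case True
    have "(\<Sum>m. B j m * fps_nth (fps_X ^ n) (i + m + 1)) = (\<Sum>m\<in>{n - i - 1}. B j m * fps_nth (fps_X ^ n) (i + m + 1))"
      by (rule suminf_finite) (use True in \<open>auto simp: fps_X_power_nth\<close>)
    then show ?thesis using True by (simp add: fps_X_power_nth)
  next
    case False
    then have "(\<lambda>m. B j m * fps_nth (fps_X ^ n) (i + m + 1)) = (\<lambda>m. 0)"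
      by (auto simp: fps_X_power_nth)
    then show ?thesis using False by simp
  qed
  then show ?thesis by (auto simp: X_def fps_X_power_nth)
qed

text \<open>Row \<open>j\<close> of \<open>X (fps_X ^ n)\<close> vanishes beyond column
  \<open>j + n\<close>, so the product is a finite sum; it follows by iterating the shift.\<close>

lemma X_power_mult:
  assumes f: "\<And>i. cmod (fps_nth f i) \<le> C * t ^ i"
  shows "X (fps_X ^ n * f) j k = (\<Sum>i\<le>j + n. X (fps_X ^ n) j i * X f i k)"
proof (induction n arbitrary: j)
  case 0
  have "(\<Sum>i\<le>j. X (fps_X ^ 0) j i * X f i k) = (\<Sum>i\<le>j. if i = j then X f i k else 0)"
    by (rule sum.cong) (auto simp: X_power simp del: power_0)
  then show ?case by simp
next
  case (Suc n)
  have "X (fps_X ^ Suc n * f) j k = X (fps_X ^ n * f) (Suc j) k + B j 0 * X (fps_X ^ n * f) 0 k"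
    using X_shift[OF fps_X_power_mult_decay[OF f], of n j k] by (simp add: mult.assoc)
  also have "X (fps_X ^ n * f) 0 k = (\<Sum>i\<le>j + Suc n. X (fps_X ^ n) 0 i * X f i k)"
    unfolding Suc.IH by (rule sum.mono_neutral_left) (auto simp: X_power)
  also have "X (fps_X ^ n * f) (Suc j) k = (\<Sum>i\<le>j + Suc n. X (fps_X ^ n) (Suc j) i * X f i k)"
    unfolding Suc.IH by simp
  also have "(\<Sum>i\<le>j + Suc n. X (fps_X ^ n) (Suc j) i * X f i k)
      + B j 0 * (\<Sum>i\<le>j + Suc n. X (fps_X ^ n) 0 i * X f i k)
      = (\<Sum>i\<le>j + Suc n. X (fps_X ^ Suc n) j i * X f i k)"
    unfolding sum_distrib_left sum.distrib[symmetric]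
    by (rule sum.cong[OF refl]) (simp add: X_shift[OF fps_X_power_decay] distrib_right mult.assoc)
  finally show ?case .
qed

lemma X_power_le: "cmod (X (fps_X ^ n) j i) \<le> 1 + CB"
proof -
  have B1: "cmod (B j m) \<le> CB" for m
  proof -
    have "CB * q ^ j * t ^ m \<le> CB * 1 * 1"
      using CB0 q0 q1 t0 t1 by (intro mult_mono) (auto simp: power_le_one)
    then show ?thesis using B_le[of j m] by simp
  qed
  show ?thesis
    unfolding X_power by (rule order_trans[OF norm_triangle_ineq], rule add_mono) (use B1 CB0 in auto)
qed

text \<open>Decay in the row index at a fixed column. The constant grows with \<open>k\<close>,
  which is harmless because the bound only justifies an interchange of sums at fixed
  \<open>k\<close>.\<close>

lemma X_row_le:
  assumes f: "\<And>i. cmod (fps_nth f i) \<le> C * t ^ i"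
  shows "cmod (X f i k) \<le> C * (1 / q ^ k + CB / (1 - t)) * q ^ i"
proof -
  have C: "0 \<le> C" using f[of 0] by (auto intro: order_trans[OF norm_ge_zero])
  have 1: "cmod (if i \<le> k then fps_nth f (k - i) else 0) \<le> C * (1 / q ^ k) * q ^ i"
  proof (cases "i \<le> k")
    case True
    have "cmod (fps_nth f (k - i)) \<le> C * 1" using decay_le_const[OF f] by simp
    also have "\<dots> \<le> C * (1 / q ^ (k - i))" using C q0 q1 by (intro mult_left_mono) (auto simp: power_le_one)
    also have "1 / q ^ (k - i) = 1 / q ^ k * q ^ i"
      using True q0 by (simp add: field_simps power_add[symmetric])
    finally show ?thesis using True by (simp add: mult_ac)
  qed (use C q0 in simp)
  have "cmod (\<Sum>m. B i m * fps_nth f (k + m + 1)) \<le> CB / (1 - t) * C * t ^ k * q ^ i"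
    by (rule X_tail_le[OF f])
  also have "\<dots> \<le> CB / (1 - t) * C * 1 * q ^ i"
    using CB0 C t0 t1 q0 by (intro mult_right_mono mult_left_mono) (auto simp: power_le_one)
  finally have 2: "cmod (\<Sum>m. B i m * fps_nth f (k + m + 1)) \<le> C * (CB / (1 - t)) * q ^ i"
    by (simp add: mult_ac)
  show ?thesis
    unfolding X_def
    by (rule order_trans[OF norm_triangle_ineq], rule order_trans[OF add_mono[OF 1 2]])
       (simp add: algebra_simps)
qed

text \<open>Linearity of \<open>X\<close>, extended to the infinite expansion of \<open>f\<close> in
  powers of \<open>fps_X\<close> by interchanging the sums over \<open>n\<close> and
  \<open>m\<close>.\<close>

lemma X_as_series:
  assumes f: "\<And>i. cmod (fps_nth f i) \<le> C * t ^ i" and h: "\<And>i. cmod (fps_nth h i) \<le> D * t ^ i"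
  shows "(\<lambda>n. fps_nth f n * X (fps_X ^ n * h) j k) sums X (f * h) j k"
proof -
  have C: "0 \<le> C" using f[of 0] by (auto intro: order_trans[OF norm_ge_zero])
  have D: "0 \<le> D" using h[of 0] by (auto intro: order_trans[OF norm_ge_zero])
  define a where "a n m = fps_nth f n * (B j m * fps_nth (fps_X ^ n * h) (k + m + 1))" for n m
  have hc: "cmod (fps_nth (fps_X ^ n * h) i) \<le> D" for n i
    using decay_le_const[OF h] D by (simp add: fps_X_power_mult_nth)
  have a: "cmod (a n m) \<le> C * (CB * q ^ j * D) * t ^ n * t ^ m" for n m
  proof -
    have "cmod (a n m) \<le> (C * t ^ n) * (CB * q ^ j * D * t ^ m)"
      unfolding a_def norm_mult[of "fps_nth f n"]
      using C t0 by (intro mult_mono f B_mult_le hc) auto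
    then show ?thesis by (simp add: mult_ac)
  qed
  note ex = suminf_exchange_geometric[OF less_imp_le[OF t0] t1 less_imp_le[OF t0] t1 a]
  have fin: "(\<lambda>n. fps_nth f n * fps_nth (fps_X ^ n * h) p) sums fps_nth (f * h) p" for p
  proof -
    have "fps_nth (f * h) p = (\<Sum>n\<le>p. fps_nth f n * fps_nth (fps_X ^ n * h) p)"
      by (simp add: fps_mult_nth[of f] atLeast0AtMost fps_X_power_mult_nth)
    moreover have "(\<lambda>n. fps_nth f n * fps_nth (fps_X ^ n * h) p) sums
        (\<Sum>n\<le>p. fps_nth f n * fps_nth (fps_X ^ n * h) p)"
      by (rule sums_finite) (auto simp: fps_X_power_mult_nth)
    ultimately show ?thesis by simp
  qed
  have "(\<lambda>n. a n m) sums (B j m * fps_nth (f * h) (k + m + 1))" for m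
    unfolding a_def using sums_mult[OF fin[of "k + m + 1"], of "B j m"] by (simp add: mult_ac)
  then have "(\<Sum>n. a n m) = B j m * fps_nth (f * h) (k + m + 1)" for m by (simp add: sums_iff)
  then have 1: "(\<lambda>n. \<Sum>m. a n m) sums (\<Sum>m. B j m * fps_nth (f * h) (k + m + 1))"
    using ex(4) by simp
  have "(\<Sum>m. a n m) = fps_nth f n * (\<Sum>m. B j m * fps_nth (fps_X ^ n * h) (k + m + 1))" for n
    unfolding a_def using summable_B(1)[OF hc] by (subst suminf_mult) auto
  with 1 have 1: "(\<lambda>n. fps_nth f n * (\<Sum>m. B j m * fps_nth (fps_X ^ n * h) (k + m + 1))) sums
      (\<Sum>m. B j m * fps_nth (f * h) (k + m + 1))" by simp
  have 2: "(\<lambda>n. fps_nth f n * (if j \<le> k then fps_nth (fps_X ^ n * h) (k - j) else 0)) sums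
      (if j \<le> k then fps_nth (f * h) (k - j) else 0)"
    using fin[of "k - j"] by (cases "j \<le> k") simp_all
  show ?thesis
    unfolding X_def distrib_left by (rule sums_add[OF 2 1])
qed

text \<open>Powers of \<open>fps_X\<close> as first factor are covered by
  \<open>X_power_mult\<close>; expanding \<open>f\<close> and interchanging sums gives the rest. The
  identity concerns the infinite arrays; their corners satisfy it only approximately.\<close>

lemma X_mult:
  assumes f: "\<And>i. cmod (fps_nth f i) \<le> C * t ^ i" and h: "\<And>i. cmod (fps_nth h i) \<le> D * t ^ i"
  shows "(\<lambda>i. X f j i * X h i k) sums X (f * h) j k"
proof -
  have C: "0 \<le> C" using f[of 0] by (auto intro: order_trans[OF norm_ge_zero])
  define a where "a i n = X (fps_X ^ n) j i * X h i k * fps_nth f n" for i n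
  let ?D = "D * (1 / q ^ k + CB / (1 - t))"
  have a: "cmod (a i n) \<le> (1 + CB) * ?D * C * q ^ i * t ^ n" for i n
  proof -
    have "cmod (a i n) \<le> ((1 + CB) * (?D * q ^ i)) * (C * t ^ n)"
      unfolding a_def norm_mult using C CB0
      by (intro mult_mono f X_power_le X_row_le[OF h] mult_nonneg_nonneg order_trans[OF norm_ge_zero X_row_le[OF h]]) auto
    then show ?thesis by (simp add: mult_ac)
  qed
  note ex = suminf_exchange_geometric[OF less_imp_le[OF q0] q1 less_imp_le[OF t0] t1 a]
  have "(\<lambda>n. fps_nth f n * X (fps_X ^ n * 1) j i) sums X (f * 1) j i" for i
    by (rule X_as_series[OF f, of 1 1]) (use t0 in auto)
  then have "(\<lambda>n. X h i k * (fps_nth f n * X (fps_X ^ n) j i)) sums (X h i k * X f j i)" for i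
    by (intro sums_mult) simp
  then have 1: "(\<Sum>n. a i n) = X f j i * X h i k" for i
    by (simp add: a_def sums_iff mult_ac)
  have "(\<lambda>i. a i n) sums (\<Sum>i\<le>j + n. a i n)" for n
    by (rule sums_finite) (auto simp: a_def X_power)
  then have "(\<Sum>i. a i n) = (\<Sum>i\<le>j + n. a i n)" for n by (simp add: sums_iff)
  also have "(\<Sum>i\<le>j + n. a i n) = fps_nth f n * X (fps_X ^ n * h) j k" for n
    unfolding X_power_mult[OF h] a_def sum_distrib_left by (simp add: mult_ac)
  finally have "(\<Sum>n. \<Sum>i. a i n) = X (f * h) j k"
    using X_as_series[OF f h, of j k] by (simp add: sums_iff)
  then show ?thesis using ex(4) by (simp add: 1)
qed

end

section \<open>Triangular Toeplitz corners\<close>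

text \<open>\<open>lower x\<close> and \<open>upper x\<close> are the Toeplitz arrays of
  \<open>x(z)\<close> and \<open>x(1/z)\<close>.\<close>

definition lower :: "complex fps \<Rightarrow> nat \<Rightarrow> nat \<Rightarrow> complex" where
  "lower x i j = (if j \<le> i then fps_nth x (i - j) else 0)"

definition upper :: "complex fps \<Rightarrow> nat \<Rightarrow> nat \<Rightarrow> complex" where
  "upper x i j = (if i \<le> j then fps_nth x (j - i) else 0)"

lemma sum_mult_upper:
  assumes "j < n"
  shows "(\<Sum>k<n. a k * upper x k j) = (\<Sum>k\<le>j. a k * fps_nth x (j - k))"
  using assms by (intro sum.mono_neutral_cong_right) (auto simp: upper_def)

lemma sum_lower_mult:
  assumes "i < n"
  shows "(\<Sum>k<n. lower x i k * a k) = (\<Sum>k\<le>i. fps_nth x (i - k) * a k)"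
  using assms by (intro sum.mono_neutral_cong_right) (auto simp: lower_def)

lemma convolution_fps: "(\<Sum>k\<le>j. a k * fps_nth x (j - k)) = fps_nth (Abs_fps a * x) j"
  by (simp add: fps_mult_nth atLeast0AtMost)

lemma convolution_fps': "(\<Sum>k\<le>j. fps_nth x (j - k) * a k) = fps_nth (x * Abs_fps a) j" for a :: "nat \<Rightarrow> complex"
  by (subst fps_mult_nth_reversed) simp

lemma upper_convolution: "(\<Sum>k\<le>j. upper x i k * fps_nth y (j - k)) = upper (x * y) i j"
proof (cases "i \<le> j")
  case True
  have "(\<Sum>k\<le>j. upper x i k * fps_nth y (j - k)) = (\<Sum>k\<in>{0 + i..j - i + i}. upper x i k * fps_nth y (j - k))"
    using True by (intro sum.mono_neutral_right) (auto simp: upper_def)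
  also have "\<dots> = (\<Sum>l=0..j - i. fps_nth x l * fps_nth y (j - i - l))"
    by (subst sum.shift_bounds_cl_nat_ivl) (auto simp: upper_def intro!: sum.cong arg_cong[where f = "fps_nth y"])
  finally show ?thesis using True by (simp add: upper_def fps_mult_nth)
qed (auto simp: upper_def intro!: sum.neutral)

lemma fdet_upper: "fps_nth x 0 = 1 \<Longrightarrow> fdet n (upper x) = 1"
  by (rule fdet_upper_triangular) (auto simp: upper_def)

lemma upper_1: "upper 1 i j = (if i = j then 1 else 0)"
  by (auto simp: upper_def)

lemma double_sum_triangle:
  "(\<Sum>j\<le>n. \<Sum>l\<le>j. h l) = (\<Sum>l\<le>n. of_nat (n + 1 - l) * (h l :: complex))"
proof (induction n)
  case (Suc n)
  have "(\<Sum>l\<le>Suc n. of_nat (Suc n + 1 - l) * h l) = (\<Sum>l\<le>n. of_nat (Suc n + 1 - l) * h l) + h (Suc n)"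
    by simp
  also have "(\<Sum>l\<le>n. of_nat (Suc n + 1 - l) * h l) = (\<Sum>l\<le>n. of_nat (n + 1 - l) * h l) + (\<Sum>l\<le>n. h l)"
    unfolding sum.distrib[symmetric]
    by (rule sum.cong[OF refl]) (auto simp: Suc_diff_le of_nat_diff algebra_simps)
  finally show ?case by (simp add: Suc.IH)
qed simp

section \<open>The kernel \<open>K\<close>: decay, asymptotic multiplicativity and trace\<close>

context wiener_hopf
begin

definition decays :: "complex fps \<Rightarrow> bool" where
  "decays f \<longleftrightarrow> (\<exists>C. \<forall>i. cmod (fps_nth f i) \<le> C * t ^ i)"

lemma decaysE:
  assumes "decays f"
  obtains C where "0 \<le> C" "\<And>i. cmod (fps_nth f i) \<le> C * t ^ i"
proof -
  obtain C where C: "\<And>i. cmod (fps_nth f i) \<le> C * t ^ i" using assms by (auto simp: decays_def)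
  have "0 \<le> C" using C[of 0] by (auto intro: order_trans[OF norm_ge_zero])
  then show ?thesis using that C by blast
qed

text \<open>For \<open>g = 1/f\<close> this is \<open>T(e)\<close> times the Hankel arrays of
  \<open>b\<close> and \<open>f\<close> times the upper triangular array of \<open>g\<close>, a
  kernel of Borodin-Okounkov type.\<close>

definition K :: "complex fps \<Rightarrow> complex fps \<Rightarrow> nat \<Rightarrow> nat \<Rightarrow> complex" where
  "K f g j k = (\<Sum>m. B j m * (\<Sum>i\<le>k. fps_nth g (k - i) * fps_nth f (i + m + 1)))"

lemma K_inner_le:
  assumes C: "0 \<le> C" "0 \<le> D"
    and f: "\<And>i. 1 \<le> i \<Longrightarrow> cmod (fps_nth f i) \<le> C * t ^ i" and g: "\<And>i. cmod (fps_nth g i) \<le> D * t ^ i"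
  shows "cmod (\<Sum>i\<le>k. fps_nth g (k - i) * fps_nth f (i + m + 1)) \<le> D * C * \<kappa> * q ^ k"
proof (rule convolution_bound[OF t0 tq C(2) C(1) g])
  fix i
  have "cmod (fps_nth f (i + m + 1)) \<le> C * t ^ (i + m + 1)" by (rule f) simp
  also have "\<dots> \<le> C * t ^ i" using C t0 t1 by (intro mult_left_mono power_decreasing) auto
  also have "\<dots> \<le> C * q ^ i" using C by (intro mult_left_mono t_le_q)
  finally show "cmod (fps_nth f (i + m + 1)) \<le> C * q ^ i" .
qed

text \<open>Only coefficients of \<open>f\<close> from index \<open>1\<close> on enter the Hankel
  array, and the bound is linear in their size \<open>C\<close>. Along \<open>exp (x * Q)\<close>
  this makes the kernel \<open>O(x)\<close>.\<close>

lemma K_le: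
  assumes C: "0 \<le> C" "0 \<le> D"
    and f: "\<And>i. 1 \<le> i \<Longrightarrow> cmod (fps_nth f i) \<le> C * t ^ i" and g: "\<And>i. cmod (fps_nth g i) \<le> D * t ^ i"
  shows "cmod (K f g j k) \<le> (CB / (1 - t) * D * \<kappa>) * C * q ^ (j + k)"
  using summable_B(2)[OF K_inner_le[OF assms], of j k "\<lambda>m. m"]
  unfolding K_def by (simp add: power_add mult_ac)

lemma X_convolution:
  assumes f: "decays f" and fg: "f * g = 1"
  shows "(\<Sum>i\<le>k. X f j i * fps_nth g (k - i)) = idp (K f g) j k"
proof -
  obtain C where C: "\<And>i. cmod (fps_nth f i) \<le> C * t ^ i" using f by (rule decaysE) blast
  have s: "summable (\<lambda>m. B j m * fps_nth f (i + m + 1))" for i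
    by (rule summable_B(1)[OF decay_shift[OF C]])
  have "(\<Sum>i\<le>k. (\<Sum>m. B j m * fps_nth f (i + m + 1)) * fps_nth g (k - i))
      = (\<Sum>i\<le>k. \<Sum>m. B j m * fps_nth f (i + m + 1) * fps_nth g (k - i))"
    by (rule sum.cong[OF refl]) (rule suminf_mult2[OF s])
  also have "\<dots> = (\<Sum>m. \<Sum>i\<le>k. B j m * fps_nth f (i + m + 1) * fps_nth g (k - i))"
    by (rule suminf_sum[symmetric]) (rule summable_mult2[OF s])
  also have "\<dots> = K f g j k"
    unfolding K_def by (simp add: sum_distrib_left mult_ac)
  finally show ?thesis
    using upper_convolution[of f j g k]
    by (simp add: X_def distrib_right sum.distrib upper_def[of f, symmetric] fg upper_1 idp_def)
qed

text \<open>Convolution in the column index is multiplication of power series, so the factor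
  \<open>g\<close> is undone by the factor \<open>f\<close>.\<close>

lemma X_eq_convolution:
  assumes f: "decays f" and fg: "f * g = 1"
  shows "X f j k = (\<Sum>i\<le>k. idp (K f g) j i * fps_nth f (k - i))"
proof -
  have "Abs_fps (idp (K f g) j) = Abs_fps (X f j) * g"
    by (rule fps_ext) (simp add: X_convolution[OF assms, symmetric] convolution_fps)
  then have "Abs_fps (idp (K f g) j) * f = Abs_fps (X f j)"
    using fg by (simp add: mult.assoc mult.commute[of g])
  then show ?thesis by (simp add: convolution_fps)
qed

text \<open>The right factor is upper triangular, so the corner of the product is the product of the
  corners, and this factor has determinant \<open>1\<close>.\<close>

lemma fdet_X:
  assumes f: "decays f" and fg: "f * g = 1" and g0: "fps_nth g 0 = 1"
  shows "fdet n (X f) = fdet n (idp (K f g))"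
proof -
  have "fdet n (X f) * fdet n (upper g) = fdet n (idp (K f g))"
    unfolding fdet_mult
    by (rule fdet_cong) (simp add: sum_mult_upper X_convolution[OF f fg])
  then show ?thesis by (simp add: fdet_upper[OF g0])
qed

lemma X_le_const:
  assumes f: "\<And>i. cmod (fps_nth f i) \<le> C * t ^ i"
  shows "cmod (X f j k) \<le> C * (1 + CB / (1 - t))"
proof -
  have C: "0 \<le> C" using f[of 0] by (auto intro: order_trans[OF norm_ge_zero])
  have 1: "cmod (if j \<le> k then fps_nth f (k - j) else 0) \<le> C"
    using decay_le_const[OF f] C by auto
  have "CB / (1 - t) * C * t ^ k * q ^ j \<le> CB / (1 - t) * C * 1 * 1"
    using CB0 C t0 t1 q0 q1 by (intro mult_mono) (auto simp: power_le_one)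
  then have 2: "cmod (\<Sum>m. B j m * fps_nth f (k + m + 1)) \<le> CB / (1 - t) * C"
    using X_tail_le[OF f, of j k] by simp
  show ?thesis
    unfolding X_def
    by (rule order_trans[OF norm_triangle_ineq], rule order_trans[OF add_mono[OF 1 2]])
       (simp add: algebra_simps)
qed

text \<open>The missing terms have \<open>l \<ge> n > i\<close>. Below the diagonal
  \<open>X h l i\<close> consists of its Hankel part alone, which decays like
  \<open>q ^ l\<close>.\<close>

lemma truncated_product_error:
  assumes f: "\<And>i. cmod (fps_nth f i) \<le> C * t ^ i" and h: "\<And>i. cmod (fps_nth h i) \<le> D * t ^ i"
    and i: "i < n"
  shows "cmod (X (f * h) j i - (\<Sum>l<n. X f j l * X h l i))
    \<le> C * (1 + CB / (1 - t)) * (CB / (1 - t) * D) / (1 - q) * q ^ n * t ^ i"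
proof -
  let ?c = "C * (1 + CB / (1 - t)) * (CB / (1 - t) * D) * t ^ i * q ^ n"
  have C: "0 \<le> C" "0 \<le> D" using f[of 0] h[of 0] by (auto intro: order_trans[OF norm_ge_zero])
  note s = X_mult[OF f h, of j i]
  have "X (f * h) j i - (\<Sum>l<n. X f j l * X h l i) = (\<Sum>l. X f j (l + n) * X h (l + n) i)"
    using suminf_minus_initial_segment[OF sums_summable[OF s], of n] sums_unique[OF s] by simp
  also have "cmod \<dots> \<le> ?c / (1 - q)"
  proof (rule summable_geometric_bound[OF less_imp_le[OF q0] q1])
    fix l
    have "X h (l + n) i = (\<Sum>m. B (l + n) m * fps_nth h (i + m + 1))"
      using i by (simp add: X_def)
    then have "cmod (X h (l + n) i) \<le> CB / (1 - t) * D * t ^ i * q ^ (l + n)"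
      using X_tail_le[OF h, of "l + n" i] by simp
    then have "cmod (X f j (l + n) * X h (l + n) i)
        \<le> (C * (1 + CB / (1 - t))) * (CB / (1 - t) * D * t ^ i * q ^ (l + n))"
      unfolding norm_mult using C CB0 t1
      by (intro mult_mono X_le_const[OF f]) auto
    then show "cmod (X f j (l + n) * X h (l + n) i) \<le> ?c * q ^ l"
      by (simp add: power_add mult_ac)
  qed
  finally show ?thesis by (simp add: mult_ac)
qed

text \<open>Determinants multiply exactly on finite corners, the arrays \<open>X\<close> only as
  infinite arrays. The two are compared row by row; errors \<open>O(q ^ n)\<close> in
  \<open>n\<close> rows give \<open>O(n * q ^ n)\<close>.\<close>

lemma fdet_K_mult:
  assumes f: "decays f" and h: "decays h" and f': "decays f'" and h': "decays h'"
    and fh: "decays (f * h)" and fh': "decays (f' * h')"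
    and ff': "f * f' = 1" "fps_nth f' 0 = 1" and hh': "h * h' = 1" "fps_nth h' 0 = 1"
  shows "(\<lambda>n. fdet n (idp (K (f * h) (f' * h'))) - fdet n (idp (K f f')) * fdet n (idp (K h h'))) \<longlonglongrightarrow> 0"
proof -
  obtain C where C: "0 \<le> C" "\<And>i. cmod (fps_nth f i) \<le> C * t ^ i" using f by (rule decaysE) blast
  obtain D where D: "0 \<le> D" "\<And>i. cmod (fps_nth h i) \<le> D * t ^ i" using h by (rule decaysE) blast
  obtain M where M: "0 \<le> M" "\<And>i. cmod (fps_nth (f * h) i) \<le> M * t ^ i" using fh by (rule decaysE) blast
  obtain M' where M': "0 \<le> M'" "\<And>i. cmod (fps_nth (f' * h') i) \<le> M' * t ^ i" using fh' by (rule decaysE) blast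
  define c where "c = (CB / (1 - t) * M' * \<kappa>) * M"
  have c: "0 \<le> c" unfolding c_def using CB0 M M' kappa0 t1 by (intro mult_nonneg_nonneg) auto
  have K: "cmod (K (f * h) (f' * h') i j) \<le> c * q ^ (i + j)" for i j
    unfolding c_def by (rule K_le[OF M(1) M'(1)]) (use M M' in auto)
  define E where "E = C * (1 + CB / (1 - t)) * (CB / (1 - t) * D) / (1 - q)"
  have E: "0 \<le> E" unfolding E_def using C D CB0 t1 q1 by (intro divide_nonneg_nonneg mult_nonneg_nonneg) auto
  define E' where "E' = M' * E * \<kappa> / (1 - q)"
  have E': "0 \<le> E'" unfolding E'_def using M' E kappa0 q1 t0 tq by (intro divide_nonneg_nonneg mult_nonneg_nonneg) auto
  have inv: "(f * h) * (f' * h') = 1"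
    using ff' hh' by (metis mult.assoc mult.commute mult.right_neutral)
  \<comment> \<open>The product of the corners of \<open>X f\<close>, \<open>X h\<close> and the
    triangular array of the inverse of \<open>f * h\<close>. Without the truncation error of the
    first product it would equal \<open>idp (K (f * h) (f' * h'))\<close>.\<close>
  define A where "A n i j = (\<Sum>k<n. (\<Sum>l<n. X f i l * X h l k) * upper (f' * h') k j)" for n i j
  have detA: "fdet n (A n) = fdet n (idp (K f f')) * fdet n (idp (K h h'))" for n
  proof -
    have "fdet n (A n) = fdet n (X f) * fdet n (X h) * fdet n (upper (f' * h'))"
      unfolding fdet_mult A_def ..
    moreover have "fps_nth (f' * h') 0 = 1" using ff' hh' by simp
    ultimately show ?thesis
      using fdet_X[OF f ff'] fdet_X[OF h hh'] by (simp add: fdet_upper)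
  qed
  have diff: "(\<Sum>j<n. cmod (idp (K (f * h) (f' * h')) i j - A n i j)) \<le> E' * q ^ n" if i: "i < n" for n i
  proof -
    define y where "y k = (if k < n then X (f * h) i k - (\<Sum>l<n. X f i l * X h l k) else 0)" for k
    have y: "cmod (y k) \<le> E * q ^ n * q ^ k" for k
    proof (cases "k < n")
      case True
      have "cmod (y k) \<le> E * q ^ n * t ^ k"
        unfolding E_def using True truncated_product_error[OF C(2) D(2) True, of i] by (simp add: y_def)
      also have "\<dots> \<le> E * q ^ n * q ^ k" using E q0 by (intro mult_left_mono t_le_q) auto
      finally show ?thesis .
    qed (use E q0 in \<open>simp add: y_def\<close>)
    have "idp (K (f * h) (f' * h')) i j - A n i j = (\<Sum>k\<le>j. fps_nth (f' * h') (j - k) * y k)" if j: "j < n" for j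
    proof -
      have "idp (K (f * h) (f' * h')) i j - A n i j
          = (\<Sum>k\<le>j. (X (f * h) i k - (\<Sum>l<n. X f i l * X h l k)) * fps_nth (f' * h') (j - k))"
        unfolding A_def sum_mult_upper[OF j] X_convolution[OF fh inv, symmetric]
        by (simp add: sum_subtractf left_diff_distrib)
      also have "\<dots> = (\<Sum>k\<le>j. fps_nth (f' * h') (j - k) * y k)"
        using j by (intro sum.cong) (auto simp: y_def)
      finally show ?thesis .
    qed
    then have "cmod (idp (K (f * h) (f' * h')) i j - A n i j) \<le> M' * (E * q ^ n) * \<kappa> * q ^ j" if "j < n" for j
      using convolution_bound[OF t0 tq M'(1) _ M'(2) y, of j] E q0 that by simp
    then have "(\<Sum>j<n. cmod (idp (K (f * h) (f' * h')) i j - A n i j)) \<le> M' * (E * q ^ n) * \<kappa> / (1 - q)"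
      by (intro sum_geometric_le mult_nonneg_nonneg) (use q0 q1 M' E kappa0 in auto)
    then show ?thesis by (simp add: E'_def mult_ac)
  qed
  \<comment> \<open>Enlarged so that one row bound serves both matrices: for \<open>i < n\<close>
    the row error \<open>E' * q ^ n\<close> is at most \<open>E' * q ^ i\<close>.\<close>
  define c' where "c' = c + E' * (1 - q)"
  have c': "0 \<le> c'" "c' / (1 - q) = c / (1 - q) + E'"
    using c E' q1 by (auto simp: c'_def add_divide_distrib)
  have row: "(\<Sum>j<n. cmod (idp (K (f * h) (f' * h')) i j)) \<le> 1 + c / (1 - q) * q ^ i" if "i < n" for n i
    by (rule idp_row_le[OF q0 q1 c that K])
  have bound: "cmod (fdet n (idp (K (f * h) (f' * h'))) - fdet n (A n)) \<le> exp (c' / (1 - q)\<^sup>2) * E' * (of_nat n * q ^ n)" for n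
  proof -
    have "cmod (fdet n (idp (K (f * h) (f' * h'))) - fdet n (A n))
        \<le> (\<Prod>i<n. 1 + c' / (1 - q) * q ^ i) * (\<Sum>i<n. E' * q ^ n)"
    proof (rule norm_fdet_diff_le[OF _ _ diff])
      fix i assume i: "i < n"
      have le: "E' * q ^ n \<le> E' * q ^ i" using E' q0 q1 i by (intro mult_left_mono power_decreasing) auto
      have "0 \<le> E' * q ^ i" using E' q0 by simp
      then show "(\<Sum>j<n. cmod (idp (K (f * h) (f' * h')) i j)) \<le> 1 + c' / (1 - q) * q ^ i"
        using row[OF i] by (simp add: c'(2) distrib_right)
      have "(\<Sum>j<n. cmod (A n i j)) \<le> (\<Sum>j<n. cmod (idp (K (f * h) (f' * h')) i j)
          + cmod (idp (K (f * h) (f' * h')) i j - A n i j))"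
        by (rule sum_mono) (metis norm_minus_commute norm_triangle_sub)
      also have "\<dots> \<le> (1 + c / (1 - q) * q ^ i) + E' * q ^ n"
        unfolding sum.distrib by (rule add_mono[OF row[OF i] diff[OF i]])
      finally show "(\<Sum>j<n. cmod (A n i j)) \<le> 1 + c' / (1 - q) * q ^ i"
        using le by (simp add: c'(2) distrib_right)
    next
      show "1 \<le> 1 + c' / (1 - q) * q ^ i" for i using c E' q0 q1 by (simp add: c'(2))
    qed
    also have "\<dots> \<le> exp (c' / (1 - q)\<^sup>2) * (\<Sum>i<n. E' * q ^ n)"
      using E' q0 by (intro mult_right_mono prod_one_plus_geometric_le[OF q0 q1 c'(1)] sum_nonneg) auto
    finally show ?thesis by (simp add: mult_ac)
  qed
  have "(\<lambda>n. of_nat n * q ^ n) \<longlonglongrightarrow> 0" using q0 q1 by (intro powser_times_n_limit_0) simp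
  then have "(\<lambda>n. exp (c' / (1 - q)\<^sup>2) * E' * (of_nat n * q ^ n)) \<longlonglongrightarrow> 0"
    by (rule tendsto_mult_right_zero)
  then show ?thesis
    by (rule Lim_null_comparison[rotated]) (use bound detA in auto)
qed

text \<open>To first order in \<open>x\<close>, \<open>g\<close> is \<open>1\<close> and
  \<open>f\<close> is \<open>x * Q\<close> beyond its constant term, so the inner convolution
  reduces to its term \<open>i = j\<close>. The error is quadratic in \<open>x\<close>, uniformly in
  \<open>n\<close>.\<close>

lemma trace_K:
  assumes M: "0 \<le> M" and x: "cmod x \<le> 1"
    and f: "\<And>i. 1 \<le> i \<Longrightarrow> cmod (fps_nth f i) \<le> M * cmod x * t ^ i"
    and fQ: "\<And>i. 1 \<le> i \<Longrightarrow> cmod (fps_nth f i - x * fps_nth Q i) \<le> M * (cmod x)\<^sup>2 * t ^ i"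
    and g: "\<And>i. 1 \<le> i \<Longrightarrow> cmod (fps_nth g i) \<le> M * cmod x * t ^ i" and g0: "fps_nth g 0 = 1"
    and Q: "\<And>i. cmod (fps_nth Q i) \<le> C * t ^ i"
  shows "cmod ((\<Sum>j<n. K f g j j) - x * (\<Sum>j<n. \<Sum>m. B j m * fps_nth Q (j + m + 1)))
    \<le> CB / (1 - t) * (M + M * M * \<kappa>) / (1 - q) * (cmod x)\<^sup>2"
proof -
  let ?F = "\<lambda>j m. \<Sum>i\<le>j. fps_nth g (j - i) * fps_nth f (i + m + 1)"
  have y: "0 \<le> M * cmod x" using M by simp
  have F: "cmod (?F j m - x * fps_nth Q (j + m + 1)) \<le> (M + M * M * \<kappa>) * (cmod x)\<^sup>2 * q ^ j" for j m
  proof -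
    have g': "cmod (fps_nth (g - 1) i) \<le> M * cmod x * t ^ i" for i
      using g[of i] y g0 by (cases "i = 0") auto
    have "?F j m = (\<Sum>i\<le>j. fps_nth (g - 1) (j - i) * fps_nth f (i + m + 1)) + fps_nth f (j + m + 1)"
    proof -
      have "?F j m = (\<Sum>i\<le>j. fps_nth (g - 1) (j - i) * fps_nth f (i + m + 1)
          + (if i = j then fps_nth f (i + m + 1) else 0))"
        by (rule sum.cong[OF refl]) (auto simp: algebra_simps)
      then show ?thesis by (simp add: sum.distrib)
    qed
    then have eq: "?F j m - x * fps_nth Q (j + m + 1)
        = (\<Sum>i\<le>j. fps_nth (g - 1) (j - i) * fps_nth f (i + m + 1))
          + (fps_nth f (j + m + 1) - x * fps_nth Q (j + m + 1))" by simp
    have 1: "cmod (\<Sum>i\<le>j. fps_nth (g - 1) (j - i) * fps_nth f (i + m + 1))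
        \<le> (M * cmod x) * (M * cmod x) * \<kappa> * q ^ j"
      by (rule K_inner_le[OF y y f g'])
    have "cmod (fps_nth f (j + m + 1) - x * fps_nth Q (j + m + 1)) \<le> M * (cmod x)\<^sup>2 * t ^ (j + m + 1)"
      by (rule fQ) simp
    also have "\<dots> \<le> M * (cmod x)\<^sup>2 * t ^ j"
      using M t0 t1 by (intro mult_left_mono power_decreasing) auto
    also have "\<dots> \<le> M * (cmod x)\<^sup>2 * q ^ j" using M by (intro mult_left_mono t_le_q) auto
    finally have 2: "cmod (fps_nth f (j + m + 1) - x * fps_nth Q (j + m + 1)) \<le> M * (cmod x)\<^sup>2 * q ^ j" .
    show ?thesis
      unfolding eq
      by (rule order_trans[OF norm_triangle_ineq], rule order_trans[OF add_mono[OF 1 2]])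
         (simp add: algebra_simps power2_eq_square)
  qed
  have "cmod (K f g j j - x * (\<Sum>m. B j m * fps_nth Q (j + m + 1)))
      \<le> CB / (1 - t) * (M + M * M * \<kappa>) * (cmod x)\<^sup>2 * q ^ j" for j
  proof -
    have g1: "cmod (fps_nth g i) \<le> (M + 1) * t ^ i" for i
    proof (cases "i = 0")
      case False
      have "M * cmod x * t ^ i \<le> (M + 1) * t ^ i"
        using M x t0 mult_left_mono[OF x M] by (intro mult_right_mono) auto
      then show ?thesis using g[of i] False by simp
    qed (use g0 M in simp)
    have s1: "summable (\<lambda>m. B j m * ?F j m)"
      by (rule summable_B(1)[OF K_inner_le[OF y _ f g1]]) (use M in auto)
    have s2: "summable (\<lambda>m. B j m * fps_nth Q (j + m + 1))"
      by (rule summable_B(1)[OF decay_shift[OF Q]])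
    have "K f g j j - x * (\<Sum>m. B j m * fps_nth Q (j + m + 1))
        = (\<Sum>m. B j m * (?F j m - x * fps_nth Q (j + m + 1)))"
      unfolding K_def suminf_mult[OF s2, symmetric]
      by (subst suminf_diff[OF s1 summable_mult[OF s2]]) (simp add: algebra_simps)
    also have "cmod \<dots> \<le> CB / (1 - t) * ((M + M * M * \<kappa>) * (cmod x)\<^sup>2 * q ^ j) * q ^ j"
      by (rule summable_B(2)[OF F])
    also have "\<dots> \<le> (CB / (1 - t) * ((M + M * M * \<kappa>) * (cmod x)\<^sup>2 * q ^ j)) * 1"
      using CB0 t1 M kappa0 q0 q1 tq
      by (intro mult_left_mono power_le_one mult_nonneg_nonneg divide_nonneg_nonneg add_nonneg_nonneg) auto
    finally show ?thesis by (simp add: mult_ac)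
  qed
  then have "(\<Sum>j<n. cmod (K f g j j - x * (\<Sum>m. B j m * fps_nth Q (j + m + 1))))
      \<le> CB / (1 - t) * (M + M * M * \<kappa>) * (cmod x)\<^sup>2 / (1 - q)"
    using CB0 t1 M kappa0 q0 q1 tq
    by (intro sum_geometric_le mult_nonneg_nonneg divide_nonneg_nonneg add_nonneg_nonneg) auto
  then have "cmod (\<Sum>j<n. K f g j j - x * (\<Sum>m. B j m * fps_nth Q (j + m + 1)))
      \<le> CB / (1 - t) * (M + M * M * \<kappa>) * (cmod x)\<^sup>2 / (1 - q)"
    by (rule order_trans[OF norm_sum])
  then show ?thesis by (simp add: sum_subtractf sum_distrib_left)
qed

text \<open>Along an antidiagonal the product of the coefficient \<open>l\<close> of
  \<open>e\<close> and \<open>p - l + 1\<close> of \<open>b\<close> occurs \<open>p + 1 - l\<close>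
  times, which is the weight produced by differentiation. The sum is a coefficient of
  \<open>e * fps_deriv b\<close>, the logarithmic derivative of \<open>b\<close>.\<close>

lemma sum_B_antidiagonal:
  assumes P: "fps_deriv b = fps_deriv P * b"
  shows "(\<Sum>j\<le>p. B j (p - j)) = of_nat (Suc p) * fps_nth P (Suc p)"
proof -
  define h where "h l = fps_nth e l * fps_nth b (p - l + 1)" for l
  have "B j (p - j) = (\<Sum>l\<le>j. h l)" if "j \<le> p" for j
  proof -
    have "B j (p - j) = (\<Sum>i\<le>j. h (j - i))"
      unfolding B_def h_def using that by (intro sum.cong refl) (auto intro!: arg_cong[where f = "fps_nth b"])
    also have "\<dots> = (\<Sum>l\<le>j. h l)"
      using sum.nat_diff_reindex[of h "Suc j"] by (simp add: lessThan_Suc_atMost)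
    finally show ?thesis .
  qed
  then have "(\<Sum>j\<le>p. B j (p - j)) = (\<Sum>j\<le>p. \<Sum>l\<le>j. h l)" by simp
  also have "\<dots> = (\<Sum>l\<le>p. of_nat (p + 1 - l) * h l)" by (rule double_sum_triangle)
  also have "\<dots> = fps_nth (e * fps_deriv b) p"
    unfolding fps_mult_nth atLeast0AtMost
    by (rule sum.cong[OF refl]) (auto simp: h_def Suc_diff_le mult_ac)
  also have "e * fps_deriv b = fps_deriv P"
    using be by (simp add: P mult.left_commute[of e] mult.commute[of e])
  finally show ?thesis by simp
qed

text \<open>Summation by rows is replaced by summation along the antidiagonals
  \<open>p = j + m\<close>.\<close>

lemma trace_limit:
  assumes P: "fps_deriv b = fps_deriv P * b" and Q: "\<And>i. cmod (fps_nth Q i) \<le> C * t ^ i"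
  shows "(\<lambda>j. \<Sum>m. B j m * fps_nth Q (j + m + 1)) sums
    (\<Sum>p. of_nat (Suc p) * fps_nth P (Suc p) * fps_nth Q (Suc p))"
proof -
  define a where "a j p = (if j \<le> p then B j (p - j) * fps_nth Q (Suc p) else 0)" for j p
  have C: "0 \<le> C" using Q[of 0] by (auto intro: order_trans[OF norm_ge_zero])
  have a: "cmod (a j p) \<le> CB * C * q ^ j * t ^ p" for j p
  proof (cases "j \<le> p")
    case True
    have "cmod (B j (p - j)) \<le> CB * q ^ j * 1"
      using CB0 q0 t0 t1 by (intro order_trans[OF B_le] mult_left_mono power_le_one) auto
    moreover have "cmod (fps_nth Q (Suc p)) \<le> C * t ^ p"
    proof -
      have "C * t ^ Suc p \<le> C * t ^ p" using C t0 t1 by (intro mult_left_mono power_decreasing) auto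
      then show ?thesis using Q[of "Suc p"] by simp
    qed
    ultimately have "cmod (B j (p - j)) * cmod (fps_nth Q (Suc p)) \<le> (CB * q ^ j * 1) * (C * t ^ p)"
      using CB0 q0 by (intro mult_mono) auto
    then show ?thesis using True by (simp add: a_def norm_mult mult_ac)
  qed (use CB0 C q0 t0 in \<open>simp add: a_def\<close>)
  note ex = suminf_exchange_geometric[OF less_imp_le[OF q0] q1 less_imp_le[OF t0] t1 a]
  have "(\<Sum>p. a j p) = (\<Sum>m. B j m * fps_nth Q (j + m + 1))" for j
  proof -
    have "(\<Sum>p. a j p) = (\<Sum>m. a j (m + j)) + (\<Sum>p<j. a j p)"
      by (rule suminf_split_initial_segment[OF ex(1)])
    also have "(\<Sum>p<j. a j p) = 0" by (simp add: a_def)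
    finally show ?thesis by (simp add: a_def add.commute)
  qed
  moreover have "(\<Sum>j. a j p) = of_nat (Suc p) * fps_nth P (Suc p) * fps_nth Q (Suc p)" for p
  proof -
    have "(\<Sum>j. a j p) = (\<Sum>j\<le>p. a j p)" by (rule suminf_finite) (auto simp: a_def)
    also have "\<dots> = (\<Sum>j\<le>p. B j (p - j)) * fps_nth Q (Suc p)"
      unfolding sum_distrib_right by (rule sum.cong) (auto simp: a_def)
    finally show ?thesis by (simp only: sum_B_antidiagonal[OF P])
  qed
  ultimately show ?thesis using ex(4) by simp
qed

end

section \<open>Bordered Toeplitz determinants\<close>

text \<open>The triangular factors, extended by a unit row and column, keep determinant
  \<open>1\<close>. Removing them replaces the borders by the solutions \<open>u'\<close> and
  \<open>v'\<close> of triangular systems.\<close>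

lemma bordered_factorization:
  assumes b0: "fps_nth b 0 = 1" and f0: "fps_nth f 0 = 1"
    and T: "\<And>i j. i < n \<Longrightarrow> j < n \<Longrightarrow> T i j = (\<Sum>k\<le>i. fps_nth b (i - k) * (\<Sum>l\<le>j. M k l * fps_nth f (j - l)))"
    and u: "\<And>i. i < n \<Longrightarrow> u i = (\<Sum>k\<le>i. fps_nth b (i - k) * u' k)"
    and v: "\<And>j. j < n \<Longrightarrow> v j = (\<Sum>k\<le>j. v' k * fps_nth f (j - k))"
  shows "fdet (Suc n) (\<lambda>i j. if i < n \<and> j < n then T i j else if i < n then u i else if j < n then v j else a)
    = a * fdet n M - (\<Sum>i<n. \<Sum>j<n. v' i * fadj n M i j * u' j)"
proof -
  define L where "L i j = (if i < n \<and> j < n then lower b i j else if i = j then 1 else 0)" for i j :: nat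
  define U where "U i j = (if i < n \<and> j < n then upper f i j else if i = j then 1 else 0)" for i j :: nat
  define W where "W = (\<lambda>i j. if i < n \<and> j < n then M i j else if i < n then u' i else if j < n then v' j else a)"
  have dL: "fdet (Suc n) L = 1"
    by (rule fdet_lower_triangular) (auto simp: L_def lower_def b0)
  have dU: "fdet (Suc n) U = 1"
    by (rule fdet_upper_triangular) (auto simp: U_def upper_def f0)
  define WU where "WU i j = (\<Sum>l<Suc n. W i l * U l j)" for i j
  have WU1: "WU i j = (\<Sum>l\<le>j. (if i < n then M i l else v' l) * fps_nth f (j - l))" if "j < n" for i j
  proof -
    have "WU i j = (\<Sum>l<n. (if i < n then M i l else v' l) * upper f l j)"
      using that by (auto simp: WU_def W_def U_def intro!: sum.cong)
    then show ?thesis by (simp add: sum_mult_upper[OF that])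
  qed
  have WU2: "WU i n = W i n" for i
  proof -
    have "(\<Sum>l<n. W i l * U l n) = 0" by (rule sum.neutral) (auto simp: U_def)
    then show ?thesis by (simp add: WU_def U_def)
  qed
  have LA: "(\<Sum>k<Suc n. L i k * A k) = (if i < n then (\<Sum>k\<le>i. fps_nth b (i - k) * A k) else A n)"
    if "i < Suc n" for i and A :: "nat \<Rightarrow> complex"
  proof (cases "i < n")
    case True
    have "(\<Sum>k<Suc n. L i k * A k) = (\<Sum>k<n. lower b i k * A k)"
      using True by (auto simp: L_def intro!: sum.cong)
    then show ?thesis using True by (simp add: sum_lower_mult)
  next
    case False
    then have "i = n" using that by simp
    moreover have "(\<Sum>k<n. L n k * A k) = 0" by (rule sum.neutral) (auto simp: L_def)
    ultimately show ?thesis by (simp add: L_def)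
  qed
  have "fdet (Suc n) L * (fdet (Suc n) W * fdet (Suc n) U)
      = fdet (Suc n) (\<lambda>i j. \<Sum>k<Suc n. L i k * WU k j)"
    unfolding fdet_mult WU_def ..
  also have "\<dots> = fdet (Suc n) (\<lambda>i j. if i < n \<and> j < n then T i j else if i < n then u i else if j < n then v j else a)"
  proof (rule fdet_cong)
    fix i j assume i: "i < Suc n" and j: "j < Suc n"
    show "(\<Sum>k<Suc n. L i k * WU k j) = (if i < n \<and> j < n then T i j else if i < n then u i else if j < n then v j else a)"
    proof (cases "j < n")
      case True
      then show ?thesis unfolding LA[OF i]
        using i by (auto simp: WU1 T v intro!: sum.cong)
    next
      case False
      then have "j = n" using j by simp
      then show ?thesis unfolding LA[OF i]
        by (auto simp: WU2 u W_def intro!: sum.cong)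
    qed
  qed
  finally show ?thesis by (simp add: dL dU W_def fdet_bordered)
qed

lemma fadj_smult:
  assumes "i < n"
  shows "fadj n (\<lambda>i j. c * A i j) i j = c ^ (n - 1) * fadj n A i j"
  unfolding fadj_eq by (simp add: fdet_smult[of _ c "\<lambda>k l. A (skip j k) (skip i l)"])

context wiener_hopf
begin

text \<open>The right side is the Fourier coefficient of index \<open>j - k\<close> of
  \<open>b(z) f(1/z)\<close>. Its terms with \<open>m \<le> k\<close> come from the product of
  triangular arrays, those with \<open>m > k\<close> from the Hankel part through
  \<open>b_convolution_B\<close>.\<close>

lemma toeplitz_factorization:
  assumes f: "decays f"
  shows "(\<Sum>i\<le>j. fps_nth b (j - i) * X f i k)
    = (\<Sum>m. (if k \<le> j + m then fps_nth b (j + m - k) else 0) * fps_nth f m)"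
proof -
  obtain C where C0: "0 \<le> C" and C: "\<And>i. cmod (fps_nth f i) \<le> C * t ^ i" using f by (rule decaysE) blast
  let ?h = "\<lambda>m. (if k \<le> j + m then fps_nth b (j + m - k) else 0) * fps_nth f m"
  have bc: "cmod (fps_nth b i) \<le> Cb" for i by (rule decay_le_const[OF b_le])
  have h: "cmod (?h m) \<le> Cb * C * t ^ m" for m
  proof -
    have "cmod (?h m) \<le> Cb * (C * t ^ m)"
      unfolding norm_mult using Cb0 by (intro mult_mono C) (auto simp: bc)
    then show ?thesis by (simp add: mult_ac)
  qed
  have sh: "summable ?h" by (rule summable_geometric_bound(1)[OF less_imp_le[OF t0] t1 h])
  have s: "summable (\<lambda>m. B i m * fps_nth f (k + m + 1))" for i
    by (rule summable_B(1)[OF decay_shift[OF C]])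
  have "(\<Sum>i\<le>j. fps_nth b (j - i) * (\<Sum>m. B i m * fps_nth f (k + m + 1)))
      = (\<Sum>i\<le>j. \<Sum>m. fps_nth b (j - i) * (B i m * fps_nth f (k + m + 1)))"
    by (rule sum.cong[OF refl]) (rule suminf_mult[OF s, symmetric])
  also have "\<dots> = (\<Sum>m. \<Sum>i\<le>j. fps_nth b (j - i) * (B i m * fps_nth f (k + m + 1)))"
    by (rule suminf_sum[symmetric]) (rule summable_mult[OF s])
  also have "\<dots> = (\<Sum>m. fps_nth b (j + m + 1) * fps_nth f (k + m + 1))"
    by (simp only: mult.assoc[symmetric] sum_distrib_right[symmetric] b_convolution_B)
  also have "\<dots> = (\<Sum>m. ?h (m + Suc k))"
    by (simp add: add_ac)
  finally have 1: "(\<Sum>i\<le>j. fps_nth b (j - i) * (\<Sum>m. B i m * fps_nth f (k + m + 1))) = (\<Sum>m. ?h (m + Suc k))" .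
  have "(\<Sum>m<Suc k. ?h m) = (\<Sum>i<Suc k. ?h (k - i))"
    by (subst sum.nat_diff_reindex[symmetric]) (simp only: diff_Suc_Suc)
  also have "\<dots> = (\<Sum>i\<le>k. (if i \<le> j then fps_nth b (j - i) else 0) * fps_nth f (k - i))"
    unfolding lessThan_Suc_atMost by (rule sum.cong) auto
  also have "\<dots> = (\<Sum>i\<in>{..k} \<inter> {..j}. fps_nth b (j - i) * fps_nth f (k - i))"
    by (rule sum.mono_neutral_cong_right) auto
  also have "\<dots> = (\<Sum>i\<le>j. fps_nth b (j - i) * (if i \<le> k then fps_nth f (k - i) else 0))"
    by (rule sum.mono_neutral_cong_left) auto
  finally show ?thesis
    unfolding suminf_split_initial_segment[OF sh, of "Suc k"] 1[symmetric]
    by (simp add: X_def distrib_left sum.distrib)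
qed

text \<open>The borders are transformed by the inverse factors \<open>e\<close> and
  \<open>g\<close>. The division by \<open>G\<close> reflects that adjugate entries have degree
  \<open>n - 1\<close> and the determinant degree \<open>n\<close>.\<close>

lemma bordered_toeplitz:
  assumes f: "decays f" and fg: "f * g = 1" and f0: "fps_nth f 0 = 1" and G: "G \<noteq> 0" and n: "1 \<le> n"
    and T: "\<And>i j. i < n \<Longrightarrow> j < n \<Longrightarrow>
      T i j = G * (\<Sum>m. (if j \<le> i + m then fps_nth b (i + m - j) else 0) * fps_nth f m)"
  shows "fdet (Suc n) (\<lambda>i j. if i < n \<and> j < n then T i j else if i < n then u i else if j < n then v j else a)
    = G ^ n * (a * fdet n (idp (K f g)) - (\<Sum>i<n. \<Sum>j<n.
        (\<Sum>k\<le>i. v k * fps_nth g (i - k)) * fadj n (idp (K f g)) i j * (\<Sum>k\<le>j. fps_nth e (j - k) * u k)) / G)"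
proof -
  let ?M = "idp (K f g)"
  let ?v = "\<lambda>i. \<Sum>k\<le>i. v k * fps_nth g (i - k)" and ?u = "\<lambda>j. \<Sum>k\<le>j. fps_nth e (j - k) * u k"
  have "fdet (Suc n) (\<lambda>i j. if i < n \<and> j < n then T i j else if i < n then u i else if j < n then v j else a)
      = a * fdet n (\<lambda>i j. G * ?M i j) - (\<Sum>i<n. \<Sum>j<n. ?v i * fadj n (\<lambda>i j. G * ?M i j) i j * ?u j)"
  proof (rule bordered_factorization[OF b0 f0])
    fix i j
    show "T i j = (\<Sum>k\<le>i. fps_nth b (i - k) * (\<Sum>l\<le>j. G * ?M k l * fps_nth f (j - l)))" if "i < n" "j < n"
      unfolding T[OF that] toeplitz_factorization[OF f, symmetric] X_eq_convolution[OF f fg]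
      by (simp add: sum_distrib_left mult_ac)
    have "Abs_fps ?u = e * Abs_fps u" by (rule fps_ext) (simp add: convolution_fps')
    then have "b * Abs_fps ?u = Abs_fps u" using be by (simp add: mult.assoc[symmetric])
    then show "u i = (\<Sum>k\<le>i. fps_nth b (i - k) * ?u k)" by (simp only: convolution_fps' fps_nth_Abs_fps)
    have "Abs_fps ?v = Abs_fps v * g" by (rule fps_ext) (simp add: convolution_fps)
    then have "Abs_fps ?v * f = Abs_fps v" using fg by (simp add: mult.assoc mult.commute[of g])
    then show "v j = (\<Sum>k\<le>j. ?v k * fps_nth f (j - k))" by (simp only: convolution_fps fps_nth_Abs_fps)
  qed
  also have "(\<Sum>i<n. \<Sum>j<n. ?v i * fadj n (\<lambda>i j. G * ?M i j) i j * ?u j)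
      = G ^ (n - 1) * (\<Sum>i<n. \<Sum>j<n. ?v i * fadj n ?M i j * ?u j)"
    unfolding sum_distrib_left by (intro sum.cong refl) (simp add: fadj_smult[of _ n G ?M] mult_ac)
  also have "G ^ (n - 1) = G ^ n / G" using G n by (simp add: power_diff)
  finally show ?thesis by (simp add: fdet_smult[of n G ?M] algebra_simps)
qed

section \<open>The limit of the determinants of \<open>1 + K\<close>\<close>

lemma fdet_K_limit:
  assumes f: "decays f" and g: "decays g"
  obtains l where "(\<lambda>n. fdet n (idp (K f g))) \<longlonglongrightarrow> l"
proof -
  obtain C where C: "0 \<le> C" "\<And>i. cmod (fps_nth f i) \<le> C * t ^ i" using f by (rule decaysE) blast
  obtain D where D: "0 \<le> D" "\<And>i. cmod (fps_nth g i) \<le> D * t ^ i" using g by (rule decaysE) blast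
  have "0 \<le> (CB / (1 - t) * D * \<kappa>) * C"
    using CB0 t1 D C kappa0 by (intro mult_nonneg_nonneg) auto
  then show ?thesis
    by (rule fdet_idp_limit[OF q0 q1 _ K_le[OF C(1) D(1) C(2) D(2)]]) (use that in blast)
qed

text \<open>The quadratic bound gives derivative \<tau> at \<open>0\<close>; by multiplicativity the
  derivative at every \<open>x\<close> is \<open>c x * \<tau>\<close>.\<close>

lemma exp_from_small_increments:
  fixes c :: "complex \<Rightarrow> complex"
  assumes add: "\<And>x y. c (x + y) = c x * c y"
    and small: "\<And>x. cmod x \<le> 1 \<Longrightarrow> cmod (c x - 1 - x * \<tau>) \<le> D * (cmod x)\<^sup>2"
  shows "c x = exp (x * \<tau>)"
proof -
  have c0: "c 0 = 1" using small[of 0] by simp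
  have "((\<lambda>h. (c h - 1) / h) \<longlongrightarrow> \<tau>) (at 0)"
  proof (rule LIM_zero_cancel, rule Lim_null_comparison)
    show "\<forall>\<^sub>F h in at 0. cmod ((c h - 1) / h - \<tau>) \<le> D * cmod h"
      unfolding eventually_at
    proof (intro exI[of _ 1] conjI ballI impI)
      fix h :: complex assume h: "h \<noteq> 0 \<and> dist h 0 < 1"
      then have "(c h - 1) / h - \<tau> = (c h - 1 - h * \<tau>) / h" by (simp add: field_simps)
      moreover have "cmod (c h - 1 - h * \<tau>) / cmod h \<le> D * (cmod h)\<^sup>2 / cmod h"
        using h by (intro divide_right_mono small) auto
      ultimately show "cmod ((c h - 1) / h - \<tau>) \<le> D * cmod h"
        using h by (simp add: norm_divide power2_eq_square)
    qed simp
    show "((\<lambda>h. D * cmod h) \<longlongrightarrow> 0) (at 0)"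
      by (rule tendsto_mult_right_zero) (auto intro!: tendsto_norm_zero tendsto_ident_at)
  qed
  then have "((\<lambda>h. c x * ((c h - 1) / h)) \<longlongrightarrow> c x * \<tau>) (at 0)" for x
    by (rule tendsto_mult_left)
  then have dc: "(c has_field_derivative c x * \<tau>) (at x)" for x
    unfolding DERIV_def by (simp add: add right_diff_distrib)
  have "((\<lambda>x. c x * exp (- (x * \<tau>))) has_field_derivative 0) (at x)" for x
    by (rule derivative_eq_intros dc refl | simp)+
  then obtain k where k: "\<And>x. c x * exp (- (x * \<tau>)) = k"
    using has_field_derivative_zero_constant[of UNIV "\<lambda>x. c x * exp (- (x * \<tau>))"] by auto
  have "k = 1" using k[of 0] c0 by simp
  then show ?thesis using k[of x] by (simp add: exp_minus field_simps)
qed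

text \<open>The limit is multiplicative along a one-parameter group and is computed from its derivative
  at the identity, which is a trace.\<close>

lemma fdet_K_limit_exp:
  fixes F :: "complex \<Rightarrow> complex fps"
  assumes add: "\<And>x y. F (x + y) = F x * F y" and F0: "F 0 = 1"
    and dec: "\<And>x. decays (F x)" and nth0: "\<And>x. fps_nth (F x) 0 = 1"
    and M: "0 \<le> M"
    and small: "\<And>x i. cmod x \<le> 1 \<Longrightarrow> 1 \<le> i \<Longrightarrow> cmod (fps_nth (F x) i) \<le> M * cmod x * t ^ i"
    and small2: "\<And>x i. cmod x \<le> 1 \<Longrightarrow> 1 \<le> i \<Longrightarrow>
      cmod (fps_nth (F x) i - x * fps_nth Q i) \<le> M * (cmod x)\<^sup>2 * t ^ i"
    and P: "fps_deriv b = fps_deriv P * b" and Q: "\<And>i. cmod (fps_nth Q i) \<le> C * t ^ i"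
  shows "(\<lambda>n. fdet n (idp (K (F 1) (F (- 1))))) \<longlonglongrightarrow>
    exp (\<Sum>p. of_nat (Suc p) * fps_nth P (Suc p) * fps_nth Q (Suc p))"
proof -
  define \<tau> where "\<tau> = (\<Sum>p. of_nat (Suc p) * fps_nth P (Suc p) * fps_nth Q (Suc p))"
  define D where "D x n = fdet n (idp (K (F x) (F (- x))))" for x n
  have inv: "F x * F (- x) = 1" for x using add[of x "- x"] F0 by simp
  have "\<forall>x. \<exists>l. D x \<longlonglongrightarrow> l"
    unfolding D_def using fdet_K_limit[OF dec dec] by metis
  then obtain c where c: "\<And>x. D x \<longlonglongrightarrow> c x" by metis
  have c_add: "c (x + y) = c x * c y" for x y
  proof -
    have Fm: "F (- (x + y)) = F (- x) * F (- y)" using add[of "- x" "- y"] by simp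
    have "(\<lambda>n. D (x + y) n - D x n * D y n) \<longlonglongrightarrow> 0"
      unfolding D_def Fm add[of x y]
      by (rule fdet_K_mult) (auto simp: dec nth0 inv add[symmetric] F0)
    moreover have "(\<lambda>n. D (x + y) n - D x n * D y n) \<longlonglongrightarrow> c (x + y) - c x * c y"
      by (intro tendsto_intros c)
    ultimately show ?thesis using LIMSEQ_unique by fastforce
  qed
  \<comment> \<open>\<open>k * cmod x\<close> bounds the kernel at the parameter \<open>x\<close>.
    For \<open>cmod x \<le> 1\<close> it is at most \<open>k\<close>, the range in which
    \<open>D1\<close> is uniform.\<close>
  define k where "k = CB / (1 - t) * (M + 1) * \<kappa> * M"
  have k: "0 \<le> k" unfolding k_def using CB0 t1 M kappa0 by (intro mult_nonneg_nonneg) auto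
  obtain D1 where D1: "\<And>n U c. 0 \<le> c \<Longrightarrow> c \<le> k \<Longrightarrow> (\<And>i j. cmod (U i j) \<le> c * q ^ (i + j)) \<Longrightarrow>
    cmod (fdet n (idp U) - 1 - (\<Sum>j<n. U j j)) \<le> D1 * c\<^sup>2"
    using fdet_idp_trace[OF q0 q1] by blast
  define D2 where "D2 = CB / (1 - t) * (M + M * M * \<kappa>) / (1 - q)"
  define \<tau>' where "\<tau>' n = (\<Sum>j<n. \<Sum>m. B j m * fps_nth Q (j + m + 1))" for n
  have \<tau>': "\<tau>' \<longlonglongrightarrow> \<tau>" using trace_limit[OF P Q] by (simp add: sums_def \<tau>'_def[abs_def] \<tau>_def)
  have c_small: "cmod (c x - 1 - x * \<tau>) \<le> (D1 * k\<^sup>2 + D2) * (cmod x)\<^sup>2" if x: "cmod x \<le> 1" for x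
  proof -
    have g1: "cmod (fps_nth (F (- x)) i) \<le> (M + 1) * t ^ i" for i
    proof (cases "i = 0")
      case False
      have "M * cmod x * t ^ i \<le> (M + 1) * t ^ i"
        using M x t0 mult_left_mono[OF x M] by (intro mult_right_mono) auto
      then show ?thesis using small[of "- x" i] x False by simp
    qed (use nth0 M in simp)
    have KK: "cmod (K (F x) (F (- x)) i j) \<le> (k * cmod x) * q ^ (i + j)" for i j
      using K_le[of "M * cmod x" "M + 1" "F x" "F (- x)" i j] M small[OF x] g1 by (simp add: k_def mult_ac)
    have "cmod (D x n - 1 - x * \<tau>' n) \<le> (D1 * k\<^sup>2 + D2) * (cmod x)\<^sup>2" for n
    proof -
      let ?S = "\<Sum>j<n. K (F x) (F (- x)) j j"
      have "cmod (D x n - 1 - ?S) \<le> D1 * (k * cmod x)\<^sup>2"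
        unfolding D_def using k x by (intro D1 KK) (auto simp: mult_left_le)
      moreover have "cmod (?S - x * \<tau>' n) \<le> D2 * (cmod x)\<^sup>2"
        unfolding \<tau>'_def D2_def
        by (rule trace_K[OF M x small[OF x] small2[OF x] _ nth0 Q])
           (use small[of "- x"] x in auto)
      ultimately have "cmod ((D x n - 1 - ?S) + (?S - x * \<tau>' n)) \<le> D1 * (k * cmod x)\<^sup>2 + D2 * (cmod x)\<^sup>2"
        by (intro order_trans[OF norm_triangle_ineq] add_mono)
      moreover have "(D x n - 1 - ?S) + (?S - x * \<tau>' n) = D x n - 1 - x * \<tau>' n" by simp
      ultimately show ?thesis by (simp only: power_mult_distrib distrib_right mult.assoc)
    qed
    moreover have "(\<lambda>n. cmod (D x n - 1 - x * \<tau>' n)) \<longlonglongrightarrow> cmod (c x - 1 - x * \<tau>)"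
      by (intro tendsto_intros c \<tau>')
    ultimately show ?thesis by (intro LIMSEQ_le_const2[of _ "cmod (c x - 1 - x * \<tau>)"]) auto
  qed
  have "c 1 = exp (1 * \<tau>)" by (rule exp_from_small_increments[OF c_add c_small])
  then show ?thesis using c[of 1] by (simp add: \<tau>_def D_def[abs_def])
qed

end

section \<open>Logarithms and Laurent decomposition on an annulus\<close>

abbreviation annulus :: "real \<Rightarrow> complex set" where
  "annulus R \<equiv> {z. inverse R < cmod z \<and> cmod z < R}"

lemma open_annulus: "open (annulus R)"
  by (intro open_Collect_conj open_Collect_less continuous_intros)

text \<open>By compactness a neighbourhood of fixed width \<epsilon> lies in \<open>U\<close>; a
  point outside the closed annulus is compared with its radial projection to the nearer boundary
  circle.\<close>

lemma closed_annulus_subset_open: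
  fixes r :: real
  assumes "1 \<le> r" "open U" and sub: "{z. inverse r \<le> cmod z \<and> cmod z \<le> r} \<subseteq> U"
  obtains R where "r < R" "annulus R \<subseteq> U"
proof -
  let ?K = "{z. inverse r \<le> cmod z \<and> cmod z \<le> r}"
  have "closed ?K" by (intro closed_Collect_conj closed_Collect_le continuous_intros)
  moreover have "bounded ?K" by (auto simp: bounded_iff)
  ultimately have "compact ?K" by (simp add: compact_eq_bounded_closed)
  then obtain \<epsilon> where \<epsilon>: "\<epsilon> > 0" "(\<Union>x\<in>?K. cball x \<epsilon>) \<subseteq> U"
    using compact_subset_open_imp_cball_epsilon_subset[OF _ assms(2) sub] by blast
  define R where "R = r + \<epsilon>"
  have "annulus R \<subseteq> U"
  proof
    fix z assume "z \<in> annulus R"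
    then have z: "inverse R < cmod z" "cmod z < R" by auto
    have R0: "0 < R" using assms(1) \<epsilon>(1) by (simp add: R_def)
    have z0: "z \<noteq> 0" using z R0 by auto
    define w where "w c = of_real (c / cmod z) * z" for c :: real
    have w: "cmod (w c) = \<bar>c\<bar>" "dist (w c) z = \<bar>c - cmod z\<bar>" for c
    proof -
      have "cmod (w c) = \<bar>c / cmod z\<bar> * cmod z" by (simp only: w_def norm_mult norm_of_real)
      then show "cmod (w c) = \<bar>c\<bar>" using z0 by simp
      have "w c - z = of_real ((c - cmod z) / cmod z) * z"
        using z0 by (simp add: w_def field_simps)
      then have "cmod (w c - z) = \<bar>(c - cmod z) / cmod z\<bar> * cmod z"
        by (simp only: norm_mult norm_of_real)
      then show "dist (w c) z = \<bar>c - cmod z\<bar>" using z0 by (simp add: dist_norm)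
    qed
    have rr: "inverse r \<le> r" using assms(1) by (simp add: inverse_le_1_iff order_trans[of _ 1])
    consider "z \<in> ?K" | "r < cmod z" | "cmod z < inverse r" by fastforce
    then show "z \<in> U"
    proof cases
      case 1 then show ?thesis using sub by blast
    next
      case 2
      then have "w r \<in> ?K" "z \<in> cball (w r) \<epsilon>" using w[of r] z rr assms(1) by (auto simp: R_def)
      then show ?thesis using \<epsilon>(2) by blast
    next
      case 3
      \<comment> \<open>The inner gap is at most the outer one because \<open>1 \<le> r * R\<close>,
        so the same \<open>R\<close> serves both sides.\<close>
      have "inverse r - inverse R = (R - r) / (r * R)" using assms(1) R0 by (simp add: field_simps)
      also have "\<dots> \<le> (R - r) / 1"
        using assms(1) \<epsilon>(1) mult_mono[of 1 r 1 R] by (intro divide_left_mono) (auto simp: R_def)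
      finally have "inverse r - inverse R \<le> \<epsilon>" by (simp add: R_def)
      then have "w (inverse r) \<in> ?K" "z \<in> cball (w (inverse r)) \<epsilon>"
        using w[of "inverse r"] z 3 rr assms(1) by (auto simp: abs_if)
      then show ?thesis using \<epsilon>(2) by blast
    qed
  qed
  then show ?thesis using that[of R] \<epsilon>(1) by (simp add: R_def)
qed

text \<open>Pulled back by \<open>exp\<close> to a vertical strip, which is convex, the function has
  a logarithm. Winding number zero makes that logarithm periodic, so it descends to the annulus;
  across the cut of \<open>Ln\<close> a second formula with \<open>Ln (- z)\<close> is used.\<close>

lemma holomorphic_log_annulus:
  fixes R :: real
  assumes R: "1 < R" and F: "F holomorphic_on annulus R" "\<And>z. z \<in> annulus R \<Longrightarrow> F z \<noteq> 0"
    and wind: "winding_number (F \<circ> circlepath 0 1) 0 = 0"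
  obtains L where "L holomorphic_on annulus R" "\<And>z. z \<in> annulus R \<Longrightarrow> exp (L z) = F z"
proof -
  define S where "S = {w. - ln R < Re w \<and> Re w < ln R}"
  have S: "open S" "convex S"
  proof -
    show "open S" unfolding S_def by (intro open_Collect_conj open_Collect_less continuous_intros)
    have "S = {w. Re w > - ln R} \<inter> {w. Re w < ln R}" by (auto simp: S_def)
    then show "convex S" by (simp add: convex_Int convex_halfspace_Re_gt convex_halfspace_Re_lt)
  qed
  have exp_S: "exp w \<in> annulus R \<longleftrightarrow> w \<in> S" for w
  proof -
    have "inverse R = exp (- ln R)" "R = exp (ln R)" using R by (simp_all add: exp_minus)
    then show ?thesis unfolding S_def mem_Collect_eq norm_exp_eq_Re by (metis exp_less_cancel_iff)
  qed
  have imS: "\<i> * of_real x \<in> S" for x using R by (simp add: S_def)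
  have g: "(\<lambda>w. F (exp w)) holomorphic_on S"
  proof -
    have "exp ` S \<subseteq> annulus R" using exp_S by blast
    then show ?thesis using holomorphic_on_compose_gen[OF holomorphic_on_exp F(1), of S] by (simp add: o_def)
  qed
  obtain \<Lambda> where \<Lambda>: "\<Lambda> holomorphic_on S" "\<And>w. w \<in> S \<Longrightarrow> exp (\<Lambda> w) = F (exp w)"
    using holomorphic_logarithm_exists[OF S(2,1) g, of 0] F(2) exp_S imS[of 0] by auto
  define p where "p t = \<Lambda> (\<i> * of_real (2 * pi * t))" for t
  have "path p"
    unfolding path_def p_def
    by (rule continuous_on_compose2[OF holomorphic_on_imp_continuous_on[OF \<Lambda>(1)]])
       (auto intro!: continuous_intros imS simp del: of_real_mult)
  moreover have "exp \<circ> p = F \<circ> circlepath 0 1"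
  proof
    fix t
    have "exp (p t) = F (exp (\<i> * of_real (2 * pi * t)))" unfolding p_def by (rule \<Lambda>(2)[OF imS])
    then show "(exp \<circ> p) t = (F \<circ> circlepath 0 1) t" by (simp add: circlepath mult_ac)
  qed
  ultimately have "p 1 = p 0"
    using winding_number_compose_exp[of p] wind by (simp add: pathfinish_def pathstart_def)
  then have per0: "\<Lambda> (0 + 2 * pi * \<i>) = \<Lambda> 0" by (simp add: p_def mult_ac)
  have shift: "w + 2 * pi * \<i> \<in> S \<longleftrightarrow> w \<in> S" for w by (simp add: S_def)
  \<comment> \<open>The difference to the translate has exponential \<open>1\<close>, hence zero
    derivative, and is constant; its value is known from \<open>per0\<close>.\<close>
  have per: "\<Lambda> (w + 2 * pi * \<i>) = \<Lambda> w" if w: "w \<in> S" for w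
  proof -
    let ?h = "\<lambda>w. \<Lambda> (w + 2 * pi * \<i>) - \<Lambda> w"
    have "(?h has_field_derivative 0) (at w within S)" if w: "w \<in> S" for w
    proof -
      have "(\<lambda>w. \<Lambda> (w + 2 * pi * \<i>)) holomorphic_on S"
        by (rule holomorphic_on_compose_gen[OF _ \<Lambda>(1), of "\<lambda>w. w + 2 * pi * \<i>", unfolded o_def])
           (use shift in \<open>auto intro!: holomorphic_intros simp del: of_real_mult\<close>)
      then have "?h holomorphic_on S" using \<Lambda>(1) by (rule holomorphic_on_diff)
      then obtain D where D: "(?h has_field_derivative D) (at w)"
        using w S(1) by (auto simp: holomorphic_on_open)
      have e1: "exp (?h w) = 1" if "w \<in> S" for w
        using \<Lambda>(2)[OF that] \<Lambda>(2)[of "w + 2 * pi * \<i>"] F(2)[of "exp w"] that exp_S[of w] shift[of w]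
        by (simp add: exp_diff exp_add)
      have "((\<lambda>w. exp (?h w)) has_field_derivative 0) (at w)"
      proof (rule has_field_derivative_transform_within_open[where f = "\<lambda>_. 1"])
        show "1 = exp (?h x)" if "x \<in> S" for x using e1[OF that] by (rule sym)
      qed (use w S(1) in auto)
      with DERIV_fun_exp[OF D] have "exp (?h w) * D = 0" by (rule DERIV_unique)
      then have "D = 0" by simp
      then show ?thesis using has_field_derivative_at_within[OF D] by simp
    qed
    then obtain k where k: "\<And>w. w \<in> S \<Longrightarrow> ?h w = k"
      using has_field_derivative_zero_constant[OF S(2), of ?h] by blast
    have "0 \<in> S" using imS[of 0] by simp
    from k[OF this] per0 have "k = 0" by simp
    then show ?thesis using k[OF w] by simp
  qed
  define L where "L z = \<Lambda> (Ln z)" for z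
  have LnS: "Ln z \<in> S" if "z \<in> annulus R" for z
  proof -
    have "z \<noteq> 0" using that R by auto
    then show ?thesis using exp_S[of "Ln z"] that by simp
  qed
  have L2: "L z = \<Lambda> (Ln (- z) + pi * \<i>)" if z: "z \<in> annulus R" for z
  proof -
    have "z \<noteq> 0" using z R by auto
    then have "Ln (- z) + pi * \<i> = Ln z + 2 * pi * \<i> \<or> Ln (- z) + pi * \<i> = Ln z"
      by (auto simp: Ln_minus algebra_simps)
    then show ?thesis
      using per[OF LnS[OF z]] unfolding L_def by (elim disjE) (simp_all only:)
  qed
  have "L holomorphic_on annulus R - \<real>\<^sub>\<le>\<^sub>0"
    unfolding L_def[abs_def]
    by (rule holomorphic_on_compose_gen[OF _ \<Lambda>(1), unfolded o_def])
       (use LnS in \<open>auto intro!: holomorphic_on_Ln\<close>)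
  moreover have "L holomorphic_on annulus R - \<real>\<^sub>\<ge>\<^sub>0"
  proof (rule holomorphic_transform)
    show "(\<lambda>z. \<Lambda> (Ln (- z) + pi * \<i>)) holomorphic_on annulus R - \<real>\<^sub>\<ge>\<^sub>0"
    proof (rule holomorphic_on_compose_gen[OF _ \<Lambda>(1), of "\<lambda>z. Ln (- z) + pi * \<i>", unfolded o_def])
      show "(\<lambda>z. Ln (- z) + pi * \<i>) holomorphic_on annulus R - \<real>\<^sub>\<ge>\<^sub>0"
        by (intro holomorphic_intros) auto
      have "Ln (- z) + pi * \<i> \<in> S" if "z \<in> annulus R" for z
        using LnS[of "- z"] that by (simp add: S_def)
      then show "(\<lambda>z. Ln (- z) + pi * \<i>) ` (annulus R - \<real>\<^sub>\<ge>\<^sub>0) \<subseteq> S" by auto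
    qed
  qed (use L2 in auto)
  moreover have "open (annulus R - \<real>\<^sub>\<le>\<^sub>0)" "open (annulus R - \<real>\<^sub>\<ge>\<^sub>0)"
    by (intro open_Diff open_annulus closed_nonpos_Reals_complex closed_nonneg_Reals_complex)+
  ultimately have "L holomorphic_on (annulus R - \<real>\<^sub>\<le>\<^sub>0) \<union> (annulus R - \<real>\<^sub>\<ge>\<^sub>0)"
    by (intro holomorphic_on_Un)
  moreover have "annulus R \<subseteq> (annulus R - \<real>\<^sub>\<le>\<^sub>0) \<union> (annulus R - \<real>\<^sub>\<ge>\<^sub>0)"
  proof
    fix z assume z: "z \<in> annulus R"
    have "z \<noteq> 0" using z R by auto
    then have "z \<notin> \<real>\<^sub>\<le>\<^sub>0 \<or> z \<notin> \<real>\<^sub>\<ge>\<^sub>0"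
      by (auto simp: complex_nonpos_Reals_iff complex_nonneg_Reals_iff complex_eq_iff)
    then show "z \<in> (annulus R - \<real>\<^sub>\<le>\<^sub>0) \<union> (annulus R - \<real>\<^sub>\<ge>\<^sub>0)" using z by blast
  qed
  ultimately have "L holomorphic_on annulus R" by (rule holomorphic_on_subset)
  moreover have "exp (L z) = F z" if z: "z \<in> annulus R" for z
  proof -
    have "z \<noteq> 0" using z R by auto
    then show ?thesis using \<Lambda>(2)[OF LnS[OF z]] by (simp add: L_def)
  qed
  ultimately show ?thesis using that by blast
qed

text \<open>The difference has values in integer multiples of \<open>2 * pi * \<i>\<close>, a
  discrete set, and the circle is connected.\<close>

lemma continuous_logs_differ_by_constant:
  assumes "continuous_on (sphere 0 1) L" "continuous_on (sphere 0 1) L'"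
    and "\<And>z::complex. z \<in> sphere 0 1 \<Longrightarrow> exp (L z) = exp (L' z :: complex)"
  obtains k where "\<And>z. z \<in> sphere 0 1 \<Longrightarrow> L z = L' z + k"
proof -
  let ?d = "\<lambda>z. L z - L' z"
  have d: "exp (?d z) = 1" if "z \<in> sphere 0 1" for z using assms(3)[OF that] by (simp add: exp_diff)
  have "?d constant_on sphere 0 1"
  proof (rule continuous_discrete_range_constant)
    show "connected (sphere 0 1 :: complex set)" by (rule connected_sphere) simp
    show "continuous_on (sphere 0 1) ?d" by (intro continuous_intros assms)
    fix x :: complex assume x: "x \<in> sphere 0 1"
    have "1 \<le> cmod (?d y - ?d x)" if "y \<in> sphere 0 1" "?d y \<noteq> ?d x" for y
    proof -
      have "exp (?d y - ?d x) = 1" using d x that by (simp add: exp_diff[of "?d y" "?d x"])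
      then obtain n :: int where n: "Re (?d y - ?d x) = 0" "Im (?d y - ?d x) = of_int (2 * n) * pi"
        unfolding exp_eq_1 by blast
      have "n \<noteq> 0"
      proof
        assume "n = 0"
        with n have "?d y - ?d x = 0" by (simp add: complex_eq_iff)
        with that show False by simp
      qed
      then have "1 \<le> \<bar>real_of_int n\<bar>" by linarith
      then have "1 * 1 \<le> \<bar>real_of_int n\<bar> * (2 * pi)" using pi_gt3 by (intro mult_mono) auto
      also have "\<dots> = \<bar>Im (?d y - ?d x)\<bar>" unfolding n(2) by (simp add: abs_mult)
      also have "\<dots> \<le> cmod (?d y - ?d x)" by (rule abs_Im_le_cmod)
      finally show ?thesis by simp
    qed
    then show "\<exists>e>0. \<forall>y. y \<in> sphere 0 1 \<and> ?d y \<noteq> ?d x \<longrightarrow> e \<le> cmod (?d y - ?d x)"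
      by (intro exI[of _ 1]) auto
  qed
  then obtain k where "\<And>z. z \<in> sphere 0 1 \<Longrightarrow> ?d z = k" by (auto simp: constant_on_def)
  then show ?thesis using that[of k] by (metis add.commute diff_add_cancel)
qed

section \<open>Laurent splitting by Cauchy integrals\<close>

lemma Cauchy_type_integral_holomorphic:
  assumes "0 < r" "continuous_on (sphere 0 r) f" "open S" "S \<inter> sphere 0 r = {}"
  shows "(\<lambda>z. contour_integral (circlepath 0 r) (\<lambda>w. f w / (w - z))) holomorphic_on S"
  unfolding holomorphic_on_open[OF assms(3)]
proof safe
  fix z assume z: "z \<in> S"
  have r: "0 \<le> r" using assms(1) by simp
  have "((\<lambda>z. contour_integral (circlepath 0 r) (\<lambda>w. f w / (w - z))) has_field_derivative
      of_nat 1 * contour_integral (circlepath 0 r) (\<lambda>w. f w / (w - z) ^ Suc 1)) (at z)"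
  proof (rule Cauchy_next_derivative(2)[where S = S and k = 1 and B = "2 * pi * r"])
    show "continuous_on (path_image (circlepath 0 r)) f" using assms r by simp
    show "((\<lambda>w'. f w' / (w' - w) ^ 1) has_contour_integral
        contour_integral (circlepath 0 r) (\<lambda>w'. f w' / (w' - w))) (circlepath 0 r)"
      if "w \<in> S - path_image (circlepath 0 r)" for w
      unfolding power_one_right
      using that assms r
      by (intro has_contour_integral_integral contour_integrable_continuous_circlepath)
         (auto intro!: continuous_intros)
  qed (use z assms r in \<open>auto simp: vector_derivative_circlepath norm_mult\<close>)
  then show "\<exists>f'. ((\<lambda>z. contour_integral (circlepath 0 r) (\<lambda>w. f w / (w - z))) has_field_derivative f') (at z)"
    by blast
qed

text \<open>The two parts are Cauchy integrals over the circles of radius \<open>s\<close> and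
  \<open>1/s\<close>. Written in \<open>u = 1/z\<close>, the inner one has a removable singularity
  at \<open>u = 0\<close> with value \<open>0\<close>, which normalizes \<open>Q\<close>.\<close>

lemma Laurent_decomposition:
  fixes R s :: real
  assumes s: "1 < s" "s < R" and L: "L holomorphic_on annulus R"
  obtains P Q where "P holomorphic_on ball 0 s" "Q holomorphic_on ball 0 s" "Q 0 = 0"
    "\<And>z. z \<in> sphere 0 1 \<Longrightarrow> L z = P z + Q (inverse z)"
proof -
  define s' where "s' = inverse s"
  have s': "0 < s'" "s' < 1" using s by (auto simp: s'_def inverse_less_1_iff)
  have circ: "sphere 0 s \<subseteq> annulus R" "sphere 0 s' \<subseteq> annulus R"
    using s s' by (auto simp: s'_def less_imp_inverse_less order.strict_trans[of _ 1] inverse_less_1_iff)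
  note cont = continuous_on_subset[OF holomorphic_on_imp_continuous_on[OF L]]
  define c where "c = 2 * of_real pi * \<i>"
  have c0: "c \<noteq> 0" by (simp add: c_def)
  define I where "I r z = contour_integral (circlepath 0 r) (\<lambda>w. L w / (w - z))" for r z
  define P where "P z = I s z / c" for z
  define N where "N u = - I s' (inverse u) / c" for u
  have holP: "P holomorphic_on ball 0 s"
    unfolding P_def I_def using s circ
    by (intro holomorphic_on_divide holomorphic_on_const Cauchy_type_integral_holomorphic cont) (auto simp: c0)
  have holI: "I s' holomorphic_on {z. s' < cmod z}"
    unfolding I_def using s' circ
    by (intro Cauchy_type_integral_holomorphic cont open_Collect_less continuous_intros) auto
  have inv: "s' < cmod (inverse u)" if "u \<noteq> 0" "cmod u < s" for u
    using that s unfolding s'_def norm_inverse by (intro less_imp_inverse_less) auto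
  have holN: "N holomorphic_on ball 0 s - {0}"
    unfolding N_def
    by (intro holomorphic_intros holomorphic_on_compose_gen[OF _ holI, of inverse, unfolded o_def])
       (auto simp: c0 inv)
  have "compact (L ` sphere 0 s')" by (intro compact_continuous_image cont circ compact_sphere)
  then obtain M where M: "\<And>w. w \<in> sphere 0 s' \<Longrightarrow> cmod (L w) \<le> M" "0 \<le> M"
    by (metis (no_types, lifting) bounded_pos compact_imp_bounded image_eqI less_imp_le)
  \<comment> \<open>In this range \<open>inverse u\<close> stays at distance at least
    \<open>1 / (2 * cmod u)\<close> from the inner circle, so the Cauchy integral is
    \<open>O(u)\<close>.\<close>
  have N_le: "cmod (N u) \<le> (M * (2 * pi * s') * 2 / cmod c) * cmod u" if u: "u \<noteq> 0" "cmod u < s / 2" for u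
  proof -
    have us: "s' * (2 * cmod u) \<le> 1" using u s by (simp add: s'_def field_simps)
    then have us': "s' \<le> 1 / (2 * cmod u)" using u by (simp add: field_simps)
    have lower: "1 / (2 * cmod u) \<le> cmod (w - inverse u)" if "cmod w = s'" for w
    proof -
      have "cmod (inverse u) - cmod w \<le> cmod (w - inverse u)" by (metis norm_minus_commute norm_triangle_ineq2)
      moreover have "cmod (inverse u) = 1 / (2 * cmod u) + 1 / (2 * cmod u)"
        unfolding norm_inverse using u by (simp add: field_simps)
      ultimately show ?thesis using us' that by simp
    qed
    have "cmod (L w / (w - inverse u)) \<le> M * (2 * cmod u)" if w: "cmod w = s'" for w
    proof -
      have pos: "0 < 1 / (2 * cmod u)" using u by simp
      have "cmod (L w) / cmod (w - inverse u) \<le> M / (1 / (2 * cmod u))"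
        using M w lower[OF w] pos by (intro frac_le) auto
      then show ?thesis by (simp add: norm_divide)
    qed
    moreover have "((\<lambda>w. L w / (w - inverse u)) has_contour_integral I s' (inverse u)) (circlepath 0 s')"
      unfolding I_def using s' circ inv[of u] u s
      by (intro has_contour_integral_integral contour_integrable_continuous_circlepath continuous_intros cont) auto
    ultimately have "cmod (I s' (inverse u)) \<le> M * (2 * cmod u) * (2 * pi * s')"
      using M s' by (intro has_contour_integral_bound_circlepath) auto
    then have "cmod (I s' (inverse u)) / cmod c \<le> M * (2 * cmod u) * (2 * pi * s') / cmod c"
      by (rule divide_right_mono) simp
    then show ?thesis by (simp add: N_def norm_divide mult_ac)
  qed
  have "N \<midarrow>0\<rightarrow> 0"
  proof (rule Lim_null_comparison)
    show "\<forall>\<^sub>F u in at 0. cmod (N u) \<le> (M * (2 * pi * s') * 2 / cmod c) * cmod u"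
      unfolding eventually_at using N_le s by (intro exI[of _ "s / 2"]) auto
    show "((\<lambda>u. (M * (2 * pi * s') * 2 / cmod c) * cmod u) \<longlongrightarrow> 0) (at 0)"
      by (rule tendsto_mult_right_zero) (auto intro!: tendsto_norm_zero tendsto_ident_at)
  qed
  from removable_singularity[OF holN open_ball this]
  have holQ: "(\<lambda>u. if u = 0 then 0 else N u) holomorphic_on ball 0 s" .
  have "L z = P z + (if inverse z = 0 then 0 else N (inverse z))" if z: "z \<in> sphere 0 1" for z
  proof -
    have z1: "cmod z = 1" using z by simp
    \<comment> \<open>The completed difference quotient is holomorphic in the whole annulus, so its
      integrals over the two homotopic circles agree. Splitting off \<open>L z\<close> turns this
      into Cauchy's formula for the annulus.\<close>
    define g where "g w = (if w = z then deriv L z else (L w - L z) / (w - z))" for w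
    have holg: "g holomorphic_on annulus R"
      unfolding g_def[abs_def] by (rule pole_lemma_open[OF L open_annulus])
    have "homotopic_loops (annulus R) (circlepath 0 s) (circlepath 0 s')"
    proof (rule homotopic_loops_linear)
      fix t :: real
      define v where "v = exp (2 * of_real pi * \<i> * of_real t)"
      have v: "cmod v = 1" by (simp add: v_def)
      show "closed_segment (circlepath 0 s t) (circlepath 0 s' t) \<subseteq> annulus R"
      proof
        fix x assume "x \<in> closed_segment (circlepath 0 s t) (circlepath 0 s' t)"
        then obtain u where u: "0 \<le> u" "u \<le> 1" "x = (1 - u) *\<^sub>R (of_real s * v) + u *\<^sub>R (of_real s' * v)"
          unfolding closed_segment_def circlepath by (auto simp: v_def)
        define y where "y = (1 - u) * s + u * s'"
        have "x = of_real y * v" using u(3) by (simp add: y_def scaleR_conv_of_real algebra_simps)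
        moreover have "s' \<le> y" "y \<le> s"
        proof -
          have le: "s' \<le> s" using s s' by simp
          have "u * s' \<le> u * s" "(1 - u) * s' \<le> (1 - u) * s" using le u by (auto intro!: mult_left_mono)
          then show "s' \<le> y" "y \<le> s" by (auto simp: y_def algebra_simps)
        qed
        ultimately have "s' \<le> cmod x" "cmod x \<le> s" using v s' by (auto simp: norm_mult)
        moreover have "inverse R < s'" using s by (simp add: s'_def less_imp_inverse_less)
        ultimately show "x \<in> annulus R" using s by auto
      qed
    qed auto
    from Cauchy_theorem_homotopic_loops[OF this open_annulus holg]
    have eq: "contour_integral (circlepath 0 s) g = contour_integral (circlepath 0 s') g" by simp
    have split: "contour_integral (circlepath 0 r) g
        = I r z - L z * contour_integral (circlepath 0 r) (\<lambda>w. 1 / (w - z))"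
      if r: "0 < r" "r \<noteq> 1" "sphere 0 r \<subseteq> annulus R" for r
    proof -
      have ne: "w \<noteq> z" if "cmod w = r" for w using that z1 r by auto
      have i1: "(\<lambda>w. L w / (w - z)) contour_integrable_on circlepath 0 r"
        using r ne by (intro contour_integrable_continuous_circlepath continuous_intros cont) auto
      have i2: "(\<lambda>w. 1 / (w - z)) contour_integrable_on circlepath 0 r"
        using r ne by (intro contour_integrable_continuous_circlepath continuous_intros) auto
      have "contour_integral (circlepath 0 r) g
          = contour_integral (circlepath 0 r) (\<lambda>w. L w / (w - z) - L z * (1 / (w - z)))"
        using r ne by (intro contour_integral_eq) (auto simp: g_def diff_divide_distrib)
      also have "\<dots> = I r z - contour_integral (circlepath 0 r) (\<lambda>w. L z * (1 / (w - z)))"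
        unfolding I_def by (rule contour_integral_diff[OF i1 contour_integrable_lmul[OF i2]])
      also have "contour_integral (circlepath 0 r) (\<lambda>w. L z * (1 / (w - z)))
          = L z * contour_integral (circlepath 0 r) (\<lambda>w. 1 / (w - z))"
        by (rule contour_integral_lmul[OF i2])
      finally show ?thesis .
    qed
    have "((\<lambda>w. 1 / (w - z)) has_contour_integral (2 * of_real pi * \<i> * 1)) (circlepath 0 s)"
      by (rule Cauchy_integral_circlepath_simple) (use z1 s in auto)
    then have o: "contour_integral (circlepath 0 s) (\<lambda>w. 1 / (w - z)) = c"
      by (simp add: contour_integral_unique c_def)
    have "((\<lambda>w. 1 / (w - z)) has_contour_integral 0) (circlepath 0 s')"
      by (rule Cauchy_theorem_disc_simple[of _ 0 1]) (use z1 s' in \<open>auto intro!: holomorphic_intros\<close>)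
    then have i: "contour_integral (circlepath 0 s') (\<lambda>w. 1 / (w - z)) = 0"
      by (simp add: contour_integral_unique)
    have "I s z - L z * c = I s' z"
      using eq split[of s] split[of s'] s s' circ o i by simp
    then have "L z * c = I s z - I s' z" by (simp add: algebra_simps)
    then have "L z = (I s z - I s' z) / c" using c0 by (simp add: field_simps)
    then show ?thesis using z1 by (auto simp: P_def N_def diff_divide_distrib)
  qed
  then show ?thesis by (intro that[OF holP holQ]) auto
qed

section \<open>Fourier coefficients on the unit circle\<close>

definition fourier_integrand :: "(complex \<Rightarrow> complex) \<Rightarrow> int \<Rightarrow> complex \<Rightarrow> complex" where
  "fourier_integrand f j \<zeta> = f \<zeta> * \<zeta> powi (- j) / (2 * of_real pi * \<i> * \<zeta>)"

lemma fourier_coeff_integrand: "fourier_coeff f j = contour_integral (circlepath 0 1) (fourier_integrand f j)"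
  by (simp add: fourier_coeff_def fourier_integrand_def[abs_def])

lemma fourier_integrand_integrable:
  assumes "continuous_on (sphere 0 1) f"
  shows "fourier_integrand f j contour_integrable_on circlepath 0 1"
  unfolding fourier_integrand_def[abs_def] using assms
  by (intro contour_integrable_continuous_circlepath) (auto intro!: continuous_intros)

lemma fourier_coeff_cong:
  assumes "\<And>z. z \<in> sphere 0 1 \<Longrightarrow> f z = g z"
  shows "fourier_coeff f j = fourier_coeff g j"
  unfolding fourier_coeff_def using assms by (intro contour_integral_eq) auto

lemma fourier_coeff_sum:
  assumes "finite I" "\<And>i. i \<in> I \<Longrightarrow> continuous_on (sphere 0 1) (f i)"
  shows "fourier_coeff (\<lambda>z. \<Sum>i\<in>I. a i * f i z) j = (\<Sum>i\<in>I. a i * fourier_coeff (f i) j)"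
proof -
  have "fourier_coeff (\<lambda>z. \<Sum>i\<in>I. a i * f i z) j
      = contour_integral (circlepath 0 1) (\<lambda>z. \<Sum>i\<in>I. a i * fourier_integrand (f i) j z)"
    by (simp add: fourier_coeff_def fourier_integrand_def sum_distrib_right sum_divide_distrib mult.assoc)
  also have "\<dots> = (\<Sum>i\<in>I. contour_integral (circlepath 0 1) (\<lambda>z. a i * fourier_integrand (f i) j z))"
    using assms by (intro contour_integral_sum contour_integrable_lmul fourier_integrand_integrable)
  also have "\<dots> = (\<Sum>i\<in>I. a i * fourier_coeff (f i) j)"
    using assms by (intro sum.cong refl)
      (simp add: contour_integral_lmul fourier_integrand_integrable fourier_coeff_integrand)
  finally show ?thesis .
qed

lemma fourier_coeff_add:
  assumes "continuous_on (sphere 0 1) f" "continuous_on (sphere 0 1) g"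
  shows "fourier_coeff (\<lambda>z. f z + g z) j = fourier_coeff f j + fourier_coeff g j"
  using fourier_coeff_sum[of "UNIV :: bool set" "\<lambda>b. if b then f else g" "\<lambda>_. 1" j] assms
  by (simp add: UNIV_bool add.commute)

lemma fourier_coeff_cmult:
  assumes "continuous_on (sphere 0 1) f"
  shows "fourier_coeff (\<lambda>z. c * f z) j = c * fourier_coeff f j"
  using fourier_coeff_sum[of "{()}" "\<lambda>_. f" "\<lambda>_. c" j] assms by simp

text \<open>The geometric majorant gives uniform convergence on the circle and hence termwise
  integration; a factor \<open>inverse z ^ n\<close> shifts the index by \<open>n\<close>.\<close>

lemma fourier_coeff_mult_negative_series:
  fixes t :: real
  assumes t: "0 \<le> t" "t < 1" and f: "\<And>n. cmod (f n) \<le> C * t ^ n"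
    and h: "continuous_on (sphere 0 1) h"
    and H: "\<And>z. z \<in> sphere 0 1 \<Longrightarrow> (\<lambda>n. f n * inverse z ^ n) sums H z"
  shows "(\<lambda>n. f n * fourier_coeff h (j + int n)) sums fourier_coeff (\<lambda>z. h z * H z) j"
proof -
  have "compact (h ` sphere 0 1)" by (intro compact_continuous_image h compact_sphere)
  then obtain M where M: "\<And>z. z \<in> sphere 0 1 \<Longrightarrow> cmod (h z) \<le> M" "0 \<le> M"
    by (metis (no_types, lifting) bounded_pos compact_imp_bounded image_eqI less_imp_le)
  define a where "a n z = f n * fourier_integrand h (j + int n) z" for n z
  have C: "0 \<le> C" using f[of 0] by (simp add: order_trans[OF norm_ge_zero])
  have a_le: "cmod (a n z) \<le> C * M / (2 * pi) * t ^ n" if z: "z \<in> sphere 0 1" for n z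
  proof -
    have "cmod (a n z) = cmod (f n) * (cmod (h z) / (2 * pi))"
      using z by (simp add: a_def fourier_integrand_def norm_mult norm_divide norm_power_int)
    also have "\<dots> \<le> (C * t ^ n) * (M / (2 * pi))"
      using f M(1)[OF z] C t by (intro mult_mono divide_right_mono) auto
    finally show ?thesis by (simp add: mult_ac)
  qed
  have a_sums: "(\<lambda>n. a n z) sums fourier_integrand (\<lambda>z. h z * H z) j z" if z: "z \<in> sphere 0 1" for z
  proof -
    have z0: "z \<noteq> 0" using z by auto
    have "a n z = fourier_integrand h j z * (f n * inverse z ^ n)" for n
    proof -
      have "- j - int n = - (j + int n)" by simp
      then have "z powi (- (j + int n)) = z powi (- j) * z powi (- int n)"
        using z0 power_int_add[of z "- j" "- int n"] by simp
      also have "z powi (- int n) = inverse z ^ n" by (simp add: power_int_minus power_inverse)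
      finally show ?thesis by (simp add: a_def fourier_integrand_def)
    qed
    moreover have "fourier_integrand (\<lambda>z. h z * H z) j z = fourier_integrand h j z * H z"
      by (simp add: fourier_integrand_def)
    ultimately show ?thesis using sums_mult[OF H[OF z]] by simp
  qed
  have int: "a n contour_integrable_on circlepath 0 1" for n
    unfolding a_def by (intro contour_integrable_lmul fourier_integrand_integrable h)
  have "uniform_limit (sphere 0 1) (\<lambda>N z. \<Sum>n<N. a n z) (\<lambda>z. \<Sum>n. a n z) sequentially"
    using t by (intro Weierstrass_m_test[OF a_le]) (auto intro!: summable_mult summable_geometric)
  then have "(\<lambda>N. contour_integral (circlepath 0 1) (\<lambda>z. \<Sum>n<N. a n z)) \<longlonglongrightarrow>
      contour_integral (circlepath 0 1) (\<lambda>z. \<Sum>n. a n z)"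
    by (intro contour_integral_uniform_limit_circlepath(2) always_eventually allI contour_integrable_sum int) auto
  moreover have "contour_integral (circlepath 0 1) (\<lambda>z. \<Sum>n<N. a n z) = (\<Sum>n<N. f n * fourier_coeff h (j + int n))" for N
  proof -
    have "contour_integral (circlepath 0 1) (a n) = f n * fourier_coeff h (j + int n)" for n
      unfolding a_def[abs_def] fourier_coeff_integrand
      by (rule contour_integral_lmul) (rule fourier_integrand_integrable[OF h])
    then show ?thesis using contour_integral_sum[of "{..<N}" a, OF _ int] by simp
  qed
  moreover have "contour_integral (circlepath 0 1) (\<lambda>z. \<Sum>n. a n z) = fourier_coeff (\<lambda>z. h z * H z) j"
    unfolding fourier_coeff_integrand
    by (rule contour_integral_eq) (use a_sums in \<open>auto simp: sums_iff\<close>)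
  ultimately show ?thesis by (simp add: sums_def)
qed

lemma fourier_coeff_holomorphic:
  assumes "1 < s" and h: "h holomorphic_on ball 0 s"
  shows "fourier_coeff h j = (if 0 \<le> j then fps_nth (fps_expansion h 0) (nat j) else 0)"
proof (cases "0 \<le> j")
  case True
  have sub: "cball 0 1 \<subseteq> ball (0::complex) s" using assms(1) by auto
  have hc: "h holomorphic_on cball 0 1" "h holomorphic_on ball 0 1"
    by (rule holomorphic_on_subset[OF h]; use sub ball_subset_cball in blast)+
  let ?n = "nat j"
  have "((\<lambda>u. h u / (u - 0) ^ Suc ?n) has_contour_integral (2 * pi * \<i> / fact ?n * (deriv ^^ ?n) h 0)) (circlepath 0 1)"
    by (rule Cauchy_has_contour_integral_higher_derivative_circlepath[OF holomorphic_on_imp_continuous_on[OF hc(1)] hc(2)]) simp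
  then have "((\<lambda>u. 1 / (2 * of_real pi * \<i>) * (h u / (u - 0) ^ Suc ?n)) has_contour_integral
      1 / (2 * of_real pi * \<i>) * (2 * pi * \<i> / fact ?n * (deriv ^^ ?n) h 0)) (circlepath 0 1)"
    by (rule has_contour_integral_lmul)
  moreover have "1 / (2 * of_real pi * \<i>) * (h u / (u - 0) ^ Suc ?n) = fourier_integrand h j u" for u
  proof -
    have "u powi (- int n) = inverse (u ^ n)" for n by (simp add: power_int_minus)
    from this[of ?n] have eq: "u powi (- j) = inverse (u ^ ?n)" using True by simp
    show ?thesis
      unfolding fourier_integrand_def eq diff_zero power_Suc
      by (simp only: divide_inverse inverse_mult_distrib mult_1_left mult_ac)
  qed
  ultimately have "fourier_coeff h j = 1 / (2 * of_real pi * \<i>) * (2 * pi * \<i> / fact ?n * (deriv ^^ ?n) h 0)"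
    by (simp add: fourier_coeff_integrand contour_integral_unique)
  then show ?thesis using True by (simp add: fps_expansion_def)
next
  case False
  define m where "m = nat (- j - 1)"
  have j: "- j = int (Suc m)" using False by (simp add: m_def)
  have "((\<lambda>u. h u * u ^ m / (2 * of_real pi * \<i>)) has_contour_integral 0) (circlepath 0 1)"
    by (rule Cauchy_theorem_disc_simple[of _ 0 s]) (use assms in \<open>auto intro!: holomorphic_intros\<close>)
  moreover have "h u * u ^ m / (2 * of_real pi * \<i>) = fourier_integrand h j u"
    if "u \<in> path_image (circlepath 0 1)" for u
  proof -
    have "u \<noteq> 0" using that by auto
    then show ?thesis unfolding fourier_integrand_def j by (simp add: power_int_def del: of_nat_Suc)
  qed
  ultimately have "(fourier_integrand h j has_contour_integral 0) (circlepath 0 1)"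
    by (rule has_contour_integral_eq)
  then show ?thesis using False by (simp add: fourier_coeff_integrand contour_integral_unique)
qed

lemma fourier_coeff_1: "fourier_coeff (\<lambda>_. 1) j = (if j = 0 then 1 else 0)"
proof -
  have "fps_expansion (\<lambda>_. 1) 0 = 1" by (rule fps_expansion_eqI) simp
  then show ?thesis using fourier_coeff_holomorphic[of 2 "\<lambda>_. 1" j] by auto
qed

section \<open>Taylor coefficients: Cauchy estimates and products\<close>

lemma fps_expansion_bound:
  assumes f: "f holomorphic_on ball 0 s" and r: "0 < r" "r < s" and B: "\<And>z. cmod z = r \<Longrightarrow> cmod (f z) \<le> B"
  shows "cmod (fps_nth (fps_expansion f 0) n) \<le> B * (1 / r) ^ n"
proof -
  have sub: "cball 0 r \<subseteq> ball (0::complex) s" using r by auto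
  have "cmod ((deriv ^^ n) f 0) \<le> fact n * B / r ^ n"
    by (rule Cauchy_inequality)
       (use f r B sub in \<open>auto intro: holomorphic_on_subset holomorphic_on_imp_continuous_on\<close>)
  then have "cmod ((deriv ^^ n) f 0) / fact n \<le> (fact n * B / r ^ n) / fact n"
    by (rule divide_right_mono) simp
  then show ?thesis by (simp add: fps_expansion_def norm_divide power_divide)
qed

lemma fps_expansion_decay:
  assumes f: "f holomorphic_on ball 0 s" and r: "0 < r" "r < s"
  obtains B where "0 \<le> B" "\<And>z. cmod z = r \<Longrightarrow> cmod (f z) \<le> B"
    "\<And>n. cmod (fps_nth (fps_expansion f 0) n) \<le> B * (1 / r) ^ n"
proof -
  have "compact (f ` sphere 0 r)"
    using r by (intro compact_continuous_image compact_sphere continuous_on_subset[OF holomorphic_on_imp_continuous_on[OF f]]) auto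
  then obtain B where B: "\<And>z. z \<in> sphere 0 r \<Longrightarrow> cmod (f z) \<le> B" "0 \<le> B"
    by (metis (no_types, lifting) bounded_pos compact_imp_bounded image_eqI less_imp_le)
  have B': "cmod (f z) \<le> B" if "cmod z = r" for z using B(1)[of z] that by simp
  show ?thesis by (rule that[OF B(2) B' fps_expansion_bound[OF f r B']])
qed

lemma has_fps_expansion_ball:
  assumes "f holomorphic_on ball 0 s" "0 < s"
  shows "f has_fps_expansion fps_expansion f 0"
  using has_fps_expansion_fps_expansion[of "ball 0 s" f] assms by simp

lemma fps_expansion_sums:
  assumes "f holomorphic_on ball 0 s" "cmod z < s"
  shows "(\<lambda>n. fps_nth (fps_expansion f 0) n * z ^ n) sums f z"
proof -
  have s: "0 < s" using assms(2) by (auto intro: order.strict_trans1[OF norm_ge_zero])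
  show ?thesis
    by (rule has_fps_expansion_imp_sums_complex[where r = "ereal s", OF has_fps_expansion_ball[OF assms(1) s]])
       (use assms in auto)
qed

lemma fps_expansion_mult:
  assumes "f holomorphic_on ball 0 s" "g holomorphic_on ball 0 s" "0 < s"
  shows "fps_expansion (\<lambda>z. f z * g z) 0 = fps_expansion f 0 * fps_expansion g 0"
  using assms by (intro fps_expansion_eqI has_fps_expansion_mult has_fps_expansion_ball)

lemma fourier_coeff_holomorphic_inverse:
  assumes s: "1 < s" and Q: "Q holomorphic_on ball 0 s" and h: "continuous_on (sphere 0 1) h"
  shows "(\<lambda>n. fps_nth (fps_expansion Q 0) n * fourier_coeff h (j + int n)) sums
    fourier_coeff (\<lambda>z. h z * Q (inverse z)) j"
proof -
  obtain r where r: "1 < r" "r < s" using dense[OF s] by blast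
  obtain B where B: "\<And>n. cmod (fps_nth (fps_expansion Q 0) n) \<le> B * (1 / r) ^ n"
    by (rule fps_expansion_decay[OF Q _ r(2)]) (use r in auto)
  show ?thesis
    by (rule fourier_coeff_mult_negative_series[OF _ _ B h])
       (use r s in \<open>auto intro!: fps_expansion_sums[OF Q] simp: norm_inverse\<close>)
qed

lemma continuous_on_sphere_ball:
  assumes "1 < s" "P holomorphic_on ball 0 s"
  shows "continuous_on (sphere 0 1) P"
  using assms by (intro continuous_on_subset[OF holomorphic_on_imp_continuous_on[OF assms(2)]]) auto

lemma continuous_on_sphere_ball_inverse:
  assumes "1 < s" "Q holomorphic_on ball 0 s"
  shows "continuous_on (sphere 0 1) (\<lambda>z. Q (inverse z))"
  using assms
  by (intro continuous_on_compose2[OF holomorphic_on_imp_continuous_on[OF assms(2)]])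
     (auto intro!: continuous_intros simp: norm_inverse)

lemma fourier_coeff_inverse:
  assumes s: "1 < s" and Q: "Q holomorphic_on ball 0 s"
  shows "fourier_coeff (\<lambda>z. Q (inverse z)) j = (if j \<le> 0 then fps_nth (fps_expansion Q 0) (nat (- j)) else 0)"
proof -
  have "(\<lambda>n. fps_nth (fps_expansion Q 0) n * fourier_coeff (\<lambda>_. 1) (j + int n)) sums
      fourier_coeff (\<lambda>z. 1 * Q (inverse z)) j"
    by (rule fourier_coeff_holomorphic_inverse[OF s Q]) auto
  moreover have "(\<lambda>n. fps_nth (fps_expansion Q 0) n * fourier_coeff (\<lambda>_. 1) (j + int n)) sums
      (\<Sum>n\<in>(if j \<le> 0 then {nat (- j)} else {}). fps_nth (fps_expansion Q 0) n * fourier_coeff (\<lambda>_. 1) (j + int n))"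
    by (rule sums_finite) (auto simp: fourier_coeff_1)
  ultimately have "fourier_coeff (\<lambda>z. 1 * Q (inverse z)) j =
      (\<Sum>n\<in>(if j \<le> 0 then {nat (- j)} else {}). fps_nth (fps_expansion Q 0) n * fourier_coeff (\<lambda>_. 1) (j + int n))"
    by (rule sums_unique2)
  then show ?thesis by (simp add: fourier_coeff_1)
qed

text \<open>A pole outside the disc gives a geometric power series in \<open>z\<close>. For a pole
  inside, the function is \<open>u / (1 - u * d)\<close> in \<open>u = 1/z\<close>, which vanishes
  at \<open>u = 0\<close>, so only negative indices survive.\<close>

lemma fourier_coeff_pole:
  assumes d: "d \<notin> sphere 0 1"
  shows "fourier_coeff (\<lambda>z. 1 / (z - d)) (int j) = (if 1 < cmod d then - (1 / d ^ Suc j) else 0)"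
proof (cases "1 < cmod d")
  case True
  then have d0: "d \<noteq> 0" by auto
  define F where "F = Abs_fps (\<lambda>j. - (1 / d ^ Suc j))"
  have hol: "(\<lambda>z. 1 / (z - d)) holomorphic_on ball 0 (cmod d)" by (auto intro!: holomorphic_intros)
  have "F * (fps_X - fps_const d) = 1"
  proof (rule fps_ext)
    fix n show "fps_nth (F * (fps_X - fps_const d)) n = fps_nth 1 n"
      using d0 by (cases n) (simp_all add: right_diff_distrib F_def)
  qed
  then have "(fps_X - fps_const d) * F = 1" by (simp add: mult.commute)
  then have "inverse (fps_X - fps_const d) = F" by (rule fps_inverse_unique)
  moreover have "(\<lambda>z. inverse (z - d)) has_fps_expansion inverse (fps_X - fps_const d)"
    using d0 by (intro fps_expansion_intros) auto
  ultimately have "fps_expansion (\<lambda>z. 1 / (z - d)) 0 = F"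
    by (intro fps_expansion_eqI) (simp add: inverse_eq_divide)
  then show ?thesis using fourier_coeff_holomorphic[OF True hol, of "int j"] True by (simp add: F_def)
next
  case False
  then have d1: "cmod d < 1" using d by simp
  \<comment> \<open>Chosen to satisfy both \<open>1 < s\<close> and
    \<open>s * cmod d < 1\<close>.\<close>
  define s where "s = 2 / (cmod d + 1)"
  have s: "1 < s" using d1 by (simp add: s_def field_simps add_pos_nonneg)
  have lt: "cmod (u * d) < 1" if "cmod u < s" for u
  proof -
    have "cmod u * cmod d \<le> s * cmod d" using that by (intro mult_right_mono) auto
    also have "\<dots> < 1" using d1 by (simp add: s_def field_simps add_pos_nonneg)
    finally show ?thesis by (simp add: norm_mult)
  qed
  have ne: "1 - u * d \<noteq> 0" if "cmod u < s" for u using lt[OF that] by auto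
  have hol: "(\<lambda>u. u / (1 - u * d)) holomorphic_on ball 0 s"
    using ne by (auto intro!: holomorphic_intros)
  have "fourier_coeff (\<lambda>z. 1 / (z - d)) (int j) = fourier_coeff (\<lambda>z. inverse z / (1 - inverse z * d)) (int j)"
  proof (rule fourier_coeff_cong)
    fix z :: complex assume "z \<in> sphere 0 1"
    then have "z \<noteq> 0" "z \<noteq> d" using d by auto
    then show "1 / (z - d) = inverse z / (1 - inverse z * d)" by (simp add: field_simps)
  qed
  also have "\<dots> = (if j = 0 then fps_nth (fps_expansion (\<lambda>u. u / (1 - u * d)) 0) 0 else 0)"
    using fourier_coeff_inverse[OF s hol, of "int j"] by auto
  also have "\<dots> = 0" by (simp add: fps_expansion_def)
  finally show ?thesis using False by simp
qed

text \<open>The Cauchy integral of \<open>P(z) + Q(1/z)\<close> is the coefficient of index \<open>-1\<close> of the quotient by \<open>\<tau> - z\<close>.\<close>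

lemma Cauchy_integral_Laurent:
  assumes s: "1 < s" and P: "P holomorphic_on ball 0 s" and Q: "Q holomorphic_on ball 0 s" "Q 0 = 0"
    and L: "\<And>z. z \<in> sphere 0 1 \<Longrightarrow> L z = P z + Q (inverse z)" and z: "z \<notin> sphere 0 1"
  shows "1 / (2 * of_real pi * \<i>) * contour_integral (circlepath 0 1) (\<lambda>\<tau>. L \<tau> / (\<tau> - z))
    = (if 1 < cmod z then - Q (inverse z) else P z)"
proof -
  let ?k = "\<lambda>\<tau>. 1 / (\<tau> - z)"
  have ck: "continuous_on (sphere 0 1) ?k" using z by (auto intro!: continuous_intros)
  have cP: "continuous_on (sphere 0 1) P" by (rule continuous_on_sphere_ball[OF s P])
  have cQ: "continuous_on (sphere 0 1) (\<lambda>z. Q (inverse z))" by (rule continuous_on_sphere_ball_inverse[OF s Q(1)])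
  have to_fourier: "1 / (2 * of_real pi * \<i>) * contour_integral (circlepath 0 1) (\<lambda>\<tau>. f \<tau> / (\<tau> - z))
      = fourier_coeff (\<lambda>\<tau>. ?k \<tau> * f \<tau>) (- 1)" if f: "continuous_on (sphere 0 1) f" for f
  proof -
    have "(\<lambda>\<tau>. f \<tau> / (\<tau> - z)) contour_integrable_on circlepath 0 1"
      using z f by (intro contour_integrable_continuous_circlepath continuous_intros) auto
    then have "1 / (2 * of_real pi * \<i>) * contour_integral (circlepath 0 1) (\<lambda>\<tau>. f \<tau> / (\<tau> - z))
        = contour_integral (circlepath 0 1) (\<lambda>\<tau>. 1 / (2 * of_real pi * \<i>) * (f \<tau> / (\<tau> - z)))"
      by (rule contour_integral_lmul[symmetric])
    also have "\<dots> = fourier_coeff (\<lambda>\<tau>. ?k \<tau> * f \<tau>) (- 1)"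
      unfolding fourier_coeff_def
    proof (rule contour_integral_eq)
      fix \<tau> assume "\<tau> \<in> path_image (circlepath 0 1)"
      then have "\<tau> \<noteq> 0" by auto
      then show "1 / (2 * of_real pi * \<i>) * (f \<tau> / (\<tau> - z))
          = ?k \<tau> * f \<tau> * \<tau> powi - (- 1) / (2 * of_real pi * \<i> * \<tau>)" by simp
    qed
    finally show ?thesis .
  qed
  have PP: "1 / (2 * of_real pi * \<i>) * contour_integral (circlepath 0 1) (\<lambda>\<tau>. P \<tau> / (\<tau> - z))
      = (if 1 < cmod z then 0 else P z)"
  proof (cases "1 < cmod z")
    case True
    have "((\<lambda>\<tau>. P \<tau> / (\<tau> - z)) has_contour_integral 0) (circlepath 0 1)"
      by (rule Cauchy_theorem_disc_simple[of _ 0 "min s (cmod z)"])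
         (use True s P in \<open>auto intro!: holomorphic_intros intro: holomorphic_on_subset\<close>)
    then show ?thesis using True by (simp add: contour_integral_unique)
  next
    case False
    then have "cmod z < 1" using z by simp
    have "((\<lambda>\<tau>. P \<tau> / (\<tau> - z)) has_contour_integral (2 * of_real pi * \<i> * P z)) (circlepath 0 1)"
    proof (rule Cauchy_integral_circlepath_simple)
      show "P holomorphic_on cball 0 1" by (rule holomorphic_on_subset[OF P]) (use s in auto)
    qed (use \<open>cmod z < 1\<close> in simp)
    then show ?thesis using False by (simp add: contour_integral_unique)
  qed
  have QQ: "fourier_coeff (\<lambda>\<tau>. ?k \<tau> * Q (inverse \<tau>)) (- 1) = (if 1 < cmod z then - Q (inverse z) else 0)"
  proof -
    have "(\<lambda>n. fps_nth (fps_expansion Q 0) n * fourier_coeff ?k (- 1 + int n)) sums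
        fourier_coeff (\<lambda>\<tau>. ?k \<tau> * Q (inverse \<tau>)) (- 1)"
      by (rule fourier_coeff_holomorphic_inverse[OF s Q(1) ck])
    moreover have "fps_nth (fps_expansion Q 0) n * fourier_coeff ?k (- 1 + int n)
        = (if 1 < cmod z then - (fps_nth (fps_expansion Q 0) n * inverse z ^ n) else 0)" for n
    proof (cases n)
      case 0 then show ?thesis using Q(2) by (simp add: fps_expansion_def)
    next
      case (Suc m)
      then have "- 1 + int n = int m" by simp
      then show ?thesis unfolding fourier_coeff_pole[OF z] \<open>- 1 + int n = int m\<close>
        using Suc by (simp add: power_inverse[symmetric] divide_inverse)
    qed
    moreover have "(\<lambda>n. if 1 < cmod z then - (fps_nth (fps_expansion Q 0) n * inverse z ^ n) else 0) sums
        (if 1 < cmod z then - Q (inverse z) else 0)"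
    proof (cases "1 < cmod z")
      case True
      then have "cmod (inverse z) < 1" by (simp add: norm_inverse inverse_less_1_iff)
      then have "cmod (inverse z) < s" using s by linarith
      then show ?thesis using True sums_minus[OF fps_expansion_sums[OF Q(1)]] by simp
    qed simp
    ultimately show ?thesis using sums_unique2 by fastforce
  qed
  have cL: "continuous_on (sphere 0 1) (\<lambda>z. P z + Q (inverse z))" by (intro continuous_intros cP cQ)
  have "contour_integral (circlepath 0 1) (\<lambda>\<tau>. L \<tau> / (\<tau> - z))
      = contour_integral (circlepath 0 1) (\<lambda>\<tau>. (P \<tau> + Q (inverse \<tau>)) / (\<tau> - z))"
    by (rule contour_integral_eq) (simp add: L)
  then have "1 / (2 * of_real pi * \<i>) * contour_integral (circlepath 0 1) (\<lambda>\<tau>. L \<tau> / (\<tau> - z))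
      = fourier_coeff (\<lambda>\<tau>. ?k \<tau> * P \<tau> + ?k \<tau> * Q (inverse \<tau>)) (- 1)"
    using to_fourier[OF cL] by (simp add: distrib_left)
  also have "\<dots> = fourier_coeff (\<lambda>\<tau>. ?k \<tau> * P \<tau>) (- 1) + fourier_coeff (\<lambda>\<tau>. ?k \<tau> * Q (inverse \<tau>)) (- 1)"
    by (rule fourier_coeff_add) (intro continuous_on_mult ck cP cQ)+
  also have "fourier_coeff (\<lambda>\<tau>. ?k \<tau> * P \<tau>) (- 1) = (if 1 < cmod z then 0 else P z)"
    using to_fourier[OF cP] PP by simp
  finally show ?thesis unfolding QQ by (cases "1 < cmod z") simp_all
qed

lemma norm_exp_minus_1_le: "cmod (exp w - 1) \<le> exp (cmod w) * cmod w"
proof -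
  have "cmod (exp w - 1) \<le> exp \<bar>Re w\<bar> * cmod w" using Taylor_exp[of w 0] by simp
  also have "\<dots> \<le> exp (cmod w) * cmod w" by (intro mult_right_mono) (auto simp: abs_Re_le_cmod)
  finally show ?thesis .
qed

lemma norm_exp_minus_1_minus_le: "cmod (exp w - 1 - w) \<le> exp (cmod w) * (cmod w)\<^sup>2"
proof -
  have "cmod (exp w - 1 - w) \<le> exp \<bar>Re w\<bar> * (cmod w)\<^sup>2"
    using Taylor_exp[of w 1] by (simp add: power2_eq_square diff_diff_eq)
  also have "\<dots> \<le> exp (cmod w) * (cmod w)\<^sup>2" by (intro mult_right_mono) (auto simp: abs_Re_le_cmod)
  finally show ?thesis .
qed

text \<open>Cauchy estimates on the circle of radius \<open>r\<close> convert the pointwise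
  expansion of the exponential in \<open>x\<close> into coefficient bounds. Excluding index
  \<open>0\<close> removes the constant term \<open>1\<close>.\<close>

lemma fps_expansion_exp_scaled:
  assumes Q: "Q holomorphic_on ball 0 s" and Q0: "Q 0 = 0" and r: "0 < r" "r < s"
  defines "F \<equiv> \<lambda>x. fps_expansion (\<lambda>u. exp (x * Q u)) 0"
  obtains M where "0 \<le> M"
    "\<And>x i. cmod x \<le> 1 \<Longrightarrow> 1 \<le> i \<Longrightarrow> cmod (fps_nth (F x) i) \<le> M * cmod x * (1 / r) ^ i"
    "\<And>x i. cmod x \<le> 1 \<Longrightarrow> 1 \<le> i \<Longrightarrow>
      cmod (fps_nth (F x) i - x * fps_nth (fps_expansion Q 0) i) \<le> M * (cmod x)\<^sup>2 * (1 / r) ^ i"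
proof -
  have s: "0 < s" using r by simp
  obtain B where B: "0 \<le> B" "\<And>z. cmod z = r \<Longrightarrow> cmod (Q z) \<le> B"
    by (rule fps_expansion_decay[OF Q r]) (rule that)
  define M where "M = exp B * (B + B\<^sup>2)"
  have M: "0 \<le> M" "exp B * B \<le> M" "exp B * B\<^sup>2 \<le> M" using B by (simp_all add: M_def)
  have exQ: "(\<lambda>u. exp (x * Q u)) holomorphic_on ball 0 s" for x by (intro holomorphic_intros Q)
  note ex = has_fps_expansion_ball[OF exQ s] and exQ' = has_fps_expansion_ball[OF Q s]
  have e1: "fps_expansion (\<lambda>u. exp (x * Q u) - 1) 0 = F x - 1" for x
    unfolding F_def by (intro fps_expansion_eqI has_fps_expansion_diff ex has_fps_expansion_1)
  have e2: "fps_expansion (\<lambda>u. exp (x * Q u) - 1 - x * Q u) 0 = F x - 1 - fps_const x * fps_expansion Q 0" for x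
    unfolding F_def
    by (intro fps_expansion_eqI has_fps_expansion_diff ex has_fps_expansion_1 has_fps_expansion_cmult_left exQ')
  have xQ: "cmod (x * Q z) \<le> cmod x * B" "exp (cmod (x * Q z)) \<le> exp B" if "cmod x \<le> 1" "cmod z = r" for x z
  proof -
    show 1: "cmod (x * Q z) \<le> cmod x * B" unfolding norm_mult by (intro mult_left_mono B that) auto
    have "cmod x * B \<le> 1 * B" using that B by (intro mult_right_mono) auto
    with 1 show "exp (cmod (x * Q z)) \<le> exp B" by simp
  qed
  show ?thesis
  proof (rule that[OF M(1)])
    fix x :: complex and i :: nat assume x: "cmod x \<le> 1" and i: "1 \<le> i"
    have "cmod (fps_nth (fps_expansion (\<lambda>u. exp (x * Q u) - 1) 0) i) \<le> M * cmod x * (1 / r) ^ i"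
    proof (rule fps_expansion_bound[OF _ r])
      fix z assume z: "cmod z = r"
      have "cmod (exp (x * Q z) - 1) \<le> exp (cmod (x * Q z)) * cmod (x * Q z)" by (rule norm_exp_minus_1_le)
      also have "\<dots> \<le> exp B * (cmod x * B)" using xQ[OF x z] by (intro mult_mono) auto
      also have "\<dots> = exp B * B * cmod x" by simp
      also have "\<dots> \<le> M * cmod x" using M by (intro mult_right_mono) auto
      finally show "cmod (exp (x * Q z) - 1) \<le> M * cmod x" .
    qed (intro holomorphic_intros Q)
    then show "cmod (fps_nth (F x) i) \<le> M * cmod x * (1 / r) ^ i" using i by (simp add: e1)
    have "cmod (fps_nth (fps_expansion (\<lambda>u. exp (x * Q u) - 1 - x * Q u) 0) i) \<le> M * (cmod x)\<^sup>2 * (1 / r) ^ i"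
    proof (rule fps_expansion_bound[OF _ r])
      fix z assume z: "cmod z = r"
      have "cmod (exp (x * Q z) - 1 - x * Q z) \<le> exp (cmod (x * Q z)) * (cmod (x * Q z))\<^sup>2"
        by (rule norm_exp_minus_1_minus_le)
      also have "\<dots> \<le> exp B * (cmod x * B)\<^sup>2" using xQ[OF x z] by (intro mult_mono power_mono) auto
      also have "\<dots> = exp B * B\<^sup>2 * (cmod x)\<^sup>2" by (simp add: power_mult_distrib)
      also have "\<dots> \<le> M * (cmod x)\<^sup>2" using M by (intro mult_right_mono) auto
      finally show "cmod (exp (x * Q z) - 1 - x * Q z) \<le> M * (cmod x)\<^sup>2" .
    qed (intro holomorphic_intros Q)
    then show "cmod (fps_nth (F x) i - x * fps_nth (fps_expansion Q 0) i) \<le> M * (cmod x)\<^sup>2 * (1 / r) ^ i"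
      using i by (simp add: e2)
  qed
qed

section \<open>Asymptotics of the bilinear form of the adjugate\<close>

lemma geometric_product_sum_le:
  fixes p q :: real
  assumes p: "0 \<le> p" "p < q"
  shows "(\<Sum>i<n. p ^ (n - i) * q ^ i) \<le> q / (q - p) * q ^ n"
proof -
  have "(\<Sum>i<n. p ^ (n - i) * q ^ i) = (\<Sum>i<n. p ^ (n - (n - Suc i)) * q ^ (n - Suc i))"
    by (rule sum.nat_diff_reindex[symmetric])
  also have "\<dots> \<le> (\<Sum>i<n. q ^ n * (p / q) ^ i)"
  proof (rule sum_mono)
    fix i assume "i \<in> {..<n}"
    then have i: "n - (n - Suc i) = Suc i" "q ^ n = q ^ Suc i * q ^ (n - Suc i)" by (simp_all add: power_add[symmetric] del: power_Suc)
    have "p ^ Suc i * q ^ (n - Suc i) \<le> (q * p ^ i) * q ^ (n - Suc i)"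
      unfolding power_Suc using p by (intro mult_right_mono) auto
    also have "\<dots> = q ^ n * (p / q) ^ i" unfolding i(2) using p by (simp add: power_divide)
    finally show "p ^ (n - (n - Suc i)) * q ^ (n - Suc i) \<le> q ^ n * (p / q) ^ i" unfolding i(1) .
  qed
  also have "\<dots> \<le> q ^ n / (1 - p / q)"
    using p by (intro sum_geometric_le) auto
  also have "\<dots> = q / (q - p) * q ^ n" using p by (simp add: field_simps)
  finally show ?thesis .
qed

text \<open>A geometric sequence concentrated at the last indices is reproduced by convolution, up
  to a partial sum of the series of \<open>x\<close> at \<open>1 / d\<close>. These partial sums are
  the source of the values of the factors in the limit.\<close>

lemma bottom_convolution:
  fixes d :: complex
  assumes "j < n"
  shows "(\<Sum>k\<le>j. x (j - k) * - (1 / d ^ (n - k))) = - ((1 / d) ^ (n - j)) * (\<Sum>i\<le>j. x i * (1 / d) ^ i)"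
proof -
  have "(\<Sum>k\<le>j. x (j - k) * - (1 / d ^ (n - k))) = (\<Sum>i\<le>j. x i * - (1 / d ^ (n - (j - i))))"
    using sum.nat_diff_reindex[of "\<lambda>i. x i * - (1 / d ^ (n - (j - i)))" "Suc j"]
    unfolding lessThan_Suc_atMost by (simp add: Suc_diff_Suc cong: sum.cong_simp)
  also have "\<dots> = (\<Sum>i\<le>j. - ((1 / d) ^ (n - j)) * (x i * (1 / d) ^ i))"
  proof (rule sum.cong[OF refl])
    fix i assume "i \<in> {..j}"
    then have "n - (j - i) = (n - j) + i" using assms by simp
    then show "x i * - (1 / d ^ (n - (j - i))) = - ((1 / d) ^ (n - j)) * (x i * (1 / d) ^ i)"
      by (simp add: power_add power_divide)
  qed
  finally show ?thesis by (simp add: sum_distrib_left)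
qed

lemma partial_sum_bound:
  fixes t C :: real and x :: "nat \<Rightarrow> complex"
  assumes t: "0 < t" "t < 1" and x: "\<And>i. cmod (x i) \<le> C * t ^ i" and z: "cmod z \<le> 1"
    and s: "(\<lambda>i. x i * z ^ i) sums X"
  shows "cmod (\<Sum>i\<le>j. x i * z ^ i) \<le> C / (1 - t)" "cmod ((\<Sum>i\<le>j. x i * z ^ i) - X) \<le> C / (1 - t) * t ^ j"
    "cmod X \<le> C / (1 - t)"
proof -
  have C: "0 \<le> C" using x[of 0] by (simp add: order_trans[OF norm_ge_zero])
  have xz: "cmod (x i * z ^ i) \<le> C * t ^ i" for i
  proof -
    have "cmod (x i * z ^ i) \<le> (C * t ^ i) * 1"
      unfolding norm_mult norm_power using x z t C by (intro mult_mono power_le_one) auto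
    then show ?thesis by simp
  qed
  have "cmod (\<Sum>i<Suc j. x i * z ^ i) \<le> C / (1 - t)"
    using t C by (intro order_trans[OF norm_sum] sum_geometric_le xz) auto
  then show "cmod (\<Sum>i\<le>j. x i * z ^ i) \<le> C / (1 - t)" by (simp only: lessThan_Suc_atMost)
  have "X - (\<Sum>i<Suc j. x i * z ^ i) = (\<Sum>i. x (i + Suc j) * z ^ (i + Suc j))"
    using suminf_minus_initial_segment[OF sums_summable[OF s], of "Suc j"] sums_unique[OF s] by simp
  also have "cmod \<dots> \<le> C * t ^ j / (1 - t)"
  proof (rule summable_geometric_bound(2))
    fix i
    have "C * t ^ (i + Suc j) \<le> C * t ^ (i + j)" using C t by (intro mult_left_mono power_decreasing) auto
    then show "cmod (x (i + Suc j) * z ^ (i + Suc j)) \<le> C * t ^ j * t ^ i"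
      using xz[of "i + Suc j"] by (simp add: power_add mult_ac)
  qed (use t in auto)
  finally show "cmod ((\<Sum>i\<le>j. x i * z ^ i) - X) \<le> C / (1 - t) * t ^ j"
    by (simp add: lessThan_Suc_atMost norm_minus_commute)
  have "cmod (suminf (\<lambda>i. x i * z ^ i)) \<le> C / (1 - t)"
    by (rule summable_geometric_bound(2)[OF _ t(2) xz]) (use t in simp)
  then show "cmod X \<le> C / (1 - t)" using sums_unique[OF s] by simp
qed

lemma bilinear_sum:
  fixes F :: complex
  shows "(\<Sum>m\<in>J. c m * V m) * F * (\<Sum>l\<in>I. a l * U l) = (\<Sum>l\<in>I. \<Sum>m\<in>J. a l * c m * (V m * F * U l))"
  by (subst sum.swap) (simp add: sum_distrib_left sum_distrib_right mult_ac)

lemma sum_diagonal: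
  fixes d :: complex and n :: nat
  shows "d * (\<Sum>i<n. v i * u i) = (\<Sum>i<n. \<Sum>j<n. v i * (if i = j then d else 0) * u j)"
proof -
  have "(\<Sum>j<n. v i * (if i = j then d else 0) * u j) = d * (v i * u i)" if "i < n" for i
  proof -
    have "(\<Sum>j<n. v i * (if i = j then d else 0) * u j) = (\<Sum>j<n. if j = i then v i * d * u j else 0)"
      by (rule sum.cong) auto
    then show ?thesis using that by simp
  qed
  then show ?thesis unfolding sum_distrib_left by simp
qed

section \<open>The bilinear form \<open>W\<close> and its pairings\<close>

context wiener_hopf
begin

text \<open>The form \<open>v adj u\<close> that remains once the triangular factors have acted on
  the borders.\<close>

definition W :: "complex fps \<Rightarrow> complex fps \<Rightarrow> nat \<Rightarrow> (nat \<Rightarrow> complex) \<Rightarrow> (nat \<Rightarrow> complex) \<Rightarrow> complex" where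
  "W f g n u v = (\<Sum>i<n. \<Sum>j<n. (\<Sum>k\<le>i. v k * fps_nth g (i - k)) * fadj n (idp (K f g)) i j
      * (\<Sum>k\<le>j. fps_nth e (j - k) * u k))"

lemma W_sum:
  "W f g n (\<lambda>k. \<Sum>l\<in>I. a l * u l k) (\<lambda>k. \<Sum>m\<in>J. c m * v m k)
    = (\<Sum>l\<in>I. \<Sum>m\<in>J. a l * c m * W f g n (u l) (v m))"
proof -
  let ?U = "\<lambda>l j. \<Sum>k\<le>j. fps_nth e (j - k) * u l k" and ?V = "\<lambda>m i. \<Sum>k\<le>i. v m k * fps_nth g (i - k)"
  let ?F = "fadj n (idp (K f g))"
  have U: "(\<Sum>k\<le>j. fps_nth e (j - k) * (\<Sum>l\<in>I. a l * u l k)) = (\<Sum>l\<in>I. a l * ?U l j)" for j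
    unfolding sum_distrib_left by (subst sum.swap) (simp add: mult_ac)
  have V: "(\<Sum>k\<le>i. (\<Sum>m\<in>J. c m * v m k) * fps_nth g (i - k)) = (\<Sum>m\<in>J. c m * ?V m i)" for i
    unfolding sum_distrib_left sum_distrib_right by (subst sum.swap) (simp add: mult_ac)
  have "W f g n (\<lambda>k. \<Sum>l\<in>I. a l * u l k) (\<lambda>k. \<Sum>m\<in>J. c m * v m k)
      = (\<Sum>i<n. \<Sum>j<n. \<Sum>l\<in>I. \<Sum>m\<in>J. a l * c m * (?V m i * ?F i j * ?U l j))"
    unfolding W_def U V bilinear_sum ..
  also have "\<dots> = (\<Sum>i<n. \<Sum>l\<in>I. \<Sum>j<n. \<Sum>m\<in>J. a l * c m * (?V m i * ?F i j * ?U l j))"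
    by (intro sum.cong refl sum.swap)
  also have "\<dots> = (\<Sum>l\<in>I. \<Sum>i<n. \<Sum>j<n. \<Sum>m\<in>J. a l * c m * (?V m i * ?F i j * ?U l j))"
    by (rule sum.swap)
  also have "\<dots> = (\<Sum>l\<in>I. \<Sum>i<n. \<Sum>m\<in>J. \<Sum>j<n. a l * c m * (?V m i * ?F i j * ?U l j))"
    by (intro sum.cong refl sum.swap)
  also have "\<dots> = (\<Sum>l\<in>I. \<Sum>m\<in>J. \<Sum>i<n. \<Sum>j<n. a l * c m * (?V m i * ?F i j * ?U l j))"
    by (intro sum.cong refl sum.swap)
  finally show ?thesis by (simp add: W_def sum_distrib_left)
qed

lemma K_decay:
  assumes "decays f" "decays g"
  obtains c where "0 \<le> c" "\<And>i j. cmod (K f g i j) \<le> c * q ^ (i + j)"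
proof -
  obtain C where C: "0 \<le> C" "\<And>i. cmod (fps_nth f i) \<le> C * t ^ i" using assms(1) by (rule decaysE) blast
  obtain D where D: "0 \<le> D" "\<And>i. cmod (fps_nth g i) \<le> D * t ^ i" using assms(2) by (rule decaysE) blast
  have "0 \<le> (CB / (1 - t) * D * \<kappa>) * C" using CB0 t1 D C kappa0 by (intro mult_nonneg_nonneg) auto
  then show ?thesis by (rule that) (rule K_le[OF C(1) D(1) C(2) D(2)])
qed

text \<open>The adjugate is a scalar matrix up to \<open>O(q ^ (i + j))\<close>, so the error splits
  into two weighted sums, one per border. The constant comes before \<open>n\<close> and the
  borders, since the borders will vary with \<open>n\<close>.\<close>

lemma W_approx:
  assumes fg: "decays f" "decays g"
  shows "\<exists>c\<ge>0. \<forall>n u v U V.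
    (\<forall>i<n. cmod (\<Sum>k\<le>i. v k * fps_nth g (i - k)) \<le> V i) \<longrightarrow>
    (\<forall>j<n. cmod (\<Sum>k\<le>j. fps_nth e (j - k) * u k) \<le> U j) \<longrightarrow>
    cmod (W f g n u v - fdet n (idp (K f g)) *
      (\<Sum>i<n. (\<Sum>k\<le>i. v k * fps_nth g (i - k)) * (\<Sum>k\<le>i. fps_nth e (i - k) * u k)))
    \<le> c * (\<Sum>i<n. V i * q ^ i) * (\<Sum>j<n. U j * q ^ j)"
proof -
  obtain c0 where c0: "0 \<le> c0" "\<And>i j. cmod (K f g i j) \<le> c0 * q ^ (i + j)" using fg by (rule K_decay) blast
  define c where "c = exp (c0 / (1 - q)\<^sup>2) * (c0 + c0\<^sup>2 / (1 - q)\<^sup>2)"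
  have c: "0 \<le> c" using c0 by (simp add: c_def)
  show ?thesis
  proof (intro exI[of _ c] conjI allI impI c)
    fix n :: nat and u v :: "nat \<Rightarrow> complex" and U V :: "nat \<Rightarrow> real"
    assume VV: "\<forall>i<n. cmod (\<Sum>k\<le>i. v k * fps_nth g (i - k)) \<le> V i"
      and UU: "\<forall>j<n. cmod (\<Sum>k\<le>j. fps_nth e (j - k) * u k) \<le> U j"
    note V = VV[rule_format] and U = UU[rule_format]
    let ?u = "\<lambda>j. \<Sum>k\<le>j. fps_nth e (j - k) * u k" and ?v = "\<lambda>i. \<Sum>k\<le>i. v k * fps_nth g (i - k)"
    let ?F = "fadj n (idp (K f g))" and ?d = "fdet n (idp (K f g))"
    have "?d * (\<Sum>i<n. ?v i * ?u i) = (\<Sum>i<n. \<Sum>j<n. ?v i * (if i = j then ?d else 0) * ?u j)"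
      by (rule sum_diagonal)
    then have eq: "W f g n u v - ?d * (\<Sum>i<n. ?v i * ?u i)
        = (\<Sum>i<n. \<Sum>j<n. ?v i * (?F i j - (if i = j then ?d else 0)) * ?u j)"
      unfolding W_def by (simp only: sum_subtractf right_diff_distrib left_diff_distrib)
    have "cmod (\<Sum>i<n. \<Sum>j<n. ?v i * (?F i j - (if i = j then ?d else 0)) * ?u j)
        \<le> (\<Sum>i<n. \<Sum>j<n. V i * (c * q ^ (i + j)) * U j)"
    proof (intro order_trans[OF norm_sum] sum_mono)
      fix i j assume "i \<in> {..<n}" "j \<in> {..<n}"
      then have ij: "i < n" "j < n" by auto
      have "0 \<le> V i" "0 \<le> U j" using V[OF ij(1)] U[OF ij(2)] by (auto intro: order_trans[OF norm_ge_zero])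
      then show "cmod (?v i * (?F i j - (if i = j then ?d else 0)) * ?u j) \<le> V i * (c * q ^ (i + j)) * U j"
        unfolding norm_mult c_def using V U ij c0 q0 q1
        by (intro mult_mono fadj_idp_approx mult_nonneg_nonneg) auto
    qed
    also have "\<dots> = c * (\<Sum>i<n. V i * q ^ i) * (\<Sum>j<n. U j * q ^ j)"
    proof -
      have "c * (\<Sum>i<n. V i * q ^ i) * (\<Sum>j<n. U j * q ^ j)
          = c * (\<Sum>i<n. \<Sum>j<n. (V i * q ^ i) * (U j * q ^ j))"
        unfolding mult.assoc[of c] sum_product ..
      also have "\<dots> = (\<Sum>i<n. \<Sum>j<n. V i * (c * q ^ (i + j)) * U j)"
        unfolding sum_distrib_left by (intro sum.cong refl) (simp only: power_add mult_ac)
      finally show ?thesis ..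
    qed
    finally show "cmod (W f g n u v - ?d * (\<Sum>i<n. ?v i * ?u i)) \<le> c * (\<Sum>i<n. V i * q ^ i) * (\<Sum>j<n. U j * q ^ j)" unfolding eq .
  qed
qed

lemma fdet_K_bounded:
  assumes "decays f" "decays g"
  obtains c where "0 \<le> c" "\<And>n. cmod (fdet n (idp (K f g))) \<le> c"
proof -
  obtain c0 where c0: "0 \<le> c0" "\<And>i j. cmod (K f g i j) \<le> c0 * q ^ (i + j)" using assms by (rule K_decay) blast
  show ?thesis by (rule that[OF _ norm_fdet_idp_le[OF q0 q1 c0]]) simp
qed

lemma fdet_K_bigo:
  assumes "decays f" "decays g" and lim: "(\<lambda>n. fdet n (idp (K f g))) \<longlonglongrightarrow> E"
  shows "(\<lambda>n. fdet n (idp (K f g)) - E) \<in> O(\<lambda>n. complex_of_real q ^ n)"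
proof -
  obtain c0 where c0: "0 \<le> c0" "\<And>i j. cmod (K f g i j) \<le> c0 * q ^ (i + j)" using assms(1,2) by (rule K_decay) blast
  obtain l D where l: "\<And>n. cmod (fdet n (idp (K f g)) - l) \<le> D * q ^ n" "(\<lambda>n. fdet n (idp (K f g))) \<longlonglongrightarrow> l"
    by (rule fdet_idp_limit[OF q0 q1 c0]) blast
  have "l = E" using LIMSEQ_unique[OF l(2) lim] .
  then show ?thesis using l(1) q0 by (intro bigoI[of _ D]) (auto simp: norm_power)
qed

lemma top_vector_bound:
  assumes x: "\<And>i. cmod (fps_nth x i) \<le> C * t ^ i" and C: "0 \<le> C" and d: "1 / cmod d < q"
  shows "cmod (\<Sum>k\<le>j. fps_nth x (j - k) * - (1 / d ^ Suc k)) \<le> C * \<kappa> * q ^ j"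
proof -
  have y: "cmod (- (1 / d ^ Suc k)) \<le> 1 * q ^ k" for k
  proof -
    have "(1 / cmod d) ^ Suc k \<le> q ^ Suc k" using d by (intro power_mono) auto
    also have "\<dots> \<le> q ^ k" using q0 q1 by (intro power_decreasing) auto
    finally show ?thesis by (simp add: norm_divide norm_power norm_mult power_divide)
  qed
  show ?thesis using convolution_bound[OF t0 tq C _ x y, of j] by simp
qed

lemma bottom_vector_bound:
  assumes x: "\<And>i. cmod (fps_nth x i) \<le> C * t ^ i" and d: "1 / cmod d < q" and j: "j < n"
    and s: "(\<lambda>i. fps_nth x i * (1 / d) ^ i) sums X'"
  shows "cmod (\<Sum>k\<le>j. fps_nth x (j - k) * - (1 / d ^ (n - k))) \<le> C / (1 - t) * (1 / cmod d) ^ (n - j)"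
proof -
  have z: "cmod (1 / d) \<le> 1" using d q1 by (simp add: norm_divide)
  have "cmod (\<Sum>i\<le>j. fps_nth x i * (1 / d) ^ i) * (1 / cmod d) ^ (n - j) \<le> C / (1 - t) * (1 / cmod d) ^ (n - j)"
    by (intro mult_right_mono partial_sum_bound(1)[OF t0 t1 x z s]) auto
  then show ?thesis
    unfolding bottom_convolution[OF j] by (simp add: norm_mult norm_power norm_divide mult_ac)
qed

text \<open>Common scheme for the pairings: \<open>V\<close> and \<open>U\<close> bound the
  transformed borders, \<open>w\<close> is the limit of their plain inner product. Three errors add
  up: deviation of the adjugate from a scalar matrix, of the inner product from \<open>w\<close>, of
  the determinant from \<open>E\<close>.\<close>

lemma W_bigo:
  fixes u v :: "nat \<Rightarrow> nat \<Rightarrow> complex" and U V :: "nat \<Rightarrow> nat \<Rightarrow> real"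
  defines "u' \<equiv> \<lambda>n j. \<Sum>k\<le>j. fps_nth e (j - k) * u n k" and "v' \<equiv> \<lambda>g n i. \<Sum>k\<le>i. v n k * fps_nth g (i - k)"
  assumes fg: "decays f" "decays g" and lim: "(\<lambda>n. fdet n (idp (K f g))) \<longlonglongrightarrow> E"
    and V: "\<And>n i. i < n \<Longrightarrow> cmod (v' g n i) \<le> V n i" and U: "\<And>n j. j < n \<Longrightarrow> cmod (u' n j) \<le> U n j"
    and VU: "\<And>n. (\<Sum>i<n. V n i * q ^ i) * (\<Sum>j<n. U n j * q ^ j) \<le> A * q ^ n"
    and main: "(\<lambda>n. (\<Sum>i<n. v' g n i * u' n i) - w) \<in> O(\<lambda>n. complex_of_real q ^ n)"
  shows "(\<lambda>n. W f g n (u n) (v n) - E * w) \<in> O(\<lambda>n. complex_of_real q ^ n)"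
proof -
  let ?d = "\<lambda>n. fdet n (idp (K f g))" and ?S = "\<lambda>n. \<Sum>i<n. v' g n i * u' n i"
  obtain k where k: "0 \<le> k" "\<forall>n u v U V.
    (\<forall>i<n. cmod (\<Sum>k\<le>i. v k * fps_nth g (i - k)) \<le> V i) \<longrightarrow>
    (\<forall>j<n. cmod (\<Sum>k\<le>j. fps_nth e (j - k) * u k) \<le> U j) \<longrightarrow>
    cmod (W f g n u v - fdet n (idp (K f g)) *
      (\<Sum>i<n. (\<Sum>k\<le>i. v k * fps_nth g (i - k)) * (\<Sum>k\<le>i. fps_nth e (i - k) * u k)))
    \<le> k * (\<Sum>i<n. V i * q ^ i) * (\<Sum>j<n. U j * q ^ j)"
    using W_approx[OF fg] by blast
  obtain D where D: "0 \<le> D" "\<And>n. cmod (?d n) \<le> D" using fg by (rule fdet_K_bounded) blast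
  have 1: "(\<lambda>n. W f g n (u n) (v n) - ?d n * ?S n) \<in> O(\<lambda>n. complex_of_real q ^ n)"
  proof (intro bigoI[of _ "k * A"] always_eventually allI)
    fix n
    have "cmod (W f g n (u n) (v n) - ?d n * ?S n) \<le> k * (\<Sum>i<n. V n i * q ^ i) * (\<Sum>j<n. U n j * q ^ j)"
      unfolding u'_def v'_def using V[unfolded v'_def] U[unfolded u'_def]
      by (intro k(2)[rule_format]) auto
    also have "\<dots> \<le> k * (A * q ^ n)" unfolding mult.assoc by (rule mult_left_mono[OF VU k(1)])
    finally show "cmod (W f g n (u n) (v n) - ?d n * ?S n) \<le> k * A * cmod (complex_of_real q ^ n)"
      using q0 by (simp add: norm_power)
  qed
  have 2: "(\<lambda>n. ?d n * (?S n - w)) \<in> O(\<lambda>n. complex_of_real q ^ n)"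
  proof -
    have "?d \<in> O(\<lambda>_. 1)" using D by (intro bigoI[of _ D]) auto
    from landau_o.big.mult[OF this main] show ?thesis by simp
  qed
  have 3: "(\<lambda>n. w * (?d n - E)) \<in> O(\<lambda>n. complex_of_real q ^ n)"
    using fdet_K_bigo[OF fg lim] by (cases "w = 0") auto
  have "(\<lambda>n. (W f g n (u n) (v n) - ?d n * ?S n) + ?d n * (?S n - w) + w * (?d n - E))
      \<in> O(\<lambda>n. complex_of_real q ^ n)"
    by (rule sum_in_bigo(1)[OF sum_in_bigo(1)[OF 1 2] 3])
  moreover have "(\<lambda>n. (W f g n (u n) (v n) - ?d n * ?S n) + ?d n * (?S n - w) + w * (?d n - E))
      = (\<lambda>n. W f g n (u n) (v n) - E * w)"
    by (rule ext) (simp add: algebra_simps)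
  ultimately show ?thesis by (simp only:)
qed

lemma bigo_q:
  assumes "\<And>n. cmod (x n) \<le> C * q ^ n"
  shows "x \<in> O(\<lambda>n. complex_of_real q ^ n)"
  using assms q0 by (intro bigoI[of _ C]) (auto simp: norm_power)

lemma bottom_weight_le:
  fixes p V :: real
  assumes "0 \<le> V" "0 \<le> p" "p < q"
  shows "(\<Sum>i<n. V * p ^ (n - i) * q ^ i) \<le> V * (q / (q - p)) * q ^ n"
  using mult_left_mono[OF geometric_product_sum_le[OF assms(2,3), of n] assms(1)]
  by (simp add: sum_distrib_left mult_ac)

lemma top_weight_le:
  assumes "0 \<le> U"
  shows "(\<Sum>j<n. U * q ^ j * q ^ j) \<le> U / (1 - q)"
proof (rule sum_geometric_le)
  show "U * q ^ i * q ^ i \<le> U * q ^ i" for i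
    using assms q0 q1 by (intro mult_left_le) (auto simp: power_le_one)
qed (use assms q0 q1 in auto)

text \<open>A sequence concentrated at the top and one concentrated at the bottom overlap only in
  terms \<open>q ^ i * p ^ (n - i)\<close>, which sum to \<open>O(q ^ n)\<close> because
  \<open>p < q\<close>.\<close>

lemma top_bottom_product_bigo:
  fixes p U V :: real
  assumes "0 \<le> U" "0 \<le> V" "0 \<le> p" "p < q"
    and x: "\<And>n i. i < n \<Longrightarrow> cmod (x n i) \<le> U * q ^ i" and y: "\<And>n i. i < n \<Longrightarrow> cmod (y n i) \<le> V * p ^ (n - i)"
  shows "(\<lambda>n. \<Sum>i<n. x n i * y n i) \<in> O(\<lambda>n. complex_of_real q ^ n)"
proof (rule bigo_q)
  fix n
  have "cmod (\<Sum>i<n. x n i * y n i) \<le> (\<Sum>i<n. U * (V * p ^ (n - i) * q ^ i))"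
  proof (rule sum_norm_le)
    fix i assume i: "i \<in> {..<n}"
    have "cmod (x n i * y n i) \<le> (U * q ^ i) * (V * p ^ (n - i))"
      unfolding norm_mult using i assms(1) q0 by (intro mult_mono x y) auto
    then show "cmod (x n i * y n i) \<le> U * (V * p ^ (n - i) * q ^ i)" by (simp add: mult_ac)
  qed
  also have "\<dots> \<le> U * (V * (q / (q - p)) * q ^ n)"
    unfolding sum_distrib_left[symmetric] by (rule mult_left_mono[OF bottom_weight_le[OF assms(2-4)] assms(1)])
  finally show "cmod (\<Sum>i<n. x n i * y n i) \<le> U * (V * (q / (q - p))) * q ^ n" by (simp add: mult_ac)
qed

lemma W_top_bottom_bigo:
  assumes fg: "decays f" "decays g" and lim: "(\<lambda>n. fdet n (idp (K f g))) \<longlonglongrightarrow> E"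
    and d: "1 / cmod d < q" and c: "1 / cmod c < q"
    and sc: "(\<lambda>i. fps_nth g i * (1 / c) ^ i) sums Y"
  shows "(\<lambda>n. W f g n (\<lambda>k. - (1 / d ^ Suc k)) (\<lambda>k. - (1 / c ^ (n - k)))) \<in> O(\<lambda>n. complex_of_real q ^ n)"
proof -
  obtain Cg where Cg: "0 \<le> Cg" "\<And>i. cmod (fps_nth g i) \<le> Cg * t ^ i" using fg(2) by (rule decaysE) blast
  define V where "V = Cg / (1 - t)"
  define U where "U = Ce * \<kappa>"
  define p where "p = 1 / cmod c"
  have V0: "0 \<le> V" using Cg t1 by (simp add: V_def)
  have U0: "0 \<le> U" unfolding U_def by (rule mult_nonneg_nonneg[OF Ce0 kappa0])
  have p: "0 \<le> p" "p < q" using c by (simp_all add: p_def)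
  have u: "cmod (\<Sum>k\<le>j. fps_nth e (j - k) * - (1 / d ^ Suc k)) \<le> U * q ^ j" for j
    unfolding U_def by (rule top_vector_bound[OF e_le Ce0 d])
  have v: "cmod (\<Sum>k\<le>i. - (1 / c ^ (n - k)) * fps_nth g (i - k)) \<le> V * p ^ (n - i)" if "i < n" for n i
    using bottom_vector_bound[OF Cg(2) c that sc] by (simp add: V_def p_def mult.commute)
  \<comment> \<open>The general scheme with limit \<open>w = 0\<close>, whence the term
    \<open>E * 0\<close>.\<close>
  have "(\<lambda>n. W f g n (\<lambda>k. - (1 / d ^ Suc k)) (\<lambda>k. - (1 / c ^ (n - k))) - E * 0) \<in> O(\<lambda>n. complex_of_real q ^ n)"
  proof (rule W_bigo[OF fg lim v u])
    show "(\<Sum>i<n. V * p ^ (n - i) * q ^ i) * (\<Sum>j<n. U * q ^ j * q ^ j)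
        \<le> (V * (q / (q - p)) * (U / (1 - q))) * q ^ n" for n
    proof -
      have "(\<Sum>i<n. V * p ^ (n - i) * q ^ i) * (\<Sum>j<n. U * q ^ j * q ^ j)
          \<le> (V * (q / (q - p)) * q ^ n) * (U / (1 - q))"
        using V0 U0 p q0 q1
        by (intro mult_mono bottom_weight_le top_weight_le sum_nonneg mult_nonneg_nonneg divide_nonneg_nonneg) auto
      then show ?thesis by (simp only: mult_ac)
    qed
    show "(\<lambda>n. (\<Sum>i<n. (\<Sum>k\<le>i. - (1 / c ^ (n - k)) * fps_nth g (i - k)) *
        (\<Sum>k\<le>i. fps_nth e (i - k) * - (1 / d ^ Suc k))) - 0) \<in> O(\<lambda>n. complex_of_real q ^ n)"
      using top_bottom_product_bigo[OF U0 V0 p u v] by (simp only: mult.commute diff_0_right)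
  qed
  then show ?thesis by simp
qed

lemma W_bottom_top_bigo:
  assumes fg: "decays f" "decays g" and lim: "(\<lambda>n. fdet n (idp (K f g))) \<longlonglongrightarrow> E"
    and d: "1 / cmod d < q" and c: "1 / cmod c < q"
    and sd: "(\<lambda>i. fps_nth e i * (1 / d) ^ i) sums X'"
  shows "(\<lambda>n. W f g n (\<lambda>k. - (1 / d ^ (n - k))) (\<lambda>k. - (1 / c ^ Suc k))) \<in> O(\<lambda>n. complex_of_real q ^ n)"
proof -
  obtain Cg where Cg: "0 \<le> Cg" "\<And>i. cmod (fps_nth g i) \<le> Cg * t ^ i" using fg(2) by (rule decaysE) blast
  define U where "U = Ce / (1 - t)"
  define V where "V = Cg * \<kappa>"
  define p where "p = 1 / cmod d"
  have U0: "0 \<le> U" using Ce0 t1 by (simp add: U_def)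
  have V0: "0 \<le> V" unfolding V_def by (rule mult_nonneg_nonneg[OF Cg(1) kappa0])
  have p: "0 \<le> p" "p < q" using d by (simp_all add: p_def)
  have v: "cmod (\<Sum>k\<le>j. - (1 / c ^ Suc k) * fps_nth g (j - k)) \<le> V * q ^ j" for j
    unfolding V_def using top_vector_bound[OF Cg(2,1) c, of j] by (simp only: mult.commute)
  have u: "cmod (\<Sum>k\<le>i. fps_nth e (i - k) * - (1 / d ^ (n - k))) \<le> U * p ^ (n - i)" if "i < n" for n i
    using bottom_vector_bound[OF e_le d that sd] by (simp add: U_def p_def)
  have "(\<lambda>n. W f g n (\<lambda>k. - (1 / d ^ (n - k))) (\<lambda>k. - (1 / c ^ Suc k)) - E * 0) \<in> O(\<lambda>n. complex_of_real q ^ n)"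
  proof (rule W_bigo[OF fg lim v u])
    show "(\<Sum>i<n. V * q ^ i * q ^ i) * (\<Sum>j<n. U * p ^ (n - j) * q ^ j)
        \<le> (V / (1 - q) * (U * (q / (q - p)))) * q ^ n" for n
    proof -
      have "(\<Sum>i<n. V * q ^ i * q ^ i) * (\<Sum>j<n. U * p ^ (n - j) * q ^ j)
          \<le> (V / (1 - q)) * (U * (q / (q - p)) * q ^ n)"
        using V0 U0 p q0 q1
        by (intro mult_mono bottom_weight_le top_weight_le sum_nonneg mult_nonneg_nonneg divide_nonneg_nonneg) auto
      then show ?thesis by (simp only: mult_ac)
    qed
    show "(\<lambda>n. (\<Sum>i<n. (\<Sum>k\<le>i. - (1 / c ^ Suc k) * fps_nth g (i - k)) *
        (\<Sum>k\<le>i. fps_nth e (i - k) * - (1 / d ^ (n - k)))) - 0) \<in> O(\<lambda>n. complex_of_real q ^ n)"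
      using top_bottom_product_bigo[OF V0 U0 p v u] by (simp only: diff_0_right)
  qed
  then show ?thesis by simp
qed

text \<open>With \<open>z = 1 / (c * d)\<close> this is a sum of \<open>z ^ (n - i)\<close> weighted
  by \<open>x i * y i\<close>. The weights are close to \<open>X' * Y\<close> where the powers are
  large, so replacing them costs \<open>O(q ^ n)\<close>; the geometric sum tends to
  \<open>z / (1 - z)\<close>, which is \<open>1 / (c * d - 1)\<close>.\<close>

lemma bottom_bottom_product_bigo:
  assumes cd: "c \<noteq> 0" "d \<noteq> 0" and p: "1 / cmod d < q" "1 / cmod c < q"
    and xX: "\<And>i. cmod (x i - X') \<le> C * t ^ i" and yY: "\<And>i. cmod (y i - Y) \<le> C' * t ^ i"
    and x: "\<And>i. cmod (x i) \<le> C" and Y: "cmod Y \<le> C'"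
  shows "(\<lambda>n. (\<Sum>i<n. (- ((1 / c) ^ (n - i)) * y i) * (- ((1 / d) ^ (n - i)) * x i)) - X' * Y / (c * d - 1))
    \<in> O(\<lambda>n. complex_of_real q ^ n)"
proof -
  define z where "z = 1 / (c * d)"
  define p where "p = 1 / cmod c"
  have p0: "0 \<le> p" "p < q" using p by (simp_all add: p_def)
  have C: "0 \<le> C" using x[of 0] by (rule order_trans[OF norm_ge_zero])
  have C': "0 \<le> C'" using Y by (rule order_trans[OF norm_ge_zero])
  have zp: "cmod z \<le> p"
  proof -
    have "cmod z = p * (1 / cmod d)" by (simp add: z_def p_def norm_divide norm_mult)
    also have "\<dots> \<le> p * 1" using p0 p(1) q1 by (intro mult_left_mono) auto
    finally show ?thesis by simp
  qed
  then have zq: "cmod z < q" "cmod z < 1" using p0 q1 by auto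
  have z1: "z \<noteq> 1" using zq by auto
  have zz: "z / (1 - z) = 1 / (c * d - 1)"
    using cd z1 by (simp add: z_def field_simps)
  define r where "r i = x i * y i - X' * Y" for i
  have r: "cmod (r i) \<le> 2 * C * C' * q ^ i" for i
  proof -
    have "r i = x i * (y i - Y) + (x i - X') * Y" by (simp add: r_def algebra_simps)
    then have "cmod (r i) \<le> cmod (x i) * cmod (y i - Y) + cmod (x i - X') * cmod Y"
      using norm_triangle_ineq[of "x i * (y i - Y)" "(x i - X') * Y"] by (simp add: norm_mult)
    also have "\<dots> \<le> C * (C' * t ^ i) + (C * t ^ i) * C'"
      using C C' t0 by (intro add_mono mult_mono x Y xX yY) auto
    also have "\<dots> = 2 * C * C' * t ^ i" by simp
    also have "\<dots> \<le> 2 * C * C' * q ^ i" using C C' by (intro mult_left_mono t_le_q) auto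
    finally show ?thesis .
  qed
  have rem: "(\<lambda>n. \<Sum>i<n. r i * z ^ (n - i)) \<in> O(\<lambda>n. complex_of_real q ^ n)"
  proof (rule top_bottom_product_bigo[of "2 * C * C'" 1 p])
    show "cmod (z ^ (n - i)) \<le> 1 * p ^ (n - i)" for n i
      using zp by (simp add: norm_power power_mono)
  qed (use C C' p0 r in auto)
  have geo: "(\<lambda>n. (\<Sum>i<n. z ^ (n - i)) - 1 / (c * d - 1)) \<in> O(\<lambda>n. complex_of_real q ^ n)"
  proof (rule bigo_q)
    fix n
    have "(\<Sum>i<n. z ^ (n - i)) = (\<Sum>i<n. z ^ (n - (n - Suc i)))"
      by (rule sum.nat_diff_reindex[symmetric])
    also have "\<dots> = (\<Sum>i<n. z * z ^ i)"
    proof (rule sum.cong[OF refl])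
      fix i assume "i \<in> {..<n}"
      then have "n - (n - Suc i) = Suc i" by simp
      then show "z ^ (n - (n - Suc i)) = z * z ^ i" by simp
    qed
    also have "\<dots> = z * ((1 - z ^ n) / (1 - z))"
      unfolding sum_distrib_left[symmetric] using z1 by (subst sum_gp_strict) simp
    finally have "(\<Sum>i<n. z ^ (n - i)) = z * ((1 - z ^ n) / (1 - z))" .
    moreover have "z * ((1 - z ^ n) / (1 - z)) - z / (1 - z) = - (z / (1 - z)) * z ^ n"
      by (simp add: right_diff_distrib diff_divide_distrib)
    ultimately have "(\<Sum>i<n. z ^ (n - i)) - 1 / (c * d - 1) = - (z / (1 - z)) * z ^ n"
      unfolding zz[symmetric] by (simp only:)
    then have "cmod ((\<Sum>i<n. z ^ (n - i)) - 1 / (c * d - 1)) = cmod (z / (1 - z)) * cmod z ^ n"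
      by (simp only: norm_mult norm_power norm_minus_cancel)
    also have "\<dots> \<le> cmod (z / (1 - z)) * q ^ n"
      using zq by (intro mult_left_mono power_mono) auto
    finally show "cmod ((\<Sum>i<n. z ^ (n - i)) - 1 / (c * d - 1)) \<le> cmod (z / (1 - z)) * q ^ n" .
  qed
  have "(\<lambda>n. (\<Sum>i<n. r i * z ^ (n - i)) + X' * Y * ((\<Sum>i<n. z ^ (n - i)) - 1 / (c * d - 1)))
      \<in> O(\<lambda>n. complex_of_real q ^ n)"
    using rem geo by (intro sum_in_bigo) (cases "X' * Y = 0", auto)
  also have "(\<lambda>n. (\<Sum>i<n. r i * z ^ (n - i)) + X' * Y * ((\<Sum>i<n. z ^ (n - i)) - 1 / (c * d - 1)))
      = (\<lambda>n. (\<Sum>i<n. (- ((1 / c) ^ (n - i)) * y i) * (- ((1 / d) ^ (n - i)) * x i)) - X' * Y / (c * d - 1))"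
  proof
    fix n
    have "(\<Sum>i<n. (- ((1 / c) ^ (n - i)) * y i) * (- ((1 / d) ^ (n - i)) * x i))
        = (\<Sum>i<n. r i * z ^ (n - i) + X' * Y * z ^ (n - i))"
      by (rule sum.cong[OF refl])
         (simp add: r_def z_def power_divide power_mult_distrib field_simps cd)
    also have "\<dots> = (\<Sum>i<n. r i * z ^ (n - i)) + X' * Y * (\<Sum>i<n. z ^ (n - i))"
      by (simp only: sum.distrib sum_distrib_left)
    finally show "(\<Sum>i<n. r i * z ^ (n - i)) + X' * Y * ((\<Sum>i<n. z ^ (n - i)) - 1 / (c * d - 1))
      = (\<Sum>i<n. (- ((1 / c) ^ (n - i)) * y i) * (- ((1 / d) ^ (n - i)) * x i)) - X' * Y / (c * d - 1)"
      by (simp add: right_diff_distrib)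
  qed
  finally show ?thesis .
qed

lemma W_bottom_bottom_bigo:
  assumes fg: "decays f" "decays g" and lim: "(\<lambda>n. fdet n (idp (K f g))) \<longlonglongrightarrow> E"
    and cd: "c \<noteq> 0" "d \<noteq> 0" and d: "1 / cmod d < q" and c: "1 / cmod c < q"
    and sd: "(\<lambda>i. fps_nth e i * (1 / d) ^ i) sums X'" and sc: "(\<lambda>i. fps_nth g i * (1 / c) ^ i) sums Y"
  shows "(\<lambda>n. W f g n (\<lambda>k. - (1 / d ^ (n - k))) (\<lambda>k. - (1 / c ^ (n - k))) - E * (X' * Y / (c * d - 1)))
    \<in> O(\<lambda>n. complex_of_real q ^ n)"
proof -
  obtain Cg where Cg: "0 \<le> Cg" "\<And>i. cmod (fps_nth g i) \<le> Cg * t ^ i" using fg(2) by (rule decaysE) blast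
  define U where "U = Ce / (1 - t)"
  define V where "V = Cg / (1 - t)"
  define p where "p = 1 / cmod c"
  define r where "r = 1 / cmod d"
  have V0: "0 \<le> V" and U0: "0 \<le> U" and p: "0 \<le> p" "p < q" and r: "0 \<le> r" "r < q"
    using Cg Ce0 t1 d c unfolding V_def U_def p_def r_def by auto
  have z: "cmod (1 / d) \<le> 1" "cmod (1 / c) \<le> 1" using d c q1 by (simp_all add: norm_divide)
  have u: "cmod (\<Sum>k\<le>i. fps_nth e (i - k) * - (1 / d ^ (n - k))) \<le> U * r ^ (n - i)" if "i < n" for n i
    using bottom_vector_bound[OF e_le d that sd] by (simp add: U_def r_def)
  have v: "cmod (\<Sum>k\<le>i. - (1 / c ^ (n - k)) * fps_nth g (i - k)) \<le> V * p ^ (n - i)" if "i < n" for n i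
    using bottom_vector_bound[OF Cg(2) c that sc] by (simp add: V_def p_def mult.commute)
  show ?thesis
  proof (rule W_bigo[OF fg lim v u])
    show "(\<Sum>i<n. V * p ^ (n - i) * q ^ i) * (\<Sum>j<n. U * r ^ (n - j) * q ^ j)
        \<le> (V * (q / (q - p)) * (U * (q / (q - r)))) * q ^ n" for n
    proof -
      have "(\<Sum>i<n. V * p ^ (n - i) * q ^ i) * (\<Sum>j<n. U * r ^ (n - j) * q ^ j)
          \<le> (V * (q / (q - p)) * q ^ n) * (U * (q / (q - r)) * 1)"
      proof (rule mult_mono[OF bottom_weight_le[OF V0 p] order_trans[OF bottom_weight_le[OF U0 r]]])
        show "U * (q / (q - r)) * q ^ n \<le> U * (q / (q - r)) * 1"
          using U0 r q0 q1 by (intro mult_left_mono power_le_one mult_nonneg_nonneg divide_nonneg_nonneg) auto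
      qed (use V0 U0 p r q0 q1 in \<open>auto intro!: mult_nonneg_nonneg divide_nonneg_nonneg sum_nonneg simp del: times_divide_eq_right\<close>)
      then show ?thesis by (simp only: mult_ac mult_1_right)
    qed
    let ?x = "\<lambda>i. \<Sum>k\<le>i. fps_nth e k * (1 / d) ^ k" and ?y = "\<lambda>i. \<Sum>k\<le>i. fps_nth g k * (1 / c) ^ k"
    have "(\<lambda>n. (\<Sum>i<n. (- ((1 / c) ^ (n - i)) * ?y i) * (- ((1 / d) ^ (n - i)) * ?x i)) - X' * Y / (c * d - 1))
        \<in> O(\<lambda>n. complex_of_real q ^ n)"
      by (rule bottom_bottom_product_bigo[OF cd d c])
         (rule partial_sum_bound[OF t0 t1 e_le z(1) sd] partial_sum_bound[OF t0 t1 Cg(2) z(2) sc])+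
    also have "(\<lambda>n. (\<Sum>i<n. (- ((1 / c) ^ (n - i)) * ?y i) * (- ((1 / d) ^ (n - i)) * ?x i)) - X' * Y / (c * d - 1))
      = (\<lambda>n. (\<Sum>i<n. (\<Sum>k\<le>i. - (1 / c ^ (n - k)) * fps_nth g (i - k)) *
        (\<Sum>k\<le>i. fps_nth e (i - k) * - (1 / d ^ (n - k)))) - X' * Y / (c * d - 1))"
    proof (intro ext arg_cong2[where f = "(-)"] sum.cong refl arg_cong2[where f = "(*)"])
      fix n i :: nat assume "i \<in> {..<n}"
      then have i: "i < n" by simp
      show "- ((1 / c) ^ (n - i)) * ?y i = (\<Sum>k\<le>i. - (1 / c ^ (n - k)) * fps_nth g (i - k))"
        using bottom_convolution[OF i, of "fps_nth g" c] by (simp only: mult.commute)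
      show "- ((1 / d) ^ (n - i)) * ?x i = (\<Sum>k\<le>i. fps_nth e (i - k) * - (1 / d ^ (n - k)))"
        by (rule bottom_convolution[OF i, symmetric])
    qed
    finally show "(\<lambda>n. (\<Sum>i<n. (\<Sum>k\<le>i. - (1 / c ^ (n - k)) * fps_nth g (i - k)) *
        (\<Sum>k\<le>i. fps_nth e (i - k) * - (1 / d ^ (n - k)))) - X' * Y / (c * d - 1))
        \<in> O(\<lambda>n. complex_of_real q ^ n)" .
  qed
qed

end

section \<open>Asymptotics of semi-framed determinants\<close>

lemma szego_asympI:
  fixes X Y :: "nat \<Rightarrow> complex"
  assumes G: "G \<noteq> 0" and E: "E \<noteq> 0" and X: "\<And>n. 1 \<le> n \<Longrightarrow> X n = G ^ n * Y n"
    and Y: "(\<lambda>n. Y n - E * s) \<in> O(\<lambda>n. inverse (of_real \<rho>) ^ n)"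
  shows "szego_asymp X G E s \<rho>"
  unfolding szego_asymp_def
proof (intro bexI[of _ "\<lambda>n. (Y n - E * s) / E"] allI impI)
  show "(\<lambda>n. (Y n - E * s) / E) \<in> O(\<lambda>n. inverse (of_real \<rho>) ^ n)"
    using Y E by simp
  show "X n = G ^ n * E * (s + (Y n - E * s) / E)" if "1 \<le> n" for n
    using E by (simp add: X[OF that] field_simps)
qed

section \<open>The symbol as an instance of the abstract factorization\<close>

text \<open>\<open>s > \<rho>\<close> leaves room beyond the closed annulus. The condition
  \<open>Q 0 = 0\<close> puts the constant term of the logarithm into \<open>P\<close>, so that the
  geometric mean is \<open>exp (P 0)\<close>.\<close>

locale szego_factorization =
  fixes \<phi> :: "complex \<Rightarrow> complex" and \<rho> s :: real and P Q :: "complex \<Rightarrow> complex"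
  assumes rho: "1 < \<rho>" "\<rho> < s" and P: "P holomorphic_on ball 0 s" and Q: "Q holomorphic_on ball 0 s" "Q 0 = 0"
    and log: "\<And>z. z \<in> sphere 0 1 \<Longrightarrow> log_symbol \<phi> z = P z + Q (inverse z)"
    and phi: "\<And>z. z \<in> sphere 0 1 \<Longrightarrow> \<phi> z = exp (P z + Q (inverse z))"
begin

lemma s1: "1 < s" and s0: "0 < s" using rho by simp_all

text \<open>\<open>1 / t\<close> is the midpoint of \<rho> and \<open>s\<close>: Cauchy estimates on
  that circle give the rate \<open>t\<close>, strictly below \<open>inverse \<rho>\<close>.\<close>

definition "t = 2 / (\<rho> + s)"
definition "b = fps_expansion (\<lambda>z. exp (P z - P 0)) 0"
definition "e = fps_expansion (\<lambda>z. exp (P 0 - P z)) 0"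
text \<open>A one-parameter group in \<open>x\<close>. The matrices involve \<open>F 1\<close> and
  its inverse \<open>F (- 1)\<close>; the other members serve to compute the limit.\<close>

definition "F x = fps_expansion (\<lambda>u. exp (x * Q u)) 0"

lemma hol_b: "(\<lambda>z. exp (P z - P 0)) holomorphic_on ball 0 s" and hol_e: "(\<lambda>z. exp (P 0 - P z)) holomorphic_on ball 0 s"
  and hol_F: "(\<lambda>u. exp (x * Q u)) holomorphic_on ball 0 s"
  by (intro holomorphic_intros P Q)+

lemma t: "0 < t" "t < inverse \<rho>" "0 < 1 / t" "1 / t < s" "1 / (1 / t) = t"
  using rho by (simp_all add: t_def field_simps)

lemma decay:
  assumes "f holomorphic_on ball 0 s"
  obtains C where "\<And>n. cmod (fps_nth (fps_expansion f 0) n) \<le> C * t ^ n"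
  by (rule fps_expansion_decay[OF assms t(3,4)]) (use that t(5) in auto)

lemma be: "b * e = 1"
proof -
  have "b * e = fps_expansion (\<lambda>z. exp (P z - P 0) * exp (P 0 - P z)) 0"
    unfolding b_def e_def by (rule fps_expansion_mult[OF hol_b hol_e s0, symmetric])
  also have "(\<lambda>z. exp (P z - P 0) * exp (P 0 - P z)) = (\<lambda>_. 1)"
    by (simp add: exp_add[symmetric])
  also have "fps_expansion (\<lambda>_. 1) 0 = 1" by (intro fps_expansion_eqI) simp
  finally show ?thesis .
qed

lemma F_add: "F (x + y) = F x * F y"
proof -
  have "F x * F y = fps_expansion (\<lambda>u. exp (x * Q u) * exp (y * Q u)) 0"
    unfolding F_def by (rule fps_expansion_mult[OF hol_F hol_F s0, symmetric])
  then show ?thesis by (simp add: F_def exp_add[symmetric] distrib_right)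
qed

lemma F_0: "F 0 = 1"
  unfolding F_def by (intro fps_expansion_eqI) simp

lemma F_nth_0: "fps_nth (F x) 0 = 1"
  by (simp add: F_def fps_expansion_def Q)

lemma deriv_b: "fps_deriv b = fps_deriv (fps_expansion P 0) * b"
proof -
  have "deriv (\<lambda>z. exp (P z - P 0)) has_fps_expansion fps_deriv b"
    unfolding b_def by (intro has_fps_expansion_deriv has_fps_expansion_ball[OF hol_b s0])
  moreover have "(\<lambda>z. deriv P z * exp (P z - P 0)) has_fps_expansion fps_deriv (fps_expansion P 0) * b"
    unfolding b_def
    by (intro has_fps_expansion_mult has_fps_expansion_deriv has_fps_expansion_ball[OF hol_b s0] has_fps_expansion_ball[OF P s0])
  moreover have "\<forall>\<^sub>F z in nhds (0::complex). deriv (\<lambda>z. exp (P z - P 0)) z = deriv P z * exp (P z - P 0)"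
  proof (rule eventually_nhds_in_open[of "ball 0 s" "0::complex", THEN eventually_mono])
    fix z :: complex assume z: "z \<in> ball 0 s"
    have "(P has_field_derivative deriv P z) (at z)"
      by (rule holomorphic_derivI[OF P open_ball z])
    then have "((\<lambda>z. exp (P z - P 0)) has_field_derivative exp (P z - P 0) * (deriv P z - 0)) (at z)"
      by (intro DERIV_fun_exp DERIV_diff DERIV_const)
    then show "deriv (\<lambda>z. exp (P z - P 0)) z = deriv P z * exp (P z - P 0)"
      by (simp add: DERIV_imp_deriv mult.commute)
  qed (use s0 in auto)
  ultimately show ?thesis
    using has_fps_expansion_cong fps_expansion_unique_complex by metis
qed

lemma log_coeff: "fourier_coeff (log_symbol \<phi>) j =
    (if 0 \<le> j then fps_nth (fps_expansion P 0) (nat j) else 0) + (if j \<le> 0 then fps_nth (fps_expansion Q 0) (nat (- j)) else 0)"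
proof -
  have "fourier_coeff (log_symbol \<phi>) j = fourier_coeff (\<lambda>z. P z + Q (inverse z)) j"
    by (rule fourier_coeff_cong) (rule log)
  also have "\<dots> = fourier_coeff P j + fourier_coeff (\<lambda>z. Q (inverse z)) j"
    by (rule fourier_coeff_add[OF continuous_on_sphere_ball[OF s1 P] continuous_on_sphere_ball_inverse[OF s1 Q(1)]])
  finally show ?thesis by (simp only: fourier_coeff_holomorphic[OF s1 P] fourier_coeff_inverse[OF s1 Q(1)])
qed

lemma szego_G: "szego_G \<phi> = exp (P 0)"
  unfolding szego_G_def log_coeff by (simp add: fps_expansion_def Q)

lemma szego_E: "szego_E \<phi> = exp (\<Sum>p. of_nat (Suc p) * fps_nth (fps_expansion P 0) (Suc p) * fps_nth (fps_expansion Q 0) (Suc p))"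
  unfolding szego_E_def log_coeff by (simp del: of_nat_Suc)

lemma szego_alpha:
  assumes "z \<notin> sphere 0 1"
  shows "szego_alpha \<phi> z = (if 1 < cmod z then exp (- Q (inverse z)) else exp (P z))"
  using Cauchy_integral_Laurent[OF s1 P Q log assms] unfolding szego_alpha_def
  by (cases "1 < cmod z") (simp_all only: if_True if_False)

lemma phi_coeff:
  "fourier_coeff \<phi> (int i - int j) =
    szego_G \<phi> * (\<Sum>m. (if j \<le> i + m then fps_nth b (i + m - j) else 0) * fps_nth (F 1) m)"
proof -
  let ?h = "\<lambda>z. exp (P z - P 0)"
  have ch: "continuous_on (sphere 0 1) ?h" by (rule continuous_on_sphere_ball[OF s1 hol_b])
  have cF: "continuous_on (sphere 0 1) (\<lambda>z. exp (1 * Q (inverse z)))"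
    by (rule continuous_on_sphere_ball_inverse[OF s1 hol_F])
  have "fourier_coeff \<phi> (int i - int j) = fourier_coeff (\<lambda>z. exp (P 0) * (?h z * exp (1 * Q (inverse z)))) (int i - int j)"
    by (rule fourier_coeff_cong) (simp add: phi exp_add[symmetric] algebra_simps)
  also have "\<dots> = exp (P 0) * fourier_coeff (\<lambda>z. ?h z * exp (1 * Q (inverse z))) (int i - int j)"
    by (intro fourier_coeff_cmult continuous_on_mult ch cF)
  also have "fourier_coeff (\<lambda>z. ?h z * exp (1 * Q (inverse z))) (int i - int j)
      = (\<Sum>m. fps_nth (F 1) m * fourier_coeff ?h (int i - int j + int m))"
    unfolding F_def by (rule sums_unique[OF fourier_coeff_holomorphic_inverse[OF s1 hol_F ch]])
  also have "\<dots> = (\<Sum>m. (if j \<le> i + m then fps_nth b (i + m - j) else 0) * fps_nth (F 1) m)"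
  proof (rule suminf_cong)
    fix m
    have "fourier_coeff ?h (int i - int j + int m) = (if j \<le> i + m then fps_nth b (i + m - j) else 0)"
    proof (cases "j \<le> i + m")
      case True
      then have eq: "int i - int j + int m = int (i + m - j)" by simp
      show ?thesis
        unfolding eq fourier_coeff_holomorphic[OF s1 hol_b] b_def using True
        by (simp only: of_nat_0_le_iff nat_int if_True)
    next
      case False
      then have "\<not> 0 \<le> int i - int j + int m" by simp
      then show ?thesis using False fourier_coeff_holomorphic[OF s1 hol_b, of "int i - int j + int m"] by simp
    qed
    then show "fps_nth (F 1) m * fourier_coeff ?h (int i - int j + int m)
        = (if j \<le> i + m then fps_nth b (i + m - j) else 0) * fps_nth (F 1) m" by simp
  qed
  finally show ?thesis by (simp add: szego_G)
qed

lemma wiener_hopf_exists: "\<exists>Cb Ce. wiener_hopf t (inverse \<rho>) b e Cb Ce"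
proof -
  obtain Cb where Cb: "\<And>n. cmod (fps_nth b n) \<le> Cb * t ^ n" unfolding b_def by (rule decay[OF hol_b]) blast
  obtain Ce where Ce: "\<And>n. cmod (fps_nth e n) \<le> Ce * t ^ n" unfolding e_def by (rule decay[OF hol_e]) blast
  have "wiener_hopf t (inverse \<rho>) b e Cb Ce"
    by unfold_locales (use t rho be Cb Ce in \<open>auto simp: b_def fps_expansion_def inverse_less_1_iff\<close>)
  then show ?thesis by blast
qed

text \<open>Closed terms for the constants whose existence has just been shown, as the sublocale
  requires.\<close>

definition "Cb = (SOME Cb. \<exists>Ce. wiener_hopf t (inverse \<rho>) b e Cb Ce)"
definition "Ce = (SOME Ce. wiener_hopf t (inverse \<rho>) b e Cb Ce)"

sublocale wiener_hopf t "inverse \<rho>" b e Cb Ce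
  unfolding Ce_def by (rule someI_ex, unfold Cb_def, rule someI_ex, rule wiener_hopf_exists)

lemma decays_expansion: "f holomorphic_on ball 0 s \<Longrightarrow> decays (fps_expansion f 0)"
  unfolding decays_def by (rule decay[of f]) auto

lemma decays_F: "decays (F x)"
  unfolding F_def by (rule decays_expansion[OF hol_F])

lemma FF: "F 1 * F (- 1) = 1"
  using F_add[of 1 "- 1"] F_0 by simp

lemma fdet_limit: "(\<lambda>n. fdet n (idp (K (F 1) (F (- 1))))) \<longlonglongrightarrow> szego_E \<phi>"
proof -
  obtain M where M: "0 \<le> M"
    "\<And>x i. cmod x \<le> 1 \<Longrightarrow> 1 \<le> i \<Longrightarrow> cmod (fps_nth (F x) i) \<le> M * cmod x * t ^ i"
    "\<And>x i. cmod x \<le> 1 \<Longrightarrow> 1 \<le> i \<Longrightarrow>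
      cmod (fps_nth (F x) i - x * fps_nth (fps_expansion Q 0) i) \<le> M * (cmod x)\<^sup>2 * t ^ i"
    by (rule fps_expansion_exp_scaled[OF Q t(3,4)]) (unfold F_def[symmetric] t(5), rule that)
  obtain C where C: "\<And>n. cmod (fps_nth (fps_expansion Q 0) n) \<le> C * t ^ n" by (rule decay[OF Q(1)]) blast
  show ?thesis
    unfolding szego_E
    by (rule fdet_K_limit_exp[OF F_add F_0 decays_F F_nth_0 M deriv_b C])
qed

lemma semi_framed_det:
  assumes n: "1 \<le> n"
  shows "Determinant.det (semi_framed_mat \<phi> u v a (n + 1)) = szego_G \<phi> ^ n *
    (a * fdet n (idp (K (F 1) (F (- 1)))) - W (F 1) (F (- 1)) n u v / szego_G \<phi>)"
proof -
  have "Determinant.det (semi_framed_mat \<phi> u v a (n + 1))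
      = fdet (Suc n) (\<lambda>i j. if i < n \<and> j < n then fourier_coeff \<phi> (int i - int j)
          else if i < n then u i else if j < n then v j else a)"
    unfolding semi_framed_mat_def fdet_def Suc_eq_plus1 add_diff_cancel_right' ..
  also have "\<dots> = szego_G \<phi> ^ n *
      (a * fdet n (idp (K (F 1) (F (- 1)))) - W (F 1) (F (- 1)) n u v / szego_G \<phi>)"
    unfolding W_def by (rule bordered_toeplitz[OF decays_F FF F_nth_0 _ n phi_coeff]) (simp add: szego_G)
  finally show ?thesis .
qed

text \<open>By bilinearity of \<open>W\<close> single pairs of poles suffice; \<open>w l m\<close>
  is the limit of a pair divided by \<open>szego_E \<phi>\<close>. The borders may depend on
  \<open>n\<close>, as those read backwards do.\<close>

lemma semi_framed_asymp:
  fixes u v :: "'i \<Rightarrow> nat \<Rightarrow> nat \<Rightarrow> complex"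
  assumes fin: "finite I" "finite J"
    and Z: "\<And>n. 1 \<le> n \<Longrightarrow> Z n = Determinant.det (semi_framed_mat \<phi>
      (\<lambda>k. \<Sum>l\<in>I. A l * u l n k) (\<lambda>k. \<Sum>m\<in>J. C m * v m n k) a (n + 1))"
    and W: "\<And>l m. l \<in> I \<Longrightarrow> m \<in> J \<Longrightarrow>
      (\<lambda>n. W (F 1) (F (- 1)) n (u l n) (v m n) - szego_E \<phi> * w l m) \<in> O(\<lambda>n. inverse (of_real \<rho>) ^ n)"
  shows "szego_asymp Z (szego_G \<phi>) (szego_E \<phi>) (a - (\<Sum>l\<in>I. \<Sum>m\<in>J. A l * C m * w l m) / szego_G \<phi>) \<rho>"
proof (rule szego_asympI)
  show G0: "szego_G \<phi> \<noteq> 0" and "szego_E \<phi> \<noteq> 0" by (simp_all add: szego_G szego_E)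
  let ?D = "\<lambda>n. fdet n (idp (K (F 1) (F (- 1))))" and ?G = "szego_G \<phi>" and ?E = "szego_E \<phi>"
  let ?W = "\<lambda>n. \<Sum>l\<in>I. \<Sum>m\<in>J. A l * C m * W (F 1) (F (- 1)) n (u l n) (v m n)"
  show "Z n = ?G ^ n * (a * ?D n - ?W n / ?G)" if "1 \<le> n" for n
    by (simp only: Z[OF that] semi_framed_det[OF that] W_sum)
  have 1: "(\<lambda>n. a * (?D n - ?E)) \<in> O(\<lambda>n. inverse (of_real \<rho>) ^ n)"
    using fdet_K_bigo[OF decays_F decays_F fdet_limit] by (cases "a = 0") auto
  have 2: "(\<lambda>n. \<Sum>l\<in>I. \<Sum>m\<in>J. A l * C m * (W (F 1) (F (- 1)) n (u l n) (v m n) - ?E * w l m))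
      \<in> O(\<lambda>n. inverse (of_real \<rho>) ^ n)"
  proof (intro big_sum_in_bigo)
    fix l m assume "l \<in> I" "m \<in> J"
    from W[OF this] show "(\<lambda>n. A l * C m * (W (F 1) (F (- 1)) n (u l n) (v m n) - ?E * w l m))
        \<in> O(\<lambda>n. inverse (of_real \<rho>) ^ n)"
      by (cases "A l * C m = 0") auto
  qed
  have "(\<lambda>n. a * (?D n - ?E) - (\<Sum>l\<in>I. \<Sum>m\<in>J. A l * C m * (W (F 1) (F (- 1)) n (u l n) (v m n) - ?E * w l m)) / ?G)
      \<in> O(\<lambda>n. inverse (of_real \<rho>) ^ n)"
    using 2 G0 by (intro sum_in_bigo(2)[OF 1]) simp
  moreover have "a * (?D n - ?E) - (\<Sum>l\<in>I. \<Sum>m\<in>J. A l * C m * (W (F 1) (F (- 1)) n (u l n) (v m n) - ?E * w l m)) / ?G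
      = a * ?D n - ?W n / ?G - ?E * (a - (\<Sum>l\<in>I. \<Sum>m\<in>J. A l * C m * w l m) / ?G)" for n
    by (simp add: right_diff_distrib sum_subtractf sum_distrib_left diff_divide_distrib mult_ac)
  ultimately show "(\<lambda>n. a * ?D n - ?W n / ?G - ?E * (a - (\<Sum>l\<in>I. \<Sum>m\<in>J. A l * C m * w l m) / ?G))
      \<in> O(\<lambda>n. inverse (of_real \<rho>) ^ n)" by (simp only:)
qed

lemma expansion_sums_inverse:
  assumes "f holomorphic_on ball 0 s" "\<rho> < cmod d"
  shows "(\<lambda>i. fps_nth (fps_expansion f 0) i * (1 / d) ^ i) sums f (1 / d)"
proof (rule fps_expansion_sums[OF assms(1)])
  have "cmod (1 / d) < 1" using assms rho by (simp add: norm_divide divide_less_eq)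
  then show "cmod (1 / d) < s" using s1 by linarith
qed

lemma inverse_less_rho: "\<rho> < cmod d \<Longrightarrow> 1 / cmod d < inverse \<rho>"
  using rho by (simp add: inverse_eq_divide frac_less2)

end

section \<open>Existence of an admissible radius and of the factorization\<close>

lemma open_nonzero_set:
  assumes "open U" "f holomorphic_on U"
  shows "open {z \<in> U. f z \<noteq> (0::complex)}"
proof -
  have "open (U \<inter> f -` (- {0}))"
    using assms by (intro continuous_open_preimage holomorphic_on_imp_continuous_on) auto
  also have "U \<inter> f -` (- {0}) = {z \<in> U. f z \<noteq> 0}" by auto
  finally show ?thesis .
qed

text \<open>The continuation is nonzero on the circle, hence on some annulus around it; \<rho> is
  taken below its radius and below the finitely many bounds imposed by the poles.\<close>

lemma admissible_radius_exists:
  assumes \<phi>: "szego_type \<phi>" and \<Lambda>: "finite \<Lambda>" "\<And>w. w \<in> \<Lambda> \<Longrightarrow> cmod w \<noteq> 1"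
  shows "\<exists>\<rho>. admissible_radius \<phi> \<Lambda> \<rho>"
proof -
  obtain U F where U: "open U" "sphere 0 1 \<subseteq> U" "F holomorphic_on U" "\<And>z. z \<in> sphere 0 1 \<Longrightarrow> F z = \<phi> z"
    and nz: "\<And>z. z \<in> sphere 0 1 \<Longrightarrow> \<phi> z \<noteq> 0"
    using \<phi> unfolding szego_type_def by blast
  define V where "V = {z \<in> U. F z \<noteq> 0}"
  have V: "open V" unfolding V_def by (rule open_nonzero_set[OF U(1,3)])
  have "{z. inverse 1 \<le> cmod z \<and> cmod z \<le> 1} \<subseteq> V"
  proof
    fix z assume "z \<in> {z. inverse 1 \<le> cmod z \<and> cmod z \<le> 1}"
    then have z: "z \<in> sphere 0 1" by simp
    then show "z \<in> V" using U(2) U(4)[OF z] nz[OF z] by (auto simp: V_def)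
  qed
  then obtain R where R: "1 < R" "annulus R \<subseteq> V"
    using closed_annulus_subset_open[of 1 V] V by auto
  \<comment> \<open>\<open>w = 0\<close> is left out because \<open>inverse 0 = 0\<close> would
    spoil \<open>1 < Min T\<close>; the condition on it is just
    \<open>0 < inverse \<rho>\<close>.\<close>
  define T where "T = insert R (cmod ` {w \<in> \<Lambda>. 1 < cmod w} \<union> (\<lambda>w. inverse (cmod w)) ` {w \<in> \<Lambda>. cmod w < 1 \<and> w \<noteq> 0})"
  have T: "finite T" "T \<noteq> {}" using \<Lambda>(1) by (auto simp: T_def)
  have "1 < Min T"
    unfolding Min_gr_iff[OF T] using R(1) by (auto simp: T_def one_less_inverse_iff)
  then obtain \<rho> where \<rho>: "1 < \<rho>" "\<rho> < Min T" using dense by blast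
  have \<rho>T: "\<rho> < x" if "x \<in> T" for x using \<rho>(2) Min_gr_iff[OF T] that by blast
  have sub: "{z. inverse \<rho> \<le> cmod z \<and> cmod z \<le> \<rho>} \<subseteq> annulus R"
  proof
    fix z assume z: "z \<in> {z. inverse \<rho> \<le> cmod z \<and> cmod z \<le> \<rho>}"
    have "\<rho> < R" using \<rho>T[of R] by (simp add: T_def)
    then have "inverse R < inverse \<rho>" using \<rho>(1) by (intro less_imp_inverse_less) auto
    then show "z \<in> annulus R" using z \<open>\<rho> < R\<close> by auto
  qed
  have "admissible_radius \<phi> \<Lambda> \<rho>"
    unfolding admissible_radius_def
  proof (intro conjI ballI impI exI[of _ F] allI)
    show "1 < \<rho>" by (rule \<rho>(1))
    show "\<rho> < cmod w" if "w \<in> \<Lambda>" "1 < cmod w" for w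
      using that by (intro \<rho>T) (auto simp: T_def)
    show "cmod w < inverse \<rho>" if "w \<in> \<Lambda>" "cmod w < 1" for w
    proof (cases "w = 0")
      case False
      then have "\<rho> < inverse (cmod w)" using that by (intro \<rho>T) (auto simp: T_def)
      then have "inverse (inverse (cmod w)) < inverse \<rho>" using \<rho>(1) by (intro less_imp_inverse_less) auto
      then show ?thesis by simp
    qed (use \<rho>(1) in simp)
    show "F analytic_on {z. inverse \<rho> \<le> cmod z \<and> cmod z \<le> \<rho>}"
      unfolding analytic_on_holomorphic
      using U(1,3) sub R(2) by (intro exI[of _ U]) (auto simp: V_def)
    show "F z \<noteq> 0" if "inverse \<rho> \<le> cmod z \<and> cmod z \<le> \<rho>" for z
      using that sub R(2) by (auto simp: V_def)
    show "F z = \<phi> z" if "z \<in> sphere 0 1" for z by (rule U(4)[OF that])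
  qed
  then show ?thesis by blast
qed

lemma szego_factorization_exists:
  assumes \<phi>: "szego_type \<phi>" and \<rho>: "admissible_radius \<phi> \<Lambda> \<rho>"
  shows "\<exists>s P Q. szego_factorization \<phi> \<rho> s P Q"
proof -
  let ?K = "{z. inverse \<rho> \<le> cmod z \<and> cmod z \<le> \<rho>}"
  obtain F where \<rho>1: "1 < \<rho>" and F: "F analytic_on ?K" "\<And>z. z \<in> ?K \<Longrightarrow> F z \<noteq> 0"
    and F\<phi>: "\<And>z. z \<in> sphere 0 1 \<Longrightarrow> F z = \<phi> z"
    using \<rho> unfolding admissible_radius_def by auto
  obtain U where U: "open U" "?K \<subseteq> U" "F holomorphic_on U"
    using F(1) unfolding analytic_on_holomorphic by blast
  define V where "V = {z \<in> U. F z \<noteq> 0}"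
  have V: "open V" unfolding V_def by (rule open_nonzero_set[OF U(1,3)])
  have "?K \<subseteq> V" using U(2) F(2) by (auto simp: V_def)
  then obtain R where R: "\<rho> < R" "annulus R \<subseteq> V"
    using closed_annulus_subset_open[of \<rho> V] V \<rho>1 by auto
  have R1: "1 < R" using R \<rho>1 by simp
  have hF: "F holomorphic_on annulus R" and nF: "\<And>z. z \<in> annulus R \<Longrightarrow> F z \<noteq> 0"
    using U(3) R(2) by (auto simp: V_def intro: holomorphic_on_subset)
  have "F \<circ> circlepath 0 1 = \<phi> \<circ> circlepath 0 1"
    by (rule ext) (simp add: F\<phi> circlepath)
  then have "winding_number (F \<circ> circlepath 0 1) 0 = 0"
    using \<phi> by (simp add: szego_type_def)
  from holomorphic_log_annulus[OF R1 hF nF this]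
  obtain L where L: "L holomorphic_on annulus R" "\<And>z. z \<in> annulus R \<Longrightarrow> exp (L z) = F z" by blast
  have sub: "sphere 0 1 \<subseteq> annulus R" using R1 by (auto simp: inverse_less_1_iff)
  have cL: "continuous_on (sphere 0 1) L"
    by (rule continuous_on_subset[OF holomorphic_on_imp_continuous_on[OF L(1)] sub])
  have eL: "exp (L z) = \<phi> z" if "z \<in> sphere 0 1" for z
    using L(2) sub F\<phi>[OF that] that by auto
  have ls: "continuous_on (sphere 0 1) (log_symbol \<phi>) \<and> (\<forall>z \<in> sphere 0 1. exp (log_symbol \<phi> z) = \<phi> z)"
    unfolding log_symbol_def by (rule someI[of _ L]) (use cL eL in blast)
  \<comment> \<open>\<open>log_symbol\<close> is an arbitrary choice and may differ from the
    holomorphic \<open>L\<close> by a constant; the splitting is therefore applied to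
    \<open>L z + k\<close>.\<close>
  obtain k where k: "\<And>z. z \<in> sphere 0 1 \<Longrightarrow> log_symbol \<phi> z = L z + k"
    using continuous_logs_differ_by_constant[of "log_symbol \<phi>" L] ls cL eL by auto
  define s where "s = (\<rho> + R) / 2"
  have s: "1 < s" "\<rho> < s" "s < R" using R \<rho>1 by (simp_all add: s_def)
  have "(\<lambda>z. L z + k) holomorphic_on annulus R" by (intro holomorphic_intros L)
  from Laurent_decomposition[OF s(1,3) this]
  obtain P Q where PQ: "P holomorphic_on ball 0 s" "Q holomorphic_on ball 0 s" "Q 0 = 0"
    "\<And>z. z \<in> sphere 0 1 \<Longrightarrow> L z + k = P z + Q (inverse z)" by blast
  have "szego_factorization \<phi> \<rho> s P Q"
  proof
    show "log_symbol \<phi> z = P z + Q (inverse z)" if "z \<in> sphere 0 1" for z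
      using k[OF that] PQ(4)[OF that] by simp
    then show "\<phi> z = exp (P z + Q (inverse z))" if "z \<in> sphere 0 1" for z
      using ls that by simp
  qed (use \<rho>1 s PQ in auto)
  then show ?thesis by blast
qed

section \<open>Border coefficients and reversal of indices\<close>

lemma fourier_coeff_rational:
  fixes m :: nat
  assumes "\<And>j. j \<in> {1..m} \<Longrightarrow> d j \<notin> sphere 0 1"
  shows "fourier_coeff (\<lambda>z. \<Sum>j=1..m. A j / (z - d j)) (int k)
    = (\<Sum>j | j \<in> {1..m} \<and> 1 < cmod (d j). A j * - (1 / d j ^ Suc k))"
proof -
  have "fourier_coeff (\<lambda>z. \<Sum>j=1..m. A j / (z - d j)) (int k)
      = fourier_coeff (\<lambda>z. \<Sum>j=1..m. A j * (1 / (z - d j))) (int k)" by simp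
  also have "\<dots> = (\<Sum>j=1..m. A j * fourier_coeff (\<lambda>z. 1 / (z - d j)) (int k))"
    using assms by (intro fourier_coeff_sum) (auto intro!: continuous_intros)
  also have "\<dots> = (\<Sum>j=1..m. if 1 < cmod (d j) then A j * - (1 / d j ^ Suc k) else 0)"
    by (rule sum.cong[OF refl]) (simp only: fourier_coeff_pole[OF assms] mult_zero_right split: if_split, simp)
  also have "\<dots> = (\<Sum>j\<in>{j \<in> {1..m}. 1 < cmod (d j)}. A j * - (1 / d j ^ Suc k))"
    by (rule sum.inter_filter[symmetric]) simp
  finally show ?thesis by simp
qed

lemma det_semi_framed_cong:
  assumes "\<And>j. j < N - 1 \<Longrightarrow> u j = u' j" "\<And>k. k < N - 1 \<Longrightarrow> v k = v' k"
  shows "Determinant.det (semi_framed_mat \<phi> u v a N) = Determinant.det (semi_framed_mat \<phi> u' v' a N)"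
  unfolding semi_framed_mat_def using assms by (intro arg_cong[where f = Determinant.det] cong_mat) auto

text \<open>For \<open>N = n + 1\<close> the index \<open>N - 2 - k\<close> is
  \<open>n - 1 - k\<close>; a pole contributes the power one higher, \<open>n - k\<close>.\<close>

lemma reversed_index: "k < n \<Longrightarrow> int (n + 1) - 2 - int k = int (n - Suc k)" "k < n \<Longrightarrow> Suc (n - Suc k) = n - k"
  by auto

text \<open>Conjugation by a permutation matrix whose square is the identity; its determinant
  squares to \<open>1\<close>, so its sign need not be known.\<close>

lemma fdet_involution:
  assumes "\<And>i. i < n \<Longrightarrow> \<sigma> i < n" "\<And>i. i < n \<Longrightarrow> \<sigma> (\<sigma> i) = i"
  shows "fdet n (\<lambda>i j. M (\<sigma> i) (\<sigma> j)) = fdet n M"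
proof -
  define J where "J i j = (if j = \<sigma> i then 1 else 0 :: complex)" for i j
  have J: "(\<Sum>k<n. J i k * A k) = A (\<sigma> i)" if "i < n" for i and A :: "nat \<Rightarrow> complex"
    using assms(1)[OF that] by (simp add: J_def if_distrib[of "\<lambda>x. x * _"] cong: if_cong)
  have J': "(\<Sum>k<n. A k * J k j) = A (\<sigma> j)" if "j < n" for j and A :: "nat \<Rightarrow> complex"
  proof -
    have "(\<Sum>k<n. A k * J k j) = (\<Sum>k<n. if k = \<sigma> j then A k else 0)"
    proof (rule sum.cong[OF refl])
      fix k assume "k \<in> {..<n}"
      then have "j = \<sigma> k \<longleftrightarrow> k = \<sigma> j" using assms(2)[of k] assms(2)[OF that] by auto
      then show "A k * J k j = (if k = \<sigma> j then A k else 0)" by (simp add: J_def)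
    qed
    then show ?thesis using assms(1)[OF that] by simp
  qed
  have "fdet n J * fdet n J = fdet n (upper 1)"
    unfolding fdet_mult by (rule fdet_cong) (simp add: J assms, simp add: J_def upper_1 assms)
  then have JJ: "fdet n J * fdet n J = 1" by (simp add: fdet_upper)
  have "fdet n J * (fdet n M * fdet n J) = fdet n (\<lambda>i j. M (\<sigma> i) (\<sigma> j))"
    unfolding fdet_mult by (rule fdet_cong) (simp add: J J' assms)
  moreover have "fdet n J * (fdet n M * fdet n J) = (fdet n J * fdet n J) * fdet n M" by (simp only: mult_ac)
  ultimately show ?thesis unfolding JJ by simp
qed

text \<open>Transposition turns \<open>i - j\<close> into \<open>j - i\<close> in the Toeplitz block
  and reversal turns it back. Transposition also exchanges the two borders, so \<psi> and \<eta>
  swap roles.\<close>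

lemma det_G_eq_det_E: "det_G (n + 1) \<phi> \<psi> \<eta> a = det_E (n + 1) \<phi> \<eta> \<psi> a"
proof -
  let ?G = "\<lambda>i j. if i < n \<and> j < n then fourier_coeff \<phi> (int i - int j)
      else if i < n then fourier_coeff \<psi> (int i) else if j < n then fourier_coeff \<eta> (int j) else a"
  let ?E = "\<lambda>i j. if i < n \<and> j < n then fourier_coeff \<phi> (int i - int j)
      else if i < n then fourier_coeff \<eta> (int (n + 1) - 2 - int i)
      else if j < n then fourier_coeff \<psi> (int (n + 1) - 2 - int j) else a"
  \<comment> \<open>Reverses the indices of the Toeplitz block and fixes the border index
    \<open>n\<close>.\<close>
  define \<sigma> where "\<sigma> i = (if i < n then n - Suc i else i)" for i
  have "det_G (n + 1) \<phi> \<psi> \<eta> a = fdet (n + 1) ?G"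
    unfolding det_G_def semi_framed_mat_def fdet_def add_diff_cancel_right' ..
  also have "\<dots> = fdet (n + 1) (\<lambda>i j. ?G j i)" by (rule fdet_transpose[symmetric])
  also have "\<dots> = fdet (n + 1) (\<lambda>i j. ?E (\<sigma> i) (\<sigma> j))"
    by (rule fdet_cong) (auto simp: \<sigma>_def of_nat_diff)
  also have "\<dots> = fdet (n + 1) ?E"
    by (rule fdet_involution) (auto simp: \<sigma>_def)
  also have "\<dots> = det_E (n + 1) \<phi> \<eta> \<psi> a"
    unfolding det_E_def semi_framed_mat_def fdet_def add_diff_cancel_right' ..
  finally show ?thesis .
qed

section \<open>The four asymptotic formulas\<close>

context szego_factorization
begin

text \<open>\<open>c\<close> and \<open>inverse d\<close> lie on different sides of the circle and
  select the two branches of \<open>szego_alpha\<close>. The factor \<open>exp (P 0)\<close> from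
  the normalization of \<open>e\<close> cancels against \<open>szego_G \<phi>\<close>, and the minus
  sign turns \<open>c * d - 1\<close> into \<open>1 - c * d\<close>.\<close>

lemma alpha_quotient:
  assumes c: "\<rho> < cmod c" and d: "\<rho> < cmod d"
  shows "szego_alpha \<phi> c / szego_alpha \<phi> (inverse d) * (1 / (1 - c * d))
    = - (exp (P 0 - P (1 / d)) * exp (- 1 * Q (1 / c)) / (c * d - 1)) / szego_G \<phi>"
proof -
  have c1: "1 < cmod c" and d1: "cmod (inverse d) < 1"
    using c d rho by (auto simp: norm_inverse inverse_less_1_iff)
  have "szego_alpha \<phi> c = exp (- Q (inverse c))" using c1 szego_alpha[of c] by simp
  moreover have "szego_alpha \<phi> (inverse d) = exp (P (inverse d))" using d1 szego_alpha[of "inverse d"] by simp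
  moreover have "1 / (1 - c * d) = - (1 / (c * d - 1))"
    by (metis minus_diff_eq minus_divide_right)
  ultimately show ?thesis
    by (simp add: szego_G exp_diff inverse_eq_divide)
qed

text \<open>The column from \<psi> is concentrated at low indices and the row from \<eta> at high
  ones; such a pairing has limit \<open>0\<close>.\<close>

lemma det_H_asymp:
  fixes A B d c :: "nat \<Rightarrow> complex"
  assumes d: "\<And>j. j \<in> {1..m\<^sub>1} \<Longrightarrow> d j \<notin> sphere 0 1" "\<And>j. j \<in> {1..m\<^sub>1} \<Longrightarrow> 1 < cmod (d j) \<Longrightarrow> \<rho> < cmod (d j)"
    and c: "\<And>k. k \<in> {1..m\<^sub>2} \<Longrightarrow> c k \<notin> sphere 0 1" "\<And>k. k \<in> {1..m\<^sub>2} \<Longrightarrow> 1 < cmod (c k) \<Longrightarrow> \<rho> < cmod (c k)"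
  shows "szego_asymp (\<lambda>n. det_H (n + 1) \<phi> (\<lambda>z. \<Sum>j=1..m\<^sub>1. A j / (z - d j)) (\<lambda>z. \<Sum>k=1..m\<^sub>2. B k / (z - c k)) a)
    (szego_G \<phi>) (szego_E \<phi>) a \<rho>"
proof -
  let ?I = "{j. j \<in> {1..m\<^sub>1} \<and> 1 < cmod (d j)}" and ?J = "{k. k \<in> {1..m\<^sub>2} \<and> 1 < cmod (c k)}"
  have "szego_asymp (\<lambda>n. det_H (n + 1) \<phi> (\<lambda>z. \<Sum>j=1..m\<^sub>1. A j / (z - d j)) (\<lambda>z. \<Sum>k=1..m\<^sub>2. B k / (z - c k)) a)
      (szego_G \<phi>) (szego_E \<phi>) (a - (\<Sum>l\<in>?I. \<Sum>m\<in>?J. A l * B m * 0) / szego_G \<phi>) \<rho>"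
  proof (rule semi_framed_asymp)
    show "det_H (n + 1) \<phi> (\<lambda>z. \<Sum>j=1..m\<^sub>1. A j / (z - d j)) (\<lambda>z. \<Sum>k=1..m\<^sub>2. B k / (z - c k)) a
        = Determinant.det (semi_framed_mat \<phi> (\<lambda>k. \<Sum>l\<in>?I. A l * - (1 / d l ^ Suc k))
          (\<lambda>k. \<Sum>m\<in>?J. B m * - (1 / c m ^ (n - k))) a (n + 1))" for n
      unfolding det_H_def
      by (rule det_semi_framed_cong)
         (simp_all only: add_diff_cancel_right' reversed_index fourier_coeff_rational[OF d(1)] fourier_coeff_rational[OF c(1)])
    fix l m assume "l \<in> ?I" "m \<in> ?J"
    then have lm: "\<rho> < cmod (d l)" "\<rho> < cmod (c m)" using d c by auto
    have "(\<lambda>n. W (F 1) (F (- 1)) n (\<lambda>k. - (1 / d l ^ Suc k)) (\<lambda>k. - (1 / c m ^ (n - k))))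
        \<in> O(\<lambda>n. complex_of_real (inverse \<rho>) ^ n)"
      by (rule W_top_bottom_bigo[OF decays_F decays_F fdet_limit inverse_less_rho[OF lm(1)] inverse_less_rho[OF lm(2)]
            expansion_sums_inverse[OF hol_F lm(2), of "- 1", folded F_def]])
    then show "(\<lambda>n. W (F 1) (F (- 1)) n (\<lambda>k. - (1 / d l ^ Suc k)) (\<lambda>k. - (1 / c m ^ (n - k))) - szego_E \<phi> * 0)
        \<in> O(\<lambda>n. inverse (of_real \<rho>) ^ n)" by simp
  qed auto
  then show ?thesis by simp
qed

text \<open>The mirror image: the column is concentrated at high indices, the row at low ones, and
  the limit is again \<open>0\<close>.\<close>

lemma det_L_asymp:
  fixes A B d c :: "nat \<Rightarrow> complex"
  assumes d: "\<And>j. j \<in> {1..m\<^sub>1} \<Longrightarrow> d j \<notin> sphere 0 1" "\<And>j. j \<in> {1..m\<^sub>1} \<Longrightarrow> 1 < cmod (d j) \<Longrightarrow> \<rho> < cmod (d j)"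
    and c: "\<And>k. k \<in> {1..m\<^sub>2} \<Longrightarrow> c k \<notin> sphere 0 1" "\<And>k. k \<in> {1..m\<^sub>2} \<Longrightarrow> 1 < cmod (c k) \<Longrightarrow> \<rho> < cmod (c k)"
  shows "szego_asymp (\<lambda>n. det_L (n + 1) \<phi> (\<lambda>z. \<Sum>j=1..m\<^sub>1. A j / (z - d j)) (\<lambda>z. \<Sum>k=1..m\<^sub>2. B k / (z - c k)) a)
    (szego_G \<phi>) (szego_E \<phi>) a \<rho>"
proof -
  let ?I = "{j. j \<in> {1..m\<^sub>1} \<and> 1 < cmod (d j)}" and ?J = "{k. k \<in> {1..m\<^sub>2} \<and> 1 < cmod (c k)}"
  have "szego_asymp (\<lambda>n. det_L (n + 1) \<phi> (\<lambda>z. \<Sum>j=1..m\<^sub>1. A j / (z - d j)) (\<lambda>z. \<Sum>k=1..m\<^sub>2. B k / (z - c k)) a)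
      (szego_G \<phi>) (szego_E \<phi>) (a - (\<Sum>l\<in>?I. \<Sum>m\<in>?J. A l * B m * 0) / szego_G \<phi>) \<rho>"
  proof (rule semi_framed_asymp)
    show "det_L (n + 1) \<phi> (\<lambda>z. \<Sum>j=1..m\<^sub>1. A j / (z - d j)) (\<lambda>z. \<Sum>k=1..m\<^sub>2. B k / (z - c k)) a
        = Determinant.det (semi_framed_mat \<phi> (\<lambda>k. \<Sum>l\<in>?I. A l * - (1 / d l ^ (n - k)))
          (\<lambda>k. \<Sum>m\<in>?J. B m * - (1 / c m ^ Suc k)) a (n + 1))" for n
      unfolding det_L_def
      by (rule det_semi_framed_cong)
         (simp_all only: add_diff_cancel_right' reversed_index fourier_coeff_rational[OF d(1)] fourier_coeff_rational[OF c(1)])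
    fix l m assume "l \<in> ?I" "m \<in> ?J"
    then have lm: "\<rho> < cmod (d l)" "\<rho> < cmod (c m)" using d c by auto
    have "(\<lambda>n. W (F 1) (F (- 1)) n (\<lambda>k. - (1 / d l ^ (n - k))) (\<lambda>k. - (1 / c m ^ Suc k)))
        \<in> O(\<lambda>n. complex_of_real (inverse \<rho>) ^ n)"
      by (rule W_bottom_top_bigo[OF decays_F decays_F fdet_limit inverse_less_rho[OF lm(1)] inverse_less_rho[OF lm(2)]
            expansion_sums_inverse[OF hol_e lm(1), folded e_def]])
    then show "(\<lambda>n. W (F 1) (F (- 1)) n (\<lambda>k. - (1 / d l ^ (n - k))) (\<lambda>k. - (1 / c m ^ Suc k)) - szego_E \<phi> * 0)
        \<in> O(\<lambda>n. inverse (of_real \<rho>) ^ n)" by simp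
  qed auto
  then show ?thesis by simp
qed

text \<open>Both borders are concentrated at high indices, so each pair of outer poles leaves a
  nontrivial limit, which \<open>alpha_quotient\<close> rewrites in terms of
  \<open>szego_alpha\<close>.\<close>

lemma det_E_asymp:
  fixes A B d c :: "nat \<Rightarrow> complex"
  assumes d: "\<And>j. j \<in> {1..m\<^sub>1} \<Longrightarrow> d j \<notin> sphere 0 1" "\<And>j. j \<in> {1..m\<^sub>1} \<Longrightarrow> 1 < cmod (d j) \<Longrightarrow> \<rho> < cmod (d j)"
    and c: "\<And>k. k \<in> {1..m\<^sub>2} \<Longrightarrow> c k \<notin> sphere 0 1" "\<And>k. k \<in> {1..m\<^sub>2} \<Longrightarrow> 1 < cmod (c k) \<Longrightarrow> \<rho> < cmod (c k)"
  shows "szego_asymp (\<lambda>n. det_E (n + 1) \<phi> (\<lambda>z. \<Sum>j=1..m\<^sub>1. A j / (z - d j)) (\<lambda>z. \<Sum>k=1..m\<^sub>2. B k / (z - c k)) a)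
    (szego_G \<phi>) (szego_E \<phi>)
    (a + (\<Sum>j | j \<in> {1..m\<^sub>1} \<and> 1 < cmod (d j). \<Sum>k | k \<in> {1..m\<^sub>2} \<and> 1 < cmod (c k).
       A j * B k * (szego_alpha \<phi> (c k) / szego_alpha \<phi> (inverse (d j))) * (1 / (1 - c k * d j)))) \<rho>"
proof -
  let ?I = "{j. j \<in> {1..m\<^sub>1} \<and> 1 < cmod (d j)}" and ?J = "{k. k \<in> {1..m\<^sub>2} \<and> 1 < cmod (c k)}"
  let ?w = "\<lambda>l m. exp (P 0 - P (1 / d l)) * exp (- 1 * Q (1 / c m)) / (c m * d l - 1)"
  have "szego_asymp (\<lambda>n. det_E (n + 1) \<phi> (\<lambda>z. \<Sum>j=1..m\<^sub>1. A j / (z - d j)) (\<lambda>z. \<Sum>k=1..m\<^sub>2. B k / (z - c k)) a)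
      (szego_G \<phi>) (szego_E \<phi>) (a - (\<Sum>l\<in>?I. \<Sum>m\<in>?J. A l * B m * ?w l m) / szego_G \<phi>) \<rho>"
  proof (rule semi_framed_asymp)
    show "det_E (n + 1) \<phi> (\<lambda>z. \<Sum>j=1..m\<^sub>1. A j / (z - d j)) (\<lambda>z. \<Sum>k=1..m\<^sub>2. B k / (z - c k)) a
        = Determinant.det (semi_framed_mat \<phi> (\<lambda>k. \<Sum>l\<in>?I. A l * - (1 / d l ^ (n - k)))
          (\<lambda>k. \<Sum>m\<in>?J. B m * - (1 / c m ^ (n - k))) a (n + 1))" for n
      unfolding det_E_def
      by (rule det_semi_framed_cong)
         (simp_all only: add_diff_cancel_right' reversed_index fourier_coeff_rational[OF d(1)] fourier_coeff_rational[OF c(1)])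
    fix l m assume "l \<in> ?I" "m \<in> ?J"
    then have lm: "\<rho> < cmod (d l)" "\<rho> < cmod (c m)" using d c by auto
    then have nz: "c m \<noteq> 0" "d l \<noteq> 0" using rho by auto
    have "(\<lambda>n. W (F 1) (F (- 1)) n (\<lambda>k. - (1 / d l ^ (n - k))) (\<lambda>k. - (1 / c m ^ (n - k))) - szego_E \<phi> * ?w l m)
        \<in> O(\<lambda>n. complex_of_real (inverse \<rho>) ^ n)"
      by (rule W_bottom_bottom_bigo[OF decays_F decays_F fdet_limit nz inverse_less_rho[OF lm(1)] inverse_less_rho[OF lm(2)]
            expansion_sums_inverse[OF hol_e lm(1), folded e_def] expansion_sums_inverse[OF hol_F lm(2), of "- 1", folded F_def]])
    then show "(\<lambda>n. W (F 1) (F (- 1)) n (\<lambda>k. - (1 / d l ^ (n - k))) (\<lambda>k. - (1 / c m ^ (n - k))) - szego_E \<phi> * ?w l m)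
        \<in> O(\<lambda>n. inverse (of_real \<rho>) ^ n)" by (simp only: of_real_inverse)
  qed auto
  also have "a - (\<Sum>l\<in>?I. \<Sum>m\<in>?J. A l * B m * ?w l m) / szego_G \<phi>
      = a + (\<Sum>l\<in>?I. \<Sum>m\<in>?J. A l * B m * (- ?w l m / szego_G \<phi>))"
    by (simp add: sum_divide_distrib sum_negf)
  also have "(\<Sum>l\<in>?I. \<Sum>m\<in>?J. A l * B m * (- ?w l m / szego_G \<phi>))
      = (\<Sum>l\<in>?I. \<Sum>m\<in>?J. A l * B m * (szego_alpha \<phi> (c m) / szego_alpha \<phi> (inverse (d l))) * (1 / (1 - c m * d l)))"
  proof (intro sum.cong refl)
    fix l m assume "l \<in> ?I" "m \<in> ?J"
    then have "\<rho> < cmod (c m)" "\<rho> < cmod (d l)" using d c by auto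
    from alpha_quotient[OF this]
    show "A l * B m * (- ?w l m / szego_G \<phi>)
        = A l * B m * (szego_alpha \<phi> (c m) / szego_alpha \<phi> (inverse (d l))) * (1 / (1 - c m * d l))"
      by (simp only: mult.assoc)
  qed
  finally show ?thesis .
qed

end

theorem theorem1p15:
  fixes \<phi> \<psi> \<eta> :: "complex \<Rightarrow> complex" and a :: complex
    and m\<^sub>1 m\<^sub>2 :: nat and d c A B :: "nat \<Rightarrow> complex"
  assumes "szego_type \<phi>"
    and "\<And>j. j \<in> {1..m\<^sub>1} \<Longrightarrow> d j \<notin> sphere 0 1"
    and "\<And>k. k \<in> {1..m\<^sub>2} \<Longrightarrow> c k \<notin> sphere 0 1"
    and "\<psi> = (\<lambda>z. \<Sum>j=1..m\<^sub>1. A j / (z - d j))"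
    and "\<eta> = (\<lambda>z. \<Sum>k=1..m\<^sub>2. B k / (z - c k))"
  shows "(\<exists>\<rho>. admissible_radius \<phi> (d ` {1..m\<^sub>1} \<union> c ` {1..m\<^sub>2}) \<rho>) \<and>
    (\<forall>\<rho>. admissible_radius \<phi> (d ` {1..m\<^sub>1} \<union> c ` {1..m\<^sub>2}) \<rho> \<longrightarrow>
       szego_asymp (\<lambda>n. det_H (n + 1) \<phi> \<psi> \<eta> a) (szego_G \<phi>) (szego_E \<phi>) a \<rho> \<and>
       szego_asymp (\<lambda>n. det_L (n + 1) \<phi> \<psi> \<eta> a) (szego_G \<phi>) (szego_E \<phi>) a \<rho> \<and>
       szego_asymp (\<lambda>n. det_E (n + 1) \<phi> \<psi> \<eta> a) (szego_G \<phi>) (szego_E \<phi>)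
         (a + (\<Sum>j | j \<in> {1..m\<^sub>1} \<and> cmod (d j) > 1. \<Sum>k | k \<in> {1..m\<^sub>2} \<and> cmod (c k) > 1.
            A j * B k * (szego_alpha \<phi> (c k) / szego_alpha \<phi> (inverse (d j)))
              * (1 / (1 - c k * d j)))) \<rho> \<and>
       szego_asymp (\<lambda>n. det_G (n + 1) \<phi> \<psi> \<eta> a) (szego_G \<phi>) (szego_E \<phi>)
         (a + (\<Sum>j | j \<in> {1..m\<^sub>1} \<and> cmod (d j) > 1. \<Sum>k | k \<in> {1..m\<^sub>2} \<and> cmod (c k) > 1.
            A j * B k * (szego_alpha \<phi> (d j) / szego_alpha \<phi> (inverse (c k)))
              * (1 / (1 - c k * d j)))) \<rho>)"
proof (intro conjI allI impI)
  let ?\<Lambda> = "d ` {1..m\<^sub>1} \<union> c ` {1..m\<^sub>2}"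
  show "\<exists>\<rho>. admissible_radius \<phi> ?\<Lambda> \<rho>"
    using assms(2,3) by (intro admissible_radius_exists[OF assms(1)]) auto
  fix \<rho> assume \<rho>: "admissible_radius \<phi> ?\<Lambda> \<rho>"
  obtain s P Q where "szego_factorization \<phi> \<rho> s P Q"
    using szego_factorization_exists[OF assms(1) \<rho>] by blast
  then interpret szego_factorization \<phi> \<rho> s P Q .
  have d: "\<rho> < cmod (d j)" if "j \<in> {1..m\<^sub>1}" "1 < cmod (d j)" for j
    using \<rho> that unfolding admissible_radius_def by blast
  have c: "\<rho> < cmod (c k)" if "k \<in> {1..m\<^sub>2}" "1 < cmod (c k)" for k
    using \<rho> that unfolding admissible_radius_def by blast
  show "szego_asymp (\<lambda>n. det_H (n + 1) \<phi> \<psi> \<eta> a) (szego_G \<phi>) (szego_E \<phi>) a \<rho>"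
    unfolding assms(4,5) by (rule det_H_asymp[OF assms(2) d assms(3) c])
  show "szego_asymp (\<lambda>n. det_L (n + 1) \<phi> \<psi> \<eta> a) (szego_G \<phi>) (szego_E \<phi>) a \<rho>"
    unfolding assms(4,5) by (rule det_L_asymp[OF assms(2) d assms(3) c])
  show "szego_asymp (\<lambda>n. det_E (n + 1) \<phi> \<psi> \<eta> a) (szego_G \<phi>) (szego_E \<phi>)
         (a + (\<Sum>j | j \<in> {1..m\<^sub>1} \<and> cmod (d j) > 1. \<Sum>k | k \<in> {1..m\<^sub>2} \<and> cmod (c k) > 1.
            A j * B k * (szego_alpha \<phi> (c k) / szego_alpha \<phi> (inverse (d j)))
              * (1 / (1 - c k * d j)))) \<rho>"
    unfolding assms(4,5) by (rule det_E_asymp[OF assms(2) d assms(3) c])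
  \<comment> \<open>The reduction to \<open>det_E\<close> exchanges the families \<open>d\<close>
    and \<open>c\<close>; the double sum is reordered to match.\<close>
  have eq: "(\<Sum>k | k \<in> {1..m\<^sub>2} \<and> cmod (c k) > 1. \<Sum>j | j \<in> {1..m\<^sub>1} \<and> cmod (d j) > 1.
            B k * A j * (szego_alpha \<phi> (d j) / szego_alpha \<phi> (inverse (c k))) * (1 / (1 - d j * c k)))
      = (\<Sum>j | j \<in> {1..m\<^sub>1} \<and> cmod (d j) > 1. \<Sum>k | k \<in> {1..m\<^sub>2} \<and> cmod (c k) > 1.
            A j * B k * (szego_alpha \<phi> (d j) / szego_alpha \<phi> (inverse (c k))) * (1 / (1 - c k * d j)))"
    by (subst sum.swap) (simp only: mult.commute[of "B _"] mult.commute[of "d _" "c _"])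
  show "szego_asymp (\<lambda>n. det_G (n + 1) \<phi> \<psi> \<eta> a) (szego_G \<phi>) (szego_E \<phi>)
         (a + (\<Sum>j | j \<in> {1..m\<^sub>1} \<and> cmod (d j) > 1. \<Sum>k | k \<in> {1..m\<^sub>2} \<and> cmod (c k) > 1.
            A j * B k * (szego_alpha \<phi> (d j) / szego_alpha \<phi> (inverse (c k)))
              * (1 / (1 - c k * d j)))) \<rho>"
    unfolding det_G_eq_det_E assms(4,5) eq[symmetric] by (rule det_E_asymp[OF assms(3) c assms(2) d])
qed

end
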